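(* For all integers $i,j,k\ge 1$: one has both $\mathrm{C}_{\sharp\le i+1}\le_{\mathrm W}\mathrm{XC}_j$ and $\mathrm{XC}_j\le_{\mathrm W}\mathrm{Sort}_{k+1}$ if and only if $i\le j\le k$.
   Context: A represented space $\mathbf X$ is a set $X$ with a partial surjection $\delta_{\mathbf X}:\subseteq\mathbb N^{\mathbb N}\to X$ (a $p$ with $\delta_{\mathbf X}(p)=x$ is a name of $x$). A realizer of a (partial) multivalued function $f:\subseteq\mathbf X\rightrightarrows\mathbf Y$ is a partial $F:\subseteq\mathbb N^{\mathbb N}\to\mathbb N^{\mathbb N}$ with $\delta_{\mathbf Y}(F(p))\in f(\delta_{\mathbf X}(p))$ for all names $p$ of points of $\mathrm{dom}(f)$; write $F\vdash f$. Weihrauch reducibility: $f\le_{\mathrm W}g$ iff there are computable $H,K:\subseteq\mathbb N^{\mathbb N}\to\mathbb N^{\mathbb N}$ such that $(p\mapsto K\langle p,GH(p)\rangle)\vdash f$ for every $G\vdash g$. $\mathcal A(\mathbf X)$ is the represented space of closed subsets of $\mathbf X$ with negative information: a name of $A$ is a name of the open set $X\setminus A$ (its continuous characteristic function into Sierpiński space). Closed choice $\mathrm C_{\mathbf X}:\subseteq\mathcal A(\mathbf X)\rightrightarrows\mathbf X$ maps a non-empty closed set $A$ to an arbitrary point of $A$. $\mathrm C_{\sharp\le n}$ is the restriction of $\mathrm C_{\{0,1\}^{\mathbb N}}$ to closed sets $A$ with $1\le|A|\le n$ (up to Weihrauch equivalence one may use $[0,1]^d$, $d\geq 1$, instead of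 $\{0,1\}^{\mathbb N}$). $\mathrm{XC}_n$ is the restriction of $\mathrm C_{[0,1]^n}$ to (non-empty closed) convex sets. $\mathrm{Sort}_d:\{0,\dots,d-1\}^\omega\to\{0,\dots,d-1\}^\omega$ is defined by $\mathrm{Sort}_d(p)=0^{c_0}1^{c_1}\cdots(m-1)^{c_{m-1}}m^{\infty}$, where $m$ is the least symbol occurring infinitely often in $p$ and $c_l=|\{n: p(n)=l\}|$ for $l<m$. *)

theory Defs
  imports Complex_Main "HOL-Library.Nat_Bijection"
begin

section \<open>Computability on Baire space\<close>

type_synonym baire = "nat \<Rightarrow> nat"

text \<open>Programs for the partial recursive functions relative to an oracle.\<close>

datatype prog =
    Zero | Succ | Proj nat | Query
  | Comp prog "prog list"
  | Prec prog prog
  | Mu prog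

inductive eval :: "baire \<Rightarrow> prog \<Rightarrow> nat list \<Rightarrow> nat \<Rightarrow> bool" for p :: baire where
  "eval p Zero xs 0"
| "eval p Succ [x] (Suc x)"
| "i < length xs \<Longrightarrow> eval p (Proj i) xs (xs ! i)"
| "eval p Query [x] (p x)"
| "length ys = length gs \<Longrightarrow> (\<And>i. i < length gs \<Longrightarrow> eval p (gs ! i) xs (ys ! i)) \<Longrightarrow>
     eval p f ys z \<Longrightarrow> eval p (Comp f gs) xs z"
| "eval p f xs y \<Longrightarrow> eval p (Prec f g) (0 # xs) y"
| "eval p (Prec f g) (n # xs) y \<Longrightarrow> eval p g (n # y # xs) z \<Longrightarrow> eval p (Prec f g) (Suc n # xs) z"
| "eval p f (n # xs) 0 \<Longrightarrow> (\<And>m. m < n \<Longrightarrow> \<exists>y. eval p f (m # xs) (Suc y)) \<Longrightarrow> eval p (Mu f) xs n"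

text \<open>As usual for partial functions on Baire space, nothing is required outside the domain.\<close>

definition computable :: "(baire \<rightharpoonup> baire) \<Rightarrow> bool" where
  "computable F \<longleftrightarrow> (\<exists>e. \<forall>p q. F p = Some q \<longrightarrow> (\<forall>n. eval p e [n] (q n)))"

definition pairing :: "baire \<Rightarrow> baire \<Rightarrow> baire" where
  "pairing p q n = (if even n then p (n div 2) else q (n div 2))"


section \<open>Represented spaces and Weihrauch reducibility\<close>

text \<open>A represented space is given by its representation; the underlying set is the range
  \<^term>\<open>ran \<delta>\<close>, so that surjectivity is automatic.\<close>

type_synonym 'a rep_space = "baire \<rightharpoonup> 'a"

definition rep_of :: "(baire \<Rightarrow> 'a \<Rightarrow> bool) \<Rightarrow> 'a rep_space" where
  "rep_of R p = (if \<exists>!x. R p x then Some (THE x. R p x) else None)"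

lemma rep_of_eq_Some:
  assumes "\<And>x y. R p x \<Longrightarrow> R p y \<Longrightarrow> x = y"
  shows "rep_of R p = Some x \<longleftrightarrow> R p x"
proof
  assume "rep_of R p = Some x"
  then show "R p x"
    by (auto simp: rep_of_def split: if_splits intro: theI')
next
  assume "R p x"
  with assms have "\<exists>!x. R p x" "(THE x. R p x) = x"
    by (blast, blast)
  then show "rep_of R p = Some x"
    by (simp add: rep_of_def)
qed

text \<open>A partial multivalued function between represented spaces; its domain consists of the
  points of \<open>ran (source f)\<close> at which \<open>val f\<close> is non-empty.\<close>

record ('a, 'b) problem =
  source :: "'a rep_space"
  target :: "'b rep_space"
  val :: "'a \<Rightarrow> 'b set"

definition realizes :: "(baire \<rightharpoonup> baire) \<Rightarrow> ('a, 'b) problem \<Rightarrow> bool" (infix "\<turnstile>" 50) where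
  "F \<turnstile> f \<longleftrightarrow> (\<forall>p x. source f p = Some x \<and> val f x \<noteq> {} \<longrightarrow>
     (\<exists>q y. F p = Some q \<and> target f q = Some y \<and> y \<in> val f x))"

definition weihrauch_le :: "('a, 'b) problem \<Rightarrow> ('c, 'd) problem \<Rightarrow> bool" (infix "\<le>\<^sub>W" 50) where
  "f \<le>\<^sub>W g \<longleftrightarrow> (\<exists>H K. computable H \<and> computable K \<and>
     (\<forall>G. G \<turnstile> g \<longrightarrow>
       (\<lambda>p. Option.bind (H p) (\<lambda>h. Option.bind (G h) (\<lambda>q. K (pairing p q)))) \<turnstile> f))"


section \<open>The space of closed sets and closed choice\<close>

text \<open>\<open>associate p q r\<close>: the partial continuous function with Kleene associate \<open>p\<close>
  maps \<open>q\<close> to \<open>r\<close>.\<close>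

definition associate :: "baire \<Rightarrow> baire \<Rightarrow> baire \<Rightarrow> bool" where
  "associate p q r \<longleftrightarrow> (\<forall>n. \<exists>k. p (list_encode (n # map q [0..<k])) = Suc (r n) \<and>
     (\<forall>l<k. p (list_encode (n # map q [0..<l])) = 0))"

text \<open>\<open>p\<close> is a name of \<open>f\<close> as a point of the space of continuous functions from
  \<open>X\<close> to \<open>Y\<close>.\<close>

definition fun_name :: "'a rep_space \<Rightarrow> 'b rep_space \<Rightarrow> baire \<Rightarrow> ('a \<Rightarrow> 'b) \<Rightarrow> bool" where
  "fun_name X Y p f \<longleftrightarrow>
     (\<forall>q x. X q = Some x \<longrightarrow> (\<exists>r. associate p q r \<and> Y r = Some (f x)))"

text \<open>Sierpinski space, with \<^term>\<open>True\<close> as its open point.\<close>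

definition sierpinski :: "bool rep_space" where
  "sierpinski p = Some (\<exists>n. p n \<noteq> 0)"

definition closed_name :: "'a rep_space \<Rightarrow> baire \<Rightarrow> 'a set \<Rightarrow> bool" where
  "closed_name X p A \<longleftrightarrow> A \<subseteq> ran X \<and> fun_name X sierpinski p (\<lambda>x. x \<notin> A)"

definition closed_sets :: "'a rep_space \<Rightarrow> 'a set rep_space" where
  "closed_sets X = rep_of (closed_name X)"

definition closed_choice :: "'a rep_space \<Rightarrow> ('a set, 'a) problem" where
  "closed_choice X = \<lparr>source = closed_sets X, target = X, val = (\<lambda>A. A)\<rparr>"

definition restrict_problem :: "('a, 'b) problem \<Rightarrow> ('a \<Rightarrow> bool) \<Rightarrow> ('a, 'b) problem" where
  "restrict_problem f P = f\<lparr>val := (\<lambda>x. if P x then val f x else {})\<rparr>"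

lemma associate_unique:
  assumes "associate p q r" "associate p q s"
  shows "r = s"
proof
  fix n
  obtain k where k: "p (list_encode (n # map q [0..<k])) = Suc (r n)"
    "\<forall>l<k. p (list_encode (n # map q [0..<l])) = 0"
    using assms(1) unfolding associate_def by blast
  obtain k' where k': "p (list_encode (n # map q [0..<k'])) = Suc (s n)"
    "\<forall>l<k'. p (list_encode (n # map q [0..<l])) = 0"
    using assms(2) unfolding associate_def by blast
  have "k = k'"
    using k k' by (metis linorder_neqE_nat nat.distinct(1))
  then show "r n = s n"
    using k k' by simp
qed

lemma closed_name_unique:
  assumes "closed_name X p A" "closed_name X p B"
  shows "A = B"
proof -
  have "x \<in> A \<longleftrightarrow> x \<in> B" if qx: "X q = Some x" for q x
  proof -
    obtain r where "associate p q r" "sierpinski r = Some (x \<notin> A)"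
      using assms(1) qx unfolding closed_name_def fun_name_def by blast
    moreover obtain s where "associate p q s" "sierpinski s = Some (x \<notin> B)"
      using assms(2) qx unfolding closed_name_def fun_name_def by blast
    ultimately show ?thesis
      using associate_unique by fastforce
  qed
  moreover have "A \<subseteq> ran X" "B \<subseteq> ran X"
    using assms by (auto simp: closed_name_def)
  ultimately show ?thesis
    by (fastforce simp: ran_def)
qed

lemma closed_sets_eq_Some: "closed_sets X p = Some A \<longleftrightarrow> closed_name X p A"
  unfolding closed_sets_def by (intro rep_of_eq_Some closed_name_unique)


section \<open>Sequence spaces, finite choice and sorting\<close>

text \<open>The space of sequences over \<open>{0, \<dots>, d - 1}\<close>; Cantor space is \<open>words 2\<close>.\<close>

definition words :: "nat \<Rightarrow> baire rep_space" where
  "words d p = (if \<forall>n. p n < d then Some p else None)"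

definition finite_choice :: "nat \<Rightarrow> (baire set, baire) problem" where
  "finite_choice n =
     restrict_problem (closed_choice (words 2)) (\<lambda>A. finite A \<and> 1 \<le> card A \<and> card A \<le> n)"

definition sort_seq :: "baire \<Rightarrow> baire" where
  "sort_seq p = (let m = (LEAST s. infinite {n. p n = s});
                     w = concat (map (\<lambda>l. replicate (card {n. p n = l}) l) [0..<m])
                 in (\<lambda>n. if n < length w then w ! n else m))"

definition Sort :: "nat \<Rightarrow> (baire, baire) problem" where
  "Sort d = \<lparr>source = words d, target = words d, val = (\<lambda>p. {sort_seq p})\<rparr>"


section \<open>Convex choice\<close>

text \<open>Every natural number codes a rational number, and every rational number has a code.\<close>

definition rat_code :: "nat \<Rightarrow> real" where
  "rat_code c = (case prod_decode c of (a, b) \<Rightarrow> of_int (int_decode a) / of_nat (Suc b))"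

definition cauchy_name :: "baire \<Rightarrow> real \<Rightarrow> bool" where
  "cauchy_name p x \<longleftrightarrow> (\<forall>m. \<bar>rat_code (p m) - x\<bar> \<le> (1/2) ^ m)"

text \<open>Points of \<open>n\<close>-dimensional space are sequences of reals that vanish from index \<open>n\<close> on.
  A name of a point interleaves names of its \<open>n\<close> coordinates.\<close>

definition cube_name :: "nat \<Rightarrow> baire \<Rightarrow> (nat \<Rightarrow> real) \<Rightarrow> bool" where
  "cube_name n p x \<longleftrightarrow>
     (\<forall>i<n. 0 \<le> x i \<and> x i \<le> 1 \<and> cauchy_name (\<lambda>m. p (n * m + i)) (x i)) \<and> (\<forall>i\<ge>n. x i = 0)"

definition cube :: "nat \<Rightarrow> (nat \<Rightarrow> real) rep_space" where
  "cube n = rep_of (cube_name n)"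

definition convex_set :: "(nat \<Rightarrow> real) set \<Rightarrow> bool" where
  "convex_set A \<longleftrightarrow>
     (\<forall>x\<in>A. \<forall>y\<in>A. \<forall>t. 0 \<le> t \<and> t \<le> 1 \<longrightarrow> (\<lambda>i. (1 - t) * x i + t * y i) \<in> A)"

definition XC :: "nat \<Rightarrow> ((nat \<Rightarrow> real) set, nat \<Rightarrow> real) problem" where
  "XC n = restrict_problem (closed_choice (cube n)) convex_set"

lemma cauchy_name_unique:
  assumes "cauchy_name p x" "cauchy_name p y"
  shows "x = y"
proof (rule ccontr)
  assume "x \<noteq> y"
  then obtain m where m: "(1/2) ^ m < \<bar>x - y\<bar> / 2"
    using real_arch_pow_inv[of "\<bar>x - y\<bar> / 2" "1/2"] by auto
  have "\<bar>rat_code (p m) - x\<bar> \<le> (1/2) ^ m" "\<bar>rat_code (p m) - y\<bar> \<le> (1/2) ^ m"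
    using assms by (auto simp: cauchy_name_def)
  moreover have "\<bar>x - y\<bar> \<le> \<bar>rat_code (p m) - x\<bar> + \<bar>rat_code (p m) - y\<bar>"
    by linarith
  ultimately show False
    using m by argo
qed

lemma cube_name_unique:
  assumes "cube_name n p x" "cube_name n p y"
  shows "x = y"
proof
  fix i
  show "x i = y i"
    using assms cauchy_name_unique[of "\<lambda>m. p (n * m + i)" "x i" "y i"]
    by (cases "i < n") (auto simp: cube_name_def)
qed

lemma cube_eq_Some: "cube n p = Some x \<longleftrightarrow> cube_name n p x"
  unfolding cube_def by (intro rep_of_eq_Some cube_name_unique)

end

theory Submission
  imports Defs "HOL-Computational_Algebra.Polynomial"
begin

text \<open>
  Finite choice reduces to convex choice because points \<open>(t, t\<^sup>2, \<dots>, t\<^sup>n)\<close> of the moment curve are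
  affinely independent (up to \<open>n + 1\<close> of them): embed Cantor space into the unit interval by ternary
  expansions and map \<open>A\<close> to the convex hull of the corresponding points of the moment curve. A point of
  the hull has unique barycentric coordinates, and a branch of \<open>A\<close> is found by always moving into a
  cylinder that is seen to carry positive weight.

  Convex choice reduces to sorting by fixing the coordinates one after the other at dyadic values: a
  convex set without a point having a dyadic value in a given free coordinate is constant in that
  coordinate. The number of occurrences of symbol \<open>l\<close> counts the refuted guesses for the \<open>l\<close>-th
  coordinate to be fixed. Once the face given by the correct guesses is known, it meets the set in a
  single point, which compactness allows to compute.

  Finite choice among \<open>n + 1\<close> points does not reduce to sorting with \<open>n\<close> symbols, even continuously:
  one builds closed sets with \<open>l + 1\<close> points, the names of which force the symbols below \<open>l\<close> to occur
  finitely often. For \<open>l = n\<close> no symbol is left. The negative half of the theorem follows, since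
  continuous reducibility is transitive.
\<close>

text \<open>Negative information can refute that a point lies in a closed set but never confirm it.
  Both positive reductions therefore wait for refutations only: the points in question are
  parametrized by binary sequences, a bad sequence is recognized from finitely many bits, and
  compactness of Cantor space turns "every sequence is bad" into a finite event
  (\<open>ex_exhausted_iff\<close>). Redundant parameters, such as the two expansions of a dyadic
  number, do no harm there.

  The obstacle in the negative half is that the sorted sequence does not depend continuously on the
  input: a late occurrence of a small symbol moves everything behind it. It behaves continuously
  only among inputs that give the smaller symbols the same counts. This is why the construction
  fixes exact counts and not only finiteness, and why every set used against the backward map has to
  respect the finite condition that fixed them.\<close>

section \<open>Determinism and finite use of oracle computations\<close>

lemma eval_det: "eval p e xs y \<Longrightarrow> eval p e xs z \<Longrightarrow> y = z"
proof (induction arbitrary: z rule: eval.induct)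
  case (5 ys gs xs f w z)
  from 5(6) obtain ys' where ys': "length ys' = length gs"
    "\<And>i. i < length gs \<Longrightarrow> eval p (gs ! i) xs (ys' ! i)" "eval p f ys' z"
    by (cases rule: eval.cases) auto
  have "ys = ys'"
    using "5.hyps"(1) ys' "5.IH"(1) by (intro nth_equalityI) auto
  with ys'(3) "5.IH"(2) show ?case by blast
next
  case (7 f g n xs y w z)
  from 7(5) obtain y' where "eval p (Prec f g) (n # xs) y'" "eval p g (n # y' # xs) z"
    by (cases rule: eval.cases) auto
  with "7.IH" show ?case by blast
next
  case (8 f n xs z)
  from 8(4) have z: "eval p f (z # xs) 0" "\<And>m. m < z \<Longrightarrow> \<exists>y. eval p f (m # xs) (Suc y)"
    by (cases rule: eval.cases, auto)+
  show ?case
  proof (rule linorder_cases[of n z])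
    assume "n < z"
    then obtain y where "eval p f (n # xs) (Suc y)" using z(2) by blast
    then have "0 = Suc y" by (rule "8.IH"(1))
    then show ?thesis by simp
  next
    assume "z < n"
    then obtain y where "\<And>x. eval p f (z # xs) x \<Longrightarrow> Suc y = x" using "8.IH"(2) by blast
    from this[OF z(1)] show ?thesis by simp
  qed
next
  case (6 f xs y g)
  from 6(3) have "eval p f xs z"
    by (cases rule: eval.cases) auto
  with "6.IH" show ?case by blast
qed (erule eval.cases; simp)+

text \<open>A halting computation asks finitely many questions. In the \<open>Mu\<close> case the
  bounds of all smaller arguments are added up, since each of them must still be seen to give a
  nonzero value.\<close>

lemma eval_use:
  "eval p e xs z \<Longrightarrow> \<exists>m. \<forall>p'. (\<forall>i<m. p' i = p i) \<longrightarrow> eval p' e xs z"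
proof (induction rule: eval.induct)
  case (4 x)
  show ?case
    by (rule exI[of _ "Suc x"]) (metis eval.intros(4) lessI)
next
  case (5 ys gs xs f z)
  from "5.IH"(1) obtain M where M: "\<And>i p'. i < length gs \<Longrightarrow> (\<forall>j<M i. p' j = p j) \<Longrightarrow>
      eval p' (gs ! i) xs (ys ! i)"
    by metis
  from "5.IH"(2) obtain m where m: "\<And>p'. (\<forall>i<m. p' i = p i) \<Longrightarrow> eval p' f ys z"
    by blast
  define k where "k = m + (\<Sum>i<length gs. M i)"
  have le: "M i \<le> k" if "i < length gs" for i
    using that member_le_sum[of i "{..<length gs}" M] by (auto simp: k_def)
  show ?case
  proof (intro exI[of _ k] allI impI)
    fix p' assume p': "\<forall>i<k. p' i = p i"
    show "eval p' (Comp f gs) xs z"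
      by (rule eval.intros(5)[OF "5.hyps"(1)]) (use p' in \<open>auto simp: k_def intro!: M m dest!: less_le_trans[OF _ le]\<close>)
  qed
next
  case (7 f g n xs y z)
  then obtain m1 m2 where "\<And>p'. (\<forall>i<m1. p' i = p i) \<Longrightarrow> eval p' (Prec f g) (n # xs) y"
    "\<And>p'. (\<forall>i<m2. p' i = p i) \<Longrightarrow> eval p' g (n # y # xs) z"
    by blast
  then show ?case
    by (intro exI[of _ "max m1 m2"] allI impI eval.intros(7)[of _ _ _ n xs y]) auto
next
  case (8 f n xs)
  then obtain m1 where m1: "\<And>p'. (\<forall>i<m1. p' i = p i) \<Longrightarrow> eval p' f (n # xs) 0"
    by blast
  have "\<forall>m<n. \<exists>k. \<forall>p'. (\<forall>i<k. p' i = p i) \<longrightarrow> (\<exists>y. eval p' f (m # xs) (Suc y))"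
  proof (intro allI impI)
    fix m assume "m < n"
    from "8.IH"(2)[OF this] obtain y k where "\<forall>p'. (\<forall>i<k. p' i = p i) \<longrightarrow> eval p' f (m # xs) (Suc y)"
      by blast
    then show "\<exists>k. \<forall>p'. (\<forall>i<k. p' i = p i) \<longrightarrow> (\<exists>y. eval p' f (m # xs) (Suc y))"
      by blast
  qed
  then obtain M where M: "\<And>m p'. m < n \<Longrightarrow> (\<forall>j<M m. p' j = p j) \<Longrightarrow> \<exists>y. eval p' f (m # xs) (Suc y)"
    by metis
  define k where "k = m1 + (\<Sum>i<n. M i)"
  have le: "M i \<le> k" if "i < n" for i
    using that member_le_sum[of i "{..<n}" M] by (auto simp: k_def)
  show ?case
  proof (intro exI[of _ k] allI impI)
    fix p' assume p': "\<forall>i<k. p' i = p i"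
    show "eval p' (Mu f) xs n"
    proof (rule eval.intros(8))
      show "eval p' f (n # xs) 0"
        using p' by (intro m1) (auto simp: k_def)
      show "\<exists>y. eval p' f (m # xs) (Suc y)" if "m < n" for m
        using p' le[OF that] by (intro M that) auto
    qed
  qed
next
  case (6 f xs y g)
  then show ?case by (meson eval.intros(6))
qed (auto intro: eval.intros)

section \<open>Uniformly computable functionals\<close>

abbreviation \<pi>1 :: "nat \<Rightarrow> nat" where "\<pi>1 z \<equiv> fst (prod_decode z)"
abbreviation \<pi>2 :: "nat \<Rightarrow> nat" where "\<pi>2 z \<equiv> snd (prod_decode z)"

lemma eval_Proj: "i < length xs \<Longrightarrow> xs ! i = y \<Longrightarrow> eval p (Proj i) xs y"
  using eval.intros(3) by blast

lemma eval_Comp1: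
  assumes "eval p g xs y" "eval p f [y] z"
  shows "eval p (Comp f [g]) xs z"
  by (rule eval.intros(5)[of "[y]"]) (use assms in auto)

lemma eval_Comp2:
  assumes "eval p g xs y" "eval p g' xs y'" "eval p f [y, y'] z"
  shows "eval p (Comp f [g, g']) xs z"
  by (rule eval.intros(5)[of "[y, y']"]) (use assms in \<open>auto simp: less_Suc_eq nth_Cons'\<close>)

lemma eval_Prec_rec_nat:
  assumes "eval p f xs b" "\<And>k y. eval p g (k # y # xs) (s k y)"
  shows "eval p (Prec f g) (k # xs) (rec_nat b s k)"
  by (induction k) (use assms in \<open>auto intro: eval.intros\<close>)

section \<open>Programs for arithmetic, pairing and projections\<close>

definition prog_plus :: prog where
  "prog_plus = Prec (Proj 0) (Comp Succ [Proj 1])"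

definition prog_pred :: prog where
  "prog_pred = Prec Zero (Proj 0)"

text \<open>\<open>Prec\<close> recurses on its first argument, which for subtraction has to be the
  subtrahend; hence the swapped arguments.\<close>

definition prog_rminus :: prog where
  "prog_rminus = Prec (Proj 0) (Comp prog_pred [Proj 1])"

definition prog_triangle :: prog where
  "prog_triangle = Prec Zero (Comp prog_plus [Comp Succ [Proj 0], Proj 1])"

definition prog_pair :: prog where
  "prog_pair = Comp prog_plus [Comp prog_triangle [Comp prog_plus [Proj 0, Proj 1]], Proj 0]"

text \<open>The pair (x, y) has the code \<open>triangle (x + y) + x\<close>. Its diagonal x + y is
  the least s with \<open>z < triangle (Suc s)\<close>, which is tested by a truncated
  difference.\<close>

definition prog_diagonal :: prog where
  "prog_diagonal = Mu (Comp prog_rminus [Comp prog_triangle [Comp Succ [Proj 0]], Comp Succ [Proj 1]])"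

definition prog_fst :: prog where
  "prog_fst = Comp prog_rminus [Comp prog_triangle [prog_diagonal], Proj 0]"

definition prog_snd :: prog where
  "prog_snd = Comp prog_rminus [prog_fst, prog_diagonal]"

lemma eval_plus: "eval p prog_plus [k, x] (k + x)"
proof -
  have "rec_nat x (\<lambda>_. Suc) k = k + x"
    by (induction k) auto
  moreover have "eval p prog_plus [k, x] (rec_nat x (\<lambda>_. Suc) k)"
    unfolding prog_plus_def
    by (intro eval_Prec_rec_nat eval_Comp1[OF _ eval.intros(2)] eval_Proj) auto
  ultimately show ?thesis by simp
qed

lemma eval_pred: "eval p prog_pred [k] (k - 1)"
proof -
  have "rec_nat 0 (\<lambda>k _. k) k = k - 1"
    by (induction k) auto
  moreover have "eval p prog_pred [k] (rec_nat 0 (\<lambda>k _. k) k)"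
    unfolding prog_pred_def by (intro eval_Prec_rec_nat eval_Proj eval.intros) auto
  ultimately show ?thesis by simp
qed

lemma eval_rminus: "eval p prog_rminus [k, x] (x - k)"
proof -
  have "rec_nat x (\<lambda>_ y. y - 1) k = x - k"
    by (induction k) auto
  moreover have "eval p prog_rminus [k, x] (rec_nat x (\<lambda>_ y. y - 1) k)"
    unfolding prog_rminus_def
    by (intro eval_Prec_rec_nat eval_Comp1[OF _ eval_pred] eval_Proj) auto
  ultimately show ?thesis by simp
qed

lemma eval_triangle: "eval p prog_triangle [k] (triangle k)"
proof -
  have "rec_nat 0 (\<lambda>k y. Suc k + y) k = triangle k"
    by (induction k) auto
  moreover have "eval p prog_triangle [k] (rec_nat 0 (\<lambda>k y. Suc k + y) k)"
    unfolding prog_triangle_def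
    by (intro eval_Prec_rec_nat eval_Comp2[OF _ _ eval_plus] eval_Comp1[OF _ eval.intros(2)]
        eval_Proj eval.intros(1)) auto
  ultimately show ?thesis by simp
qed

lemma eval_pair: "eval p prog_pair [x, y] (prod_encode (x, y))"
  unfolding prog_pair_def prod_encode_def prod.case
  by (intro eval_Comp2[OF _ _ eval_plus] eval_Comp1[OF _ eval_triangle] eval_Proj) auto

lemma triangle_mono: "m \<le> n \<Longrightarrow> triangle m \<le> triangle n"
  by (induction n) (auto simp: le_Suc_eq)

lemma eval_diagonal: "eval p prog_diagonal [prod_encode (x, y)] (x + y)"
  unfolding prog_diagonal_def
proof (rule eval.intros(8))
  let ?z = "prod_encode (x, y)"
  let ?f = "Comp prog_rminus [Comp prog_triangle [Comp Succ [Proj 0]], Comp Succ [Proj 1]]"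
  have ev: "eval p ?f [s, ?z] (Suc ?z - triangle (Suc s))" for s
    by (intro eval_Comp2[OF _ _ eval_rminus] eval_Comp1[OF _ eval_triangle]
        eval_Comp1[OF _ eval.intros(2)] eval_Proj) auto
  show "eval p ?f [x + y, ?z] 0"
    using ev[of "x + y"] by (auto simp: prod_encode_def)
  fix m assume "m < x + y"
  then have "triangle (Suc m) \<le> ?z"
    using triangle_mono[of "Suc m" "x + y"] by (simp add: prod_encode_def)
  then show "\<exists>y. eval p ?f [m, ?z] (Suc y)"
    using ev[of m] by (metis Suc_diff_le)
qed

lemma eval_fst: "eval p prog_fst [z] (\<pi>1 z)"
proof (cases "prod_decode z")
  case (Pair x y)
  then have z: "z = prod_encode (x, y)"
    by (metis prod_decode_inverse)
  have "eval p prog_fst [z] (z - triangle (x + y))"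
    unfolding prog_fst_def z
    by (intro eval_Comp2[OF _ _ eval_rminus] eval_Comp1[OF _ eval_triangle] eval_diagonal eval_Proj) auto
  then show ?thesis
    by (simp add: z) (simp add: prod_encode_def)
qed

lemma eval_snd: "eval p prog_snd [z] (\<pi>2 z)"
proof (cases "prod_decode z")
  case (Pair x y)
  then have z: "z = prod_encode (x, y)"
    by (metis prod_decode_inverse)
  have "eval p prog_snd [z] (x + y - \<pi>1 z)"
    unfolding prog_snd_def
    by (intro eval_Comp2[OF _ _ eval_rminus] eval_fst) (simp add: z eval_diagonal)
  then show ?thesis
    by (simp add: z)
qed

section \<open>Closure properties of total functionals\<close>

text \<open>Totality in the oracle and in the argument frees closure under composition from domain
  conditions; several arguments are packed into one number. Partial maps enter with
  \<open>computable_search\<close>.\<close>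

definition cf :: "(baire \<Rightarrow> nat \<Rightarrow> nat) \<Rightarrow> bool" where
  "cf f \<longleftrightarrow> (\<exists>e. \<forall>p n. eval p e [n] (f p n))"

definition cfd :: "(baire \<Rightarrow> nat \<Rightarrow> bool) \<Rightarrow> bool" where
  "cfd P \<longleftrightarrow> cf (\<lambda>p n. if P p n then 1 else 0)"

named_theorems cf_intros

lemma cf_id [cf_intros]: "cf (\<lambda>p n. n)"
  unfolding cf_def by (intro exI[of _ "Proj 0"] allI eval_Proj) auto

lemma cf_comp:
  assumes "cf f" "cf g"
  shows "cf (\<lambda>p n. f p (g p n))"
  using assms unfolding cf_def by (meson eval_Comp1)

lemma cf_Suc [cf_intros]: "cf f \<Longrightarrow> cf (\<lambda>p n. Suc (f p n))"
  unfolding cf_def by (meson eval_Comp1 eval.intros(2))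

lemma cf_query [cf_intros]: "cf f \<Longrightarrow> cf (\<lambda>p n. p (f p n))"
  unfolding cf_def by (meson eval_Comp1 eval.intros(4))

lemma cf_const [cf_intros]: "cf (\<lambda>p n. c)"
proof (induction c)
  case 0
  show ?case
    unfolding cf_def by (meson eval.intros(1))
qed (rule cf_Suc)

lemma cf_fst [cf_intros]: "cf f \<Longrightarrow> cf (\<lambda>p n. \<pi>1 (f p n))"
  unfolding cf_def by (meson eval_Comp1 eval_fst)

lemma cf_snd [cf_intros]: "cf f \<Longrightarrow> cf (\<lambda>p n. \<pi>2 (f p n))"
  unfolding cf_def by (meson eval_Comp1 eval_snd)

lemma cf_pair [cf_intros]: "cf f \<Longrightarrow> cf g \<Longrightarrow> cf (\<lambda>p n. prod_encode (f p n, g p n))"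
  unfolding cf_def by (meson eval_Comp2 eval_pair)

text \<open>A bound variable is appended to the environment \<open>n\<close> by pairing.\<close>

lemma cf_rec [cf_intros]:
  assumes "cf b" "cf m" "cf (\<lambda>p z. s p (\<pi>1 z) (\<pi>1 (\<pi>2 z)) (\<pi>2 (\<pi>2 z)))"
  shows "cf (\<lambda>p n. rec_nat (b p n) (\<lambda>k a. s p n k a) (m p n))"
proof -
  from assms obtain eb em es where e: "\<And>p n. eval p eb [n] (b p n)" "\<And>p n. eval p em [n] (m p n)"
    "\<And>p z. eval p es [z] (s p (\<pi>1 z) (\<pi>1 (\<pi>2 z)) (\<pi>2 (\<pi>2 z)))"
    unfolding cf_def by metis
  let ?g = "Comp es [Comp prog_pair [Proj 2, Comp prog_pair [Proj 0, Proj 1]]]"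
  have g: "eval p ?g [k, y, n] (s p n k y)" for p k y n
    by (rule eval_Comp1[OF eval_Comp2[OF eval_Proj eval_Comp2[OF eval_Proj eval_Proj eval_pair] eval_pair]])
       (use e(3)[of p "prod_encode (n, prod_encode (k, y))"] in auto)
  show ?thesis
    unfolding cf_def
  proof (intro exI allI)
    fix p n
    show "eval p (Comp (Prec eb ?g) [em, Proj 0]) [n] (rec_nat (b p n) (\<lambda>k a. s p n k a) (m p n))"
      by (rule eval_Comp2[OF e(2) eval_Proj eval_Prec_rec_nat[OF e(1) g]]) auto
  qed
qed

lemma cf_comp2:
  assumes "cf (\<lambda>p z. f p (\<pi>1 z) (\<pi>2 z))" "cf g" "cf h"
  shows "cf (\<lambda>p n. f p (g p n) (h p n))"
  using cf_comp[OF assms(1) cf_pair[OF assms(2,3)]] by simp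

lemma cf_plus [cf_intros]:
  assumes "cf f" "cf g" shows "cf (\<lambda>p n. f p n + g p n)"
proof -
  have "rec_nat b (\<lambda>_ a. Suc a) k = k + b" for b k :: nat
    by (induction k) auto
  moreover have "cf (\<lambda>p n. rec_nat (g p n) (\<lambda>_ a. Suc a) (f p n))"
    by (intro cf_intros assms)
  ultimately show ?thesis by simp
qed

lemma cf_diff [cf_intros]:
  assumes "cf f" "cf g" shows "cf (\<lambda>p n. f p n - g p n)"
proof -
  have pred: "cf (\<lambda>p n. rec_nat 0 (\<lambda>k _. k) n)"
    by (intro cf_intros)
  have "rec_nat 0 (\<lambda>k _. k) n = n - 1" for n :: nat
    by (cases n) auto
  with pred have pred: "cf (\<lambda>p n. n - 1)" by simp
  have "rec_nat b (\<lambda>_ a. a - 1) k = b - k" for b k :: nat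
    by (induction k) auto
  moreover have "cf (\<lambda>p n. rec_nat (f p n) (\<lambda>_ a. a - 1) (g p n))"
    by (intro cf_rec cf_comp[OF pred] cf_intros assms)
  ultimately show ?thesis by simp
qed

lemma cf_mult [cf_intros]:
  assumes "cf f" "cf g" shows "cf (\<lambda>p n. f p n * g p n)"
proof -
  have "rec_nat 0 (\<lambda>_ a. a + b) k = k * b" for b k :: nat
    by (induction k) auto
  moreover have "cf (\<lambda>p n. rec_nat 0 (\<lambda>_ a. a + g p n) (f p n))"
    by (intro cf_intros cf_comp[OF assms(2)] assms)
  ultimately show ?thesis by simp
qed

lemma cf_power [cf_intros]:
  assumes "cf f" "cf g" shows "cf (\<lambda>p n. f p n ^ g p n)"
proof -
  have "rec_nat 1 (\<lambda>_ a. a * b) k = b ^ k" for b k :: nat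
    by (induction k) auto
  moreover have "cf (\<lambda>p n. rec_nat 1 (\<lambda>_ a. a * f p n) (g p n))"
    by (intro cf_intros cf_comp[OF assms(1)] assms)
  ultimately show ?thesis by simp
qed

lemma cf_sum [cf_intros]:
  assumes "cf b" "cf (\<lambda>p z. f p (\<pi>1 z) (\<pi>2 z))" shows "cf (\<lambda>p n. \<Sum>k<b p n. f p n k)"
proof -
  have "rec_nat 0 (\<lambda>k a. a + g k) m = (\<Sum>k<m. g k)" for m and g :: "nat \<Rightarrow> nat"
    by (induction m) auto
  moreover have "cf (\<lambda>p n. rec_nat 0 (\<lambda>k a. a + f p n k) (b p n))"
    by (intro cf_intros cf_comp2[OF assms(2)] assms)
  ultimately show ?thesis by simp
qed

lemma cf_if [cf_intros]:
  assumes "cfd P" "cf f" "cf g" shows "cf (\<lambda>p n. if P p n then f p n else g p n)"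
proof -
  have "cf (\<lambda>p n. (if P p n then 1 else 0) * f p n + (1 - (if P p n then 1 else 0)) * g p n)"
    by (intro cf_intros assms assms(1)[unfolded cfd_def])
  moreover have "(\<lambda>p n. (if P p n then 1 else 0) * f p n + (1 - (if P p n then 1 else 0)) * g p n) =
      (\<lambda>p n. if P p n then f p n else g p n)"
    by (auto simp: fun_eq_iff)
  ultimately show ?thesis by simp
qed

lemma cfd_le [cf_intros]:
  assumes "cf f" "cf g" shows "cfd (\<lambda>p n. f p n \<le> g p n)"
proof -
  have "cf (\<lambda>p n. 1 - (f p n - g p n))"
    by (intro cf_intros assms)
  moreover have "(\<lambda>p n. 1 - (f p n - g p n)) = (\<lambda>p n. if f p n \<le> g p n then 1 else 0)"
    by (auto simp: fun_eq_iff)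
  ultimately show ?thesis by (simp add: cfd_def)
qed

lemma cfd_conj [cf_intros]:
  assumes "cfd P" "cfd Q" shows "cfd (\<lambda>p n. P p n \<and> Q p n)"
proof -
  have "cf (\<lambda>p n. if P p n then if Q p n then 1 else 0 else 0)"
    by (intro cf_intros assms)
  moreover have "(\<lambda>p n. if P p n then if Q p n then 1 else 0 else 0) =
    (\<lambda>p n. if P p n \<and> Q p n then 1 else 0 :: nat)"
    by (auto simp: fun_eq_iff)
  ultimately show ?thesis by (simp add: cfd_def)
qed

lemma cfd_not [cf_intros]:
  assumes "cfd P" shows "cfd (\<lambda>p n. \<not> P p n)"
proof -
  have "cf (\<lambda>p n. if P p n then 0 else 1)"
    by (intro cf_intros assms)
  moreover have "(\<lambda>p n. if P p n then 0 else 1) = (\<lambda>p n. if \<not> P p n then 1 else 0 :: nat)"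
    by (auto simp: fun_eq_iff)
  ultimately show ?thesis by (simp add: cfd_def)
qed

lemma cfd_disj [cf_intros]:
  assumes "cfd P" "cfd Q" shows "cfd (\<lambda>p n. P p n \<or> Q p n)"
proof -
  have "cfd (\<lambda>p n. \<not> (\<not> P p n \<and> \<not> Q p n))"
    by (intro cfd_not cfd_conj assms)
  then show ?thesis by simp
qed

lemma cfd_less [cf_intros]:
  assumes "cf f" "cf g" shows "cfd (\<lambda>p n. f p n < g p n)"
  unfolding not_le[symmetric] by (intro cfd_not cfd_le assms)

lemma cfd_eq [cf_intros]:
  assumes "cf f" "cf g" shows "cfd (\<lambda>p n. f p n = g p n)"
  unfolding eq_iff by (intro cfd_conj cfd_le assms)

lemma cfd_comp2:
  assumes "cfd (\<lambda>p z. P p (\<pi>1 z) (\<pi>2 z))" "cf g" "cf h"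
  shows "cfd (\<lambda>p n. P p (g p n) (h p n))"
  using cf_comp[OF assms(1)[unfolded cfd_def] cf_pair[OF assms(2,3)]] by (simp add: cfd_def)

lemma cfd_all [cf_intros]:
  assumes "cf b" "cfd (\<lambda>p z. P p (\<pi>1 z) (\<pi>2 z))" shows "cfd (\<lambda>p n. \<forall>k<b p n. P p n k)"
proof -
  have "cfd (\<lambda>p n. (\<Sum>k<b p n. if P p n k then 0 else 1) = (0 :: nat))"
    by (intro cf_intros cfd_comp2[OF assms(2)] assms)
  moreover have "(\<lambda>p n. (\<Sum>k<b p n. if P p n k then 0 else 1) = (0 :: nat)) =
      (\<lambda>p n. \<forall>k<b p n. P p n k)"
    by (auto simp: fun_eq_iff)
  ultimately show ?thesis by simp
qed

lemma cfd_ex [cf_intros]: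
  assumes "cf b" "cfd (\<lambda>p z. P p (\<pi>1 z) (\<pi>2 z))" shows "cfd (\<lambda>p n. \<exists>k<b p n. P p n k)"
proof -
  have "cfd (\<lambda>p n. \<not> (\<forall>k<b p n. \<not> P p n k))"
    by (intro cfd_not cfd_all assms)
  then show ?thesis by simp
qed

lemma cf_div [cf_intros]:
  assumes "cf f" "cf g" shows "cf (\<lambda>p n. f p n div g p n)"
proof -
  have "a div b = (if b = 0 then 0 else \<Sum>k<a. if Suc k * b \<le> a then 1 else 0)" for a b :: nat
  proof (cases "b = 0")
    case False
    have "Suc k * b \<le> a \<longleftrightarrow> k < a div b" for k
      using False less_eq_div_iff_mult_less_eq[of b "Suc k" a] by (simp add: Suc_le_eq)
    then have "(\<Sum>k<a. if Suc k * b \<le> a then 1 else 0) = (\<Sum>k<a. if k < a div b then 1 else 0 :: nat)"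
      by simp
    also have "\<dots> = (\<Sum>k\<in>{..<a} \<inter> {k. k < a div b}. 1)"
      by (subst sum.inter_restrict) simp_all
    also have "\<dots> = card {..<a div b}"
    proof -
      have "{..<a} \<inter> {k. k < a div b} = {..<a div b}"
        using div_le_dividend[of a b] by (auto dest: less_le_trans[of _ "a div b" a])
      then show ?thesis by simp
    qed
    finally show ?thesis using False by simp
  qed simp
  moreover have "cf (\<lambda>p n. if g p n = 0 then 0 else \<Sum>k<f p n. if Suc k * g p n \<le> f p n then 1 else 0)"
    by (intro cf_intros cf_comp[OF assms(1)] cf_comp[OF assms(2)] assms)
  ultimately show ?thesis by simp
qed

lemma cf_mod [cf_intros]:
  assumes "cf f" "cf g" shows "cf (\<lambda>p n. f p n mod g p n)"
proof -
  have "cf (\<lambda>p n. f p n - g p n * (f p n div g p n))"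
    by (intro cf_intros assms)
  then show ?thesis by (simp add: minus_mult_div_eq_mod)
qed

lemma eval_Least:
  assumes "\<And>p z. eval p e [z] (if R p (\<pi>1 z) (\<pi>2 z) then 1 else 0)" "\<exists>t. R p n t"
  shows "eval p (Mu (Comp prog_rminus [Comp e [Comp prog_pair [Proj 1, Proj 0]], Comp Succ [Zero]])) [n]
    (LEAST t. R p n t)"
proof -
  \<comment> \<open>\<open>Mu\<close> looks for a zero and puts the candidate t in front of n,
    whereas R expects the pair (n, t): so the indicator is subtracted from 1 and the arguments are
    swapped.\<close>
  let ?f = "Comp prog_rminus [Comp e [Comp prog_pair [Proj 1, Proj 0]], Comp Succ [Zero]]"
  have ev: "eval p ?f [t, n] (Suc 0 - (if R p n t then 1 else 0))" for t
    by (rule eval_Comp2[OF eval_Comp1[OF eval_Comp2[OF eval_Proj eval_Proj eval_pair] assms(1)]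
          eval_Comp1[OF eval.intros(1) eval.intros(2)]])
       (use eval_rminus[of p "if R p n t then 1 else 0" "Suc 0"] in auto)
  show ?thesis
  proof (rule eval.intros(8))
    show "eval p ?f [LEAST t. R p n t, n] 0"
      using ev[of "LEAST t. R p n t"] LeastI_ex[OF assms(2)] by simp
    fix m assume "m < (LEAST t. R p n t)"
    then have "\<not> R p n m" by (rule not_less_Least)
    then show "\<exists>y. eval p ?f [m, n] (Suc y)"
      using ev[of m] by auto
  qed
qed

lemma cf_Least [cf_intros]:
  assumes "cfd (\<lambda>p z. R p (\<pi>1 z) (\<pi>2 z))" "\<And>p n. \<exists>t. R p n t"
  shows "cf (\<lambda>p n. LEAST t. R p n t)"
proof -
  from assms(1) obtain e where "\<And>p z. eval p e [z] (if R p (\<pi>1 z) (\<pi>2 z) then 1 else 0)"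
    unfolding cfd_def cf_def by blast
  then show ?thesis
    unfolding cf_def using eval_Least[where R = R, OF _ assms(2)] by blast
qed

text \<open>The backward maps of both reductions have this form: each output is read off from the
  first certificate t, and the search has to succeed only on the domain of F.\<close>

lemma computable_search:
  assumes "cfd (\<lambda>p z. R p (\<pi>1 z) (\<pi>2 z))" "cf (\<lambda>p z. g p (\<pi>1 z) (\<pi>2 z))"
    and "\<And>p y n. F p = Some y \<Longrightarrow> \<exists>t. R p n t"
    and "\<And>p y n. F p = Some y \<Longrightarrow> y n = g p n (LEAST t. R p n t)"
  shows "computable F"
proof -
  from assms(1,2) obtain e1 e2 where e1: "\<And>p z. eval p e1 [z] (if R p (\<pi>1 z) (\<pi>2 z) then 1 else 0)"
    and e2: "\<And>p z. eval p e2 [z] (g p (\<pi>1 z) (\<pi>2 z))"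
    unfolding cfd_def cf_def by metis
  show ?thesis
    unfolding computable_def
  proof (intro exI allI impI)
    fix p y n
    assume y: "F p = Some y"
    show "eval p (Comp e2 [Comp prog_pair [Proj 0, Mu (Comp prog_rminus
        [Comp e1 [Comp prog_pair [Proj 1, Proj 0]], Comp Succ [Zero]])]]) [n] (y n)"
      unfolding assms(4)[OF y]
    proof (rule eval_Comp1)
      show "eval p (Comp prog_pair [Proj 0, Mu (Comp prog_rminus
        [Comp e1 [Comp prog_pair [Proj 1, Proj 0]], Comp Succ [Zero]])]) [n]
        (prod_encode (n, LEAST t. R p n t))"
        by (rule eval_Comp2[OF eval_Proj eval_Least[where R = R, OF e1 assms(3)[OF y]] eval_pair]) auto
      show "eval p e2 [prod_encode (n, LEAST t. R p n t)] (g p n (LEAST t. R p n t))"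
        using e2[of p "prod_encode (n, LEAST t. R p n t)"] by simp
    qed
  qed
qed

lemma computable_cf: "cf f \<Longrightarrow> computable (\<lambda>p. Some (f p))"
  unfolding cf_def computable_def by auto

section \<open>Codes of lists\<close>

lemma cf_list_encode [cf_intros]:
  assumes "cf m" "cf (\<lambda>p z. f p (\<pi>1 z) (\<pi>2 z))"
  shows "cf (\<lambda>p n. list_encode (map (f p n) [0..<m p n]))"
proof -
  \<comment> \<open>A list code is built from its last entry backwards, so step j prepends the entry
    with index \<open>k - Suc j\<close>.\<close>
  have "rec_nat 0 (\<lambda>j a. Suc (prod_encode (g (k - Suc j), a))) j = list_encode (map g [k - j..<k])"
    if "j \<le> k" for g :: "nat \<Rightarrow> nat" and j k
    using that
  proof (induction j)
    case (Suc j)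
    then have "[k - Suc j..<k] = (k - Suc j) # [k - j..<k]"
      by (subst upt_conv_Cons) (auto simp: Suc_diff_Suc)
    with Suc show ?case by simp
  qed simp
  from this[of k k for k] have "list_encode (map g [0..<k]) =
      rec_nat 0 (\<lambda>j a. Suc (prod_encode (g (k - Suc j), a))) k" for g k
    by simp
  moreover have "cf (\<lambda>p n. rec_nat 0 (\<lambda>j a. Suc (prod_encode (f p n (m p n - Suc j), a))) (m p n))"
    by (intro cf_intros cf_comp2[OF assms(2)] cf_comp[OF assms(1)] assms)
  ultimately show ?thesis by simp
qed

definition code_tl :: "nat \<Rightarrow> nat" where "code_tl c = \<pi>2 (c - 1)"

definition code_nth :: "nat \<Rightarrow> nat \<Rightarrow> nat" where
  "code_nth c i = \<pi>1 (rec_nat c (\<lambda>_. code_tl) i - 1)"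

definition code_length :: "nat \<Rightarrow> nat" where
  "code_length c = (LEAST i. rec_nat c (\<lambda>_. code_tl) i = 0)"

lemma prod_decode_0: "prod_decode 0 = (0, 0)"
  using prod_encode_inverse[of "(0, 0)"] by (simp add: prod_encode_def)

lemma code_tl_iter: "rec_nat (list_encode xs) (\<lambda>_. code_tl) i = list_encode (drop i xs)"
proof (induction i)
  case (Suc i)
  have "code_tl (list_encode ys) = list_encode (tl ys)" for ys
    by (cases ys) (auto simp: code_tl_def prod_decode_0)
  with Suc show ?case
    by (simp add: drop_Suc tl_drop)
qed simp

lemma code_nth_list_encode: "i < length xs \<Longrightarrow> code_nth (list_encode xs) i = xs ! i"
  by (simp add: code_nth_def code_tl_iter Cons_nth_drop_Suc[symmetric])

lemma list_encode_eq_0: "list_encode xs = 0 \<longleftrightarrow> xs = []"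
  by (cases xs) auto

lemma code_length_list_encode: "code_length (list_encode xs) = length xs"
  by (auto simp: code_length_def code_tl_iter list_encode_eq_0 intro!: Least_equality)

lemma cf_code_nth [cf_intros]: "cf f \<Longrightarrow> cf g \<Longrightarrow> cf (\<lambda>p n. code_nth (f p n) (g p n))"
  unfolding code_nth_def code_tl_def by (intro cf_intros)

lemma cf_code_length [cf_intros]: "cf f \<Longrightarrow> cf (\<lambda>p n. code_length (f p n))"
proof (rule cf_comp[of "\<lambda>p. code_length"])
  show "cf (\<lambda>p. code_length)"
    unfolding code_length_def code_tl_def
  proof (intro cf_intros)
    fix c :: nat
    show "\<exists>t. rec_nat c (\<lambda>_ y. \<pi>2 (y - 1)) t = 0"
      using code_tl_iter[of "list_decode c" "length (list_decode c)"]
      by (intro exI[of _ "length (list_decode c)"]) (simp add: code_tl_def[abs_def])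
  qed
qed

section \<open>Cantor space\<close>

definition cantor :: "baire set" where
  "cantor = {b. \<forall>j. b j < 2}"

lemma words_2_eq_Some: "words 2 p = Some x \<longleftrightarrow> p \<in> cantor \<and> x = p"
  by (auto simp: words_def cantor_def)

text \<open>A number stands for the eventually zero sequence of its binary digits, least significant
  first. Quantification over the cylinders of length m becomes a bounded quantifier over
  \<open>v < 2 ^ m\<close>.\<close>

definition bits :: "nat \<Rightarrow> baire" where
  "bits v j = v div 2 ^ j mod 2"

lemma cf_bits [cf_intros]: "cf f \<Longrightarrow> cf g \<Longrightarrow> cf (\<lambda>p n. bits (f p n) (g p n))"
  unfolding bits_def by (intro cf_intros)

lemma bits_in_cantor: "bits v \<in> cantor"
  by (simp add: bits_def cantor_def)

lemma bits_eq: "bits v j = of_bool (bit v j)"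
  by (simp add: bits_def bit_iff_odd odd_iff_mod_2_eq_one)

lemma ex_bits:
  assumes "b \<in> cantor"
  shows "\<exists>v<2 ^ m. \<forall>j<m. bits v j = b j"
proof (intro exI conjI allI impI)
  let ?v = "take_bit m (horner_sum of_bool 2 (map (\<lambda>j. b j = 1) [0..<m]) :: nat)"
  show "?v < 2 ^ m"
    by simp
  fix j assume "j < m"
  moreover have "b j < 2"
    using assms by (auto simp: cantor_def)
  ultimately show "bits ?v j = b j"
    by (auto simp: bits_eq bit_take_bit_iff bit_horner_sum_bit_iff)
qed

text \<open>Koenig's lemma. If no stage serves all sequences, one half of every bad cylinder is bad
  again. The sequence b found in this way satisfies \<open>R b s\<close> for some s, and by locality
  so does everything that shares its first \<open>f s\<close> bits, against the badness of that
  cylinder.\<close>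

lemma cantor_compact:
  fixes R :: "baire \<Rightarrow> nat \<Rightarrow> bool"
  assumes cover: "\<And>b. b \<in> cantor \<Longrightarrow> \<exists>s. R b s"
    and local: "\<And>b b' s. R b s \<Longrightarrow> \<forall>j<f s. b' j = b j \<Longrightarrow> R b' s"
  shows "\<exists>s. \<forall>b\<in>cantor. \<exists>s'\<le>s. R b s'"
proof (rule ccontr)
  assume neg: "\<not> ?thesis"
  define bad where "bad b m \<longleftrightarrow> (\<forall>s. \<exists>b'\<in>cantor. (\<forall>j<m. b' j = b j) \<and> \<not> (\<exists>s'\<le>s. R b' s'))"
    for b m
  have step: "\<exists>c. (b \<in> cantor \<longrightarrow> c \<in> cantor) \<and> bad c (Suc m) \<and> (\<forall>j<m. c j = b j)"
    if bad: "bad b m" for b m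
  proof (rule ccontr)
    assume no: "\<not> ?thesis"
    have ex: "\<exists>s. \<forall>b'\<in>cantor. (\<forall>j<m. b' j = b j) \<longrightarrow> b' m = i \<longrightarrow> (\<exists>s'\<le>s. R b' s')" if "i < 2" for i
    proof (rule ccontr)
      assume *: "\<not> ?thesis"
      have "bad (b(m := i)) (Suc m)"
        unfolding bad_def
      proof
        fix s
        obtain b' where "b' \<in> cantor" "\<forall>j<m. b' j = b j" "b' m = i" "\<not> (\<exists>s'\<le>s. R b' s')"
          using * by blast
        then show "\<exists>b'\<in>cantor. (\<forall>j<Suc m. b' j = (b(m := i)) j) \<and> \<not> (\<exists>s'\<le>s. R b' s')"
          by (intro bexI[of _ b']) (auto simp: less_Suc_eq)
      qed
      moreover have "b \<in> cantor \<longrightarrow> b(m := i) \<in> cantor" "\<forall>j<m. (b(m := i)) j = b j"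
        using that by (auto simp: cantor_def)
      ultimately show False using no by blast
    qed
    define S where "S i = (SOME s. \<forall>b'\<in>cantor. (\<forall>j<m. b' j = b j) \<longrightarrow> b' m = i \<longrightarrow>
        (\<exists>s'\<le>s. R b' s'))" for i
    have S: "\<forall>b'\<in>cantor. (\<forall>j<m. b' j = b j) \<longrightarrow> b' m = i \<longrightarrow> (\<exists>s'\<le>S i. R b' s')" if "i < 2" for i
      unfolding S_def using ex[OF that] by (rule someI_ex)
    obtain b' where b': "b' \<in> cantor" "\<forall>j<m. b' j = b j" "\<not> (\<exists>s'\<le>max (S 0) (S 1). R b' s')"
      using spec[OF bad[unfolded bad_def], of "max (S 0) (S 1)"] by auto
    have "b' m < 2"
      using b'(1) by (auto simp: cantor_def)
    then obtain s' where s': "s' \<le> S (b' m)" "R b' s'"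
      using bspec[OF S b'(1)] b'(2) by blast
    have "b' m = 0 \<or> b' m = 1"
      using \<open>b' m < 2\<close> by auto
    with s'(1) have "s' \<le> max (S 0) (S 1)"
      by (auto simp: le_max_iff_disj)
    with s'(2) b'(3) show False
      by blast
  qed
  have "bad (\<lambda>_. 0) 0"
    using neg by (auto simp: bad_def)
  then have "\<exists>B. \<forall>m. (B m \<in> cantor \<and> bad (B m) m) \<and> (\<forall>j<m. B (Suc m) j = B m j)"
  proof (intro dependent_nat_choice)
    show "\<exists>b. b \<in> cantor \<and> bad b 0"
      using \<open>bad (\<lambda>_. 0) 0\<close> by (intro exI[of _ "\<lambda>_. 0"]) (auto simp: cantor_def)
    show "\<exists>c. (c \<in> cantor \<and> bad c (Suc m)) \<and> (\<forall>j<m. c j = b j)" if "b \<in> cantor \<and> bad b m" for b m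
      using step[of b m] that by auto
  qed
  then obtain B where B: "\<And>m. B m \<in> cantor" "\<And>m. bad (B m) m"
    "\<And>m j. j < m \<Longrightarrow> B (Suc m) j = B m j"
    by blast
  define b where "b j = B (Suc j) j" for j
  have eq: "B m j = b j" if "j < m" for m j
    using that
  proof (induction m)
    case (Suc m)
    then show ?case by (cases "j = m") (auto simp: b_def B(3))
  qed simp
  have "b \<in> cantor"
    using B(1) by (auto simp: cantor_def b_def)
  then obtain s where s: "R b s"
    using cover by blast
  obtain b' where "\<forall>j<f s. b' j = b j" "\<not> R b' s"
    using B(2)[of "f s"] eq unfolding bad_def by (metis order_refl)
  with local[OF s] show False by blast
qed

text \<open>If \<open>R\<close> at stage s' depends on \<open>f s'\<close> bits only and f is
  monotone, one representative per cylinder of length \<open>f s\<close> shows whether stage s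
  covers all of Cantor space.\<close>

definition exhausted :: "(nat \<Rightarrow> nat) \<Rightarrow> (baire \<Rightarrow> nat \<Rightarrow> bool) \<Rightarrow> nat \<Rightarrow> bool" where
  "exhausted f R s \<longleftrightarrow> (\<forall>v<2 ^ f s. \<exists>s'<Suc s. R (bits v) s')"

lemma exhausted_iff:
  assumes "\<And>b b' s. R b s \<Longrightarrow> \<forall>j<f s. b' j = b j \<Longrightarrow> R b' s" "mono f"
  shows "exhausted f R s \<longleftrightarrow> (\<forall>b\<in>cantor. \<exists>s'\<le>s. R b s')"
proof
  assume *: "exhausted f R s"
  show "\<forall>b\<in>cantor. \<exists>s'\<le>s. R b s'"
  proof
    fix b assume "b \<in> cantor"
    then obtain v where v: "v < 2 ^ f s" "\<forall>j<f s. bits v j = b j"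
      using ex_bits by blast
    then obtain s' where s': "s' \<le> s" "R (bits v) s'"
      using * by (auto simp: exhausted_def less_Suc_eq_le)
    have "f s' \<le> f s"
      using assms(2) s'(1) by (rule monoD)
    with v(2) have "R b s'"
      by (intro assms(1)[OF s'(2)]) auto
    with s' show "\<exists>s'\<le>s. R b s'" by blast
  qed
qed (use bits_in_cantor in \<open>auto simp: exhausted_def less_Suc_eq_le\<close>)

lemma exhausted_mono:
  assumes "\<And>b b' s. R b s \<Longrightarrow> \<forall>j<f s. b' j = b j \<Longrightarrow> R b' s" "mono f"
    and "exhausted f R s" "s \<le> t"
  shows "exhausted f R t"
proof -
  have iff: "exhausted f R s \<longleftrightarrow> (\<forall>b\<in>cantor. \<exists>s'\<le>s. R b s')" for s
    by (rule exhausted_iff) (use assms in blast)+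
  show ?thesis
    using assms(3,4) unfolding iff by (meson order_trans)
qed

text \<open>Emptiness of a closed subset of a compact space is a finite event under negative
  information. The tests \<open>off_hull\<close>, \<open>refuted\<close> and \<open>pinned\<close>
  are instances.\<close>

lemma ex_exhausted_iff:
  assumes "\<And>b b' s. R b s \<Longrightarrow> \<forall>j<f s. b' j = b j \<Longrightarrow> R b' s" "mono f"
  shows "(\<exists>s. exhausted f R s) \<longleftrightarrow> (\<forall>b\<in>cantor. \<exists>s. R b s)"
proof -
  have iff: "exhausted f R s \<longleftrightarrow> (\<forall>b\<in>cantor. \<exists>s'\<le>s. R b s')" for s
    by (rule exhausted_iff) (use assms in blast)+
  have "\<exists>s. \<forall>b\<in>cantor. \<exists>s'\<le>s. R b s'" if "\<And>b. b \<in> cantor \<Longrightarrow> \<exists>s. R b s"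
    by (rule cantor_compact[OF that]) (use assms in blast)+
  then show ?thesis
    unfolding iff by blast
qed

lemma cfd_exhausted:
  assumes "cf (\<lambda>p z. f p (\<pi>1 z) (\<pi>2 z))" "cf g"
    and R: "cfd (\<lambda>p z. R p (\<pi>1 (\<pi>1 z)) (bits (\<pi>2 (\<pi>1 z))) (\<pi>2 z))"
  shows "cfd (\<lambda>p n. exhausted (f p n) (R p n) (g p n))"
  unfolding exhausted_def
  by (intro cf_intros cf_comp2[OF assms(1)] cf_comp[OF assms(2)] assms R)

section \<open>Digit expansions\<close>

definition digits :: "nat \<Rightarrow> baire \<Rightarrow> nat \<Rightarrow> nat" where
  "digits B \<beta> M = rec_nat 0 (\<lambda>k a. B * a + \<beta> k) M"

lemma digits_simps [simp]: "digits B \<beta> 0 = 0" "digits B \<beta> (Suc M) = B * digits B \<beta> M + \<beta> M"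
  by (simp_all add: digits_def)

lemma cf_digits [cf_intros]:
  assumes "cf m" "cf B" "cf (\<lambda>p z. \<beta> p (\<pi>1 z) (\<pi>2 z))"
  shows "cf (\<lambda>p n. digits (B p n) (\<beta> p n) (m p n))"
  unfolding digits_def by (intro cf_intros cf_comp2[OF assms(3)] cf_comp[OF assms(2)] assms)

lemma digits_cong: "(\<And>j. j < M \<Longrightarrow> \<beta> j = \<gamma> j) \<Longrightarrow> digits B \<beta> M = digits B \<gamma> M"
  by (induction M) auto

text \<open>Nested closed intervals of length 1 / B^M take the place of an infinite series.
  Closedness at both ends admits both expansions of a B-adic rational and an expansion of 1.\<close>

definition has_value :: "nat \<Rightarrow> baire \<Rightarrow> real \<Rightarrow> bool" where
  "has_value B \<beta> x \<longleftrightarrow> (\<forall>M. real (digits B \<beta> M) \<le> x * real B ^ M \<and> x * real B ^ M \<le> real (digits B \<beta> M) + 1)"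

lemma has_value_bounds: "has_value B \<beta> x \<Longrightarrow> 0 \<le> x \<and> x \<le> 1"
  unfolding has_value_def by (drule spec[of _ 0]) simp

lemma has_value_error:
  assumes "has_value B \<beta> x" "B > 0"
  shows "\<bar>real (digits B \<beta> M) / real B ^ M - x\<bar> \<le> 1 / real B ^ M"
proof -
  have "real (digits B \<beta> M) / real B ^ M \<le> x" "x \<le> (real (digits B \<beta> M) + 1) / real B ^ M"
    using assms unfolding has_value_def by (simp_all add: divide_le_eq le_divide_eq)
  then show ?thesis by (simp add: add_divide_distrib abs_le_iff)
qed

lemma inverse_power_tendsto_0: "2 \<le> B \<Longrightarrow> (\<lambda>M. 1 / real B ^ M) \<longlonglongrightarrow> 0"
  using LIMSEQ_power_zero[of "1 / real B"] by (simp add: power_one_over)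

lemma le_all_inverse_power_imp_le_0:
  assumes "2 \<le> B" "\<And>M. (x::real) \<le> C / real B ^ M"
  shows "x \<le> 0"
proof (rule LIMSEQ_le_const)
  show "(\<lambda>M. C / real B ^ M) \<longlonglongrightarrow> 0"
    using tendsto_mult_right_zero[OF inverse_power_tendsto_0[OF assms(1)], of C] by simp
qed (use assms in auto)

lemma has_value_unique:
  assumes "has_value B \<beta> x" "has_value B \<beta> y" "2 \<le> B"
  shows "x = y"
proof -
  have "\<bar>x - y\<bar> \<le> 2 / real B ^ M" for M
    using has_value_error[OF assms(1), of M] has_value_error[OF assms(2), of M] assms(3) by simp
  then have "\<bar>x - y\<bar> \<le> 0"
    using assms(3) by (rule le_all_inverse_power_imp_le_0[rotated])
  then show ?thesis by simp
qed

lemma ex_has_value: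
  assumes "2 \<le> B" "\<And>j. \<beta> j < B"
  shows "\<exists>x. has_value B \<beta> x"
proof -
  let ?f = "\<lambda>M. real (digits B \<beta> M) / real B ^ M"
  let ?g = "\<lambda>M. (real (digits B \<beta> M) + 1) / real B ^ M"
  have B: "real B > 0" using assms(1) by simp
  have "\<exists>l. ((\<forall>n. ?f n \<le> l) \<and> ?f \<longlonglongrightarrow> l) \<and> (\<forall>n. l \<le> ?g n) \<and> ?g \<longlonglongrightarrow> l"
  proof (rule nested_sequence_unique)
    show "\<forall>n. ?f n \<le> ?f (Suc n)"
      using B by (simp add: field_simps)
    show "\<forall>n. ?g (Suc n) \<le> ?g n"
    proof
      fix n
      have "real (\<beta> n) + 1 \<le> real B"
        using assms(2)[of n] by linarith
      then show "?g (Suc n) \<le> ?g n"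
        using B by (simp add: divide_simps) (simp add: algebra_simps)
    qed
    show "\<forall>n. ?f n \<le> ?g n"
      using B by (simp add: divide_right_mono)
    show "(\<lambda>n. ?f n - ?g n) \<longlonglongrightarrow> 0"
      using tendsto_minus[OF inverse_power_tendsto_0[OF assms(1)]]
      by (simp add: add_divide_distrib)
  qed
  then obtain l where "\<And>n. ?f n \<le> l" "\<And>n. l \<le> ?g n" by blast
  then show ?thesis
    using B unfolding has_value_def by (auto simp: divide_le_eq le_divide_eq)
qed

lemma ex_binary:
  assumes "0 \<le> x" "x \<le> 1"
  shows "\<exists>b\<in>cantor. has_value 2 b x"
proof -
  define F where "F = rec_nat 0 (\<lambda>M a. 2 * a + (if real (2 * a + 1) \<le> x * 2 ^ Suc M then 1 else 0 :: nat))"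
  define b where "b M = (if real (2 * F M + 1) \<le> x * 2 ^ Suc M then 1 else 0 :: nat)" for M
  have F: "F 0 = 0" "F (Suc M) = 2 * F M + b M" for M
    by (simp_all add: F_def b_def)
  have "digits 2 b M = F M" for M
    by (induction M) (simp_all add: F)
  moreover have "real (F M) \<le> x * 2 ^ M \<and> x * 2 ^ M \<le> real (F M) + 1" for M
  proof (induction M)
    case (Suc M)
    then show ?case
      by (auto simp: F(2) b_def)
  qed (use assms in \<open>simp add: F\<close>)
  ultimately have "has_value 2 b x"
    by (simp add: has_value_def)
  moreover have "b \<in> cantor"
    by (simp add: cantor_def b_def)
  ultimately show ?thesis by blast
qed

section \<open>Negative information about closed sets\<close>

text \<open>An associate codes the output r by \<open>Suc r\<close>, and a nonzero output places q
  outside the set; hence the bound 2. One number s bounds both the output position and the prefix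
  that is read, so it can serve as a stage.\<close>

definition rejects :: "baire \<Rightarrow> baire \<Rightarrow> nat \<Rightarrow> bool" where
  "rejects p q s \<longleftrightarrow> (\<exists>m<s. \<exists>k<s. 2 \<le> p (list_encode (m # map q [0..<k])) \<and>
     (\<forall>l<k. p (list_encode (m # map q [0..<l])) = 0))"

lemma cfd_rejects [cf_intros]:
  assumes P: "cf (\<lambda>p z. P p (\<pi>1 z) (\<pi>2 z))" and Q: "cf (\<lambda>p z. Q p (\<pi>1 z) (\<pi>2 z))" and s: "cf s"
  shows "cfd (\<lambda>p n. rejects (P p n) (Q p n) (s p n))"
  unfolding rejects_def list_encode.simps
  by (intro cf_intros cf_comp2[OF P] cf_comp2[OF Q] cf_comp[OF s] s)

lemma rejects_cong:
  assumes "rejects p q s" "\<forall>j<s. q' j = q j"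
  shows "rejects p q' s"
proof -
  have eq: "map q' [0..<k] = map q [0..<k]" if "k < s" for k
    using assms(2) that by simp
  obtain m k where "m < s" "k < s" "2 \<le> p (list_encode (m # map q [0..<k]))"
    "\<forall>l<k. p (list_encode (m # map q [0..<l])) = 0"
    using assms(1) unfolding rejects_def by blast
  moreover from this have "\<forall>l<k. p (list_encode (m # map q' [0..<l])) = 0"
    by (metis eq order_less_trans)
  ultimately show ?thesis
    unfolding rejects_def using eq[of k] by metis
qed

lemma rejects_iff:
  assumes "closed_name X p A" "X q = Some x"
  shows "(\<exists>s. rejects p q s) \<longleftrightarrow> x \<notin> A"
proof -
  have "\<exists>r. associate p q r \<and> sierpinski r = Some (x \<notin> A)"
    using assms unfolding closed_name_def fun_name_def by blast
  then obtain r where r: "associate p q r" "x \<notin> A \<longleftrightarrow> (\<exists>m. r m \<noteq> 0)"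
    by (auto simp: sierpinski_def)
  have "r m \<noteq> 0 \<longleftrightarrow> (\<exists>k. 2 \<le> p (list_encode (m # map q [0..<k])) \<and>
     (\<forall>l<k. p (list_encode (m # map q [0..<l])) = 0))" (is "_ \<longleftrightarrow> (\<exists>k. ?P k)") for m
  proof -
    obtain k where k: "p (list_encode (m # map q [0..<k])) = Suc (r m)"
     "\<forall>l<k. p (list_encode (m # map q [0..<l])) = 0"
      using r(1) unfolding associate_def by blast
    have "k' = k" if "?P k'" for k'
    proof (rule linorder_cases[of k' k])
      assume "k' < k"
      then show ?thesis using k(2) that by auto
    next
      assume "k < k'"
      then show ?thesis using k(1) that by auto
    qed
    then have "(\<exists>k. ?P k) \<longleftrightarrow> ?P k"
      by blast
    then show ?thesis
      using k by auto
  qed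
  then have "x \<notin> A \<longleftrightarrow> (\<exists>m k. 2 \<le> p (list_encode (m # map q [0..<k])) \<and>
     (\<forall>l<k. p (list_encode (m # map q [0..<l])) = 0))"
    using r(2) by blast
  also have "\<dots> \<longleftrightarrow> (\<exists>s. rejects p q s)"
    unfolding rejects_def
    by (meson less_Suc_eq_le max.cobounded1 max.cobounded2)
  finally show ?thesis by blast
qed

text \<open>Nonnegative integers have even codes, and denominators are coded less one. The dyadic
  approximations written by \<open>bit_name\<close> and \<open>pin_map\<close> have this
  form.\<close>

lemma rat_code_dyadic: "rat_code (prod_encode (2 * E, 2 ^ M - 1)) = real E / 2 ^ M"
proof -
  have "int_decode (2 * E) = int E"
    using int_encode_inverse[of "int E"] by (simp add: int_encode_def sum_encode_def)
  then show ?thesis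
    by (simp add: rat_code_def)
qed

section \<open>Finite choice reduces to convex choice\<close>

subsection \<open>Convex hulls of points on the moment curve\<close>

definition value_of :: "nat \<Rightarrow> baire \<Rightarrow> real" where
  "value_of B \<beta> = (THE x. has_value B \<beta> x)"

lemma has_value_value_of:
  assumes "2 \<le> B" "\<And>j. \<beta> j < B"
  shows "has_value B \<beta> (value_of B \<beta>)"
proof -
  obtain x where x: "has_value B \<beta> x"
    using ex_has_value[of B \<beta>] assms by auto
  then show ?thesis
    unfolding value_of_def by (rule theI) (rule has_value_unique[OF _ x assms(1)])
qed

lemma value_of_eq: "has_value B \<beta> x \<Longrightarrow> 2 \<le> B \<Longrightarrow> value_of B \<beta> = x"
  unfolding value_of_def by (intro the_equality) (auto intro: has_value_unique)

text \<open>With the digits 0 and 2 only, base 3 expansions are unique, so distinct branches give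
  distinct nodes on the moment curve. Base 2 would identify the two expansions of a dyadic
  number.\<close>

definition ternary :: "baire \<Rightarrow> real" where
  "ternary a = value_of 3 (\<lambda>j. 2 * a j)"

lemma has_value_ternary:
  assumes "a \<in> cantor" shows "has_value 3 (\<lambda>j. 2 * a j) (ternary a)"
  unfolding ternary_def
proof (rule has_value_value_of)
  show "2 * a j < 3" for j
    using assms by (auto simp: cantor_def dest: spec[of _ j])
qed simp

lemma ternary_bounds: "a \<in> cantor \<Longrightarrow> 0 \<le> ternary a \<and> ternary a \<le> 1"
  using has_value_bounds[OF has_value_ternary] by simp

lemma ternary_less:
  assumes "a \<in> cantor" "b \<in> cantor" "\<And>j. j < M \<Longrightarrow> a j = b j" "a M = 0" "b M = 1"
  shows "ternary a < ternary b"
proof -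
  let ?d = "\<lambda>a. digits 3 (\<lambda>j. 2 * a j)"
  have "?d a M = ?d b M"
    by (rule digits_cong) (simp add: assms(3))
  moreover have "ternary a * 3 ^ Suc M \<le> real (?d a (Suc M)) + 1"
    using has_value_ternary[OF assms(1)] unfolding has_value_def by (metis of_nat_numeral)
  moreover have "real (?d b (Suc M)) \<le> ternary b * 3 ^ Suc M"
    using has_value_ternary[OF assms(2)] unfolding has_value_def by (metis of_nat_numeral)
  ultimately have "ternary a * 3 ^ Suc M < ternary b * 3 ^ Suc M"
    using assms(4,5) unfolding digits_simps by linarith
  then show ?thesis
    by simp
qed

lemma ternary_inj: "inj_on ternary cantor"
proof (rule inj_onI, rule ccontr)
  fix a b assume ab: "a \<in> cantor" "b \<in> cantor" "ternary a = ternary b" "a \<noteq> b"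
  define M where "M = (LEAST j. a j \<noteq> b j)"
  have "a M \<noteq> b M"
    unfolding M_def by (rule LeastI_ex) (use ab(4) in auto)
  moreover have eq: "a j = b j" if "j < M" for j
    using not_less_Least[of j "\<lambda>j. a j \<noteq> b j"] that unfolding M_def by auto
  moreover have "a M < 2" "b M < 2"
    using ab(1,2) by (auto simp: cantor_def)
  ultimately have "a M = 0 \<and> b M = 1 \<or> b M = 0 \<and> a M = 1"
    by linarith
  then show False
    using ternary_less[of a b M] ternary_less[of b a M] ab(1-3) eq by auto
qed

text \<open>The extra coordinate 1 turns "the weights sum to 1" into the moment equation of order
  0.\<close>

definition homogeneous :: "(nat \<Rightarrow> real) \<Rightarrow> nat \<Rightarrow> real" where
  "homogeneous x j = (if j = 0 then 1 else x (j - 1))"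

definition moment_hull :: "nat \<Rightarrow> baire set \<Rightarrow> (nat \<Rightarrow> real) set" where
  "moment_hull n S = {x. (\<forall>i\<ge>n. x i = 0) \<and> (\<exists>\<mu>. (\<forall>a\<in>S. 0 \<le> \<mu> a) \<and>
     (\<forall>j\<le>n. (\<Sum>a\<in>S. \<mu> a * ternary a ^ j) = homogeneous x j))}"

lemma moment_hull_bounds:
  assumes "x \<in> moment_hull n S" "S \<subseteq> cantor" "i < n"
  shows "0 \<le> x i \<and> x i \<le> 1"
proof -
  obtain \<mu> where \<mu>: "\<forall>a\<in>S. 0 \<le> \<mu> a" "\<forall>j\<le>n. (\<Sum>a\<in>S. \<mu> a * ternary a ^ j) = homogeneous x j"
    using assms(1) by (auto simp: moment_hull_def)
  have x: "x i = (\<Sum>a\<in>S. \<mu> a * ternary a ^ Suc i)"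
    using \<mu>(2)[rule_format, of "Suc i"] assms(3) by (simp add: homogeneous_def)
  have t: "0 \<le> ternary a ^ Suc i \<and> ternary a ^ Suc i \<le> 1" if "a \<in> S" for a
    using ternary_bounds[of a] that assms(2) by (auto intro!: power_le_one mult_le_one)
  have "x i \<le> (\<Sum>a\<in>S. \<mu> a * 1)"
    unfolding x using \<mu>(1) t by (intro sum_mono mult_left_mono) auto
  moreover have "(\<Sum>a\<in>S. \<mu> a * 1) = 1"
    using \<mu>(2)[rule_format, of 0] by (simp add: homogeneous_def)
  moreover have "0 \<le> x i"
    unfolding x using \<mu>(1) t by (intro sum_nonneg mult_nonneg_nonneg) auto
  ultimately show ?thesis by simp
qed

lemma moment_hull_empty: "moment_hull n {} = {}"
  by (auto simp: moment_hull_def homogeneous_def intro!: exI[of _ 0])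

lemma moment_hull_nonempty:
  assumes "finite S" "a \<in> S" shows "moment_hull n S \<noteq> {}"
proof -
  have "(\<lambda>i. if i < n then ternary a ^ Suc i else 0) \<in> moment_hull n S"
    unfolding moment_hull_def
    using assms by (auto simp: homogeneous_def if_distrib[of "\<lambda>z. z * _"] gr0_conv_Suc cong: if_cong
        intro!: exI[of _ "\<lambda>b. if b = a then 1 else 0"])
  then show ?thesis by blast
qed

lemma convex_moment_hull: "convex_set (moment_hull n S)"
  unfolding convex_set_def
proof (intro ballI allI impI)
  fix x y and t :: real
  assume x: "x \<in> moment_hull n S" and y: "y \<in> moment_hull n S" and t: "0 \<le> t \<and> t \<le> 1"
  obtain \<mu> where \<mu>: "\<forall>a\<in>S. 0 \<le> \<mu> a" "\<forall>j\<le>n. (\<Sum>a\<in>S. \<mu> a * ternary a ^ j) = homogeneous x j"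
    using x by (auto simp: moment_hull_def)
  obtain \<nu> where \<nu>: "\<forall>a\<in>S. 0 \<le> \<nu> a" "\<forall>j\<le>n. (\<Sum>a\<in>S. \<nu> a * ternary a ^ j) = homogeneous y j"
    using y by (auto simp: moment_hull_def)
  have "(\<Sum>a\<in>S. ((1 - t) * \<mu> a + t * \<nu> a) * ternary a ^ j) =
      homogeneous (\<lambda>i. (1 - t) * x i + t * y i) j" if "j \<le> n" for j
  proof -
    have "(\<Sum>a\<in>S. ((1 - t) * \<mu> a + t * \<nu> a) * ternary a ^ j) =
        (1 - t) * (\<Sum>a\<in>S. \<mu> a * ternary a ^ j) + t * (\<Sum>a\<in>S. \<nu> a * ternary a ^ j)"
      by (simp add: sum_distrib_left sum.distrib[symmetric] algebra_simps)
    with \<mu>(2) \<nu>(2) that show ?thesis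
      by (simp add: homogeneous_def)
  qed
  then show "(\<lambda>i. (1 - t) * x i + t * y i) \<in> moment_hull n S"
    using x y t \<mu>(1) \<nu>(1) unfolding moment_hull_def
    by (auto intro!: exI[of _ "\<lambda>a. (1 - t) * \<mu> a + t * \<nu> a"])
qed

text \<open>Equal moments up to order n give equal weighted sums of every polynomial of degree at
  most n. The polynomial whose roots are all nodes but that of c has such a degree and isolates the
  weight of c.\<close>

lemma moment_weights_unique:
  assumes "finite A" "A \<subseteq> cantor" "card A \<le> Suc n"
    and eq: "\<And>j. j \<le> n \<Longrightarrow> (\<Sum>a\<in>A. \<mu> a * ternary a ^ j) = (\<Sum>a\<in>A. \<nu> a * ternary a ^ j)"
    and c: "c \<in> A"
  shows "\<mu> c = \<nu> c"
proof -
  define p where "p = (\<Prod>a\<in>A - {c}. [:- ternary a, 1:])"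
  have "degree p \<le> (\<Sum>a\<in>A - {c}. degree [:- ternary a, 1:])"
    unfolding p_def using degree_prod_sum_le[of "A - {c}" "\<lambda>a. [:- ternary a, 1:]"] assms(1)
    by (simp add: o_def)
  also have "\<dots> \<le> n"
    using assms(1,3) c by simp
  finally have deg: "degree p \<le> n" .
  have poly_p: "poly p x = (\<Sum>j\<le>n. coeff p j * x ^ j)" for x
    unfolding poly_altdef
    by (rule sum.mono_neutral_left) (use deg in \<open>auto simp: coeff_eq_0\<close>)
  have "(\<Sum>a\<in>A. f a * poly p (ternary a)) = (\<Sum>j\<le>n. coeff p j * (\<Sum>a\<in>A. f a * ternary a ^ j))" for f
    unfolding poly_p sum_distrib_left by (subst sum.swap) (simp add: algebra_simps)
  then have "(\<Sum>a\<in>A. \<mu> a * poly p (ternary a)) = (\<Sum>a\<in>A. \<nu> a * poly p (ternary a))"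
    using eq by simp
  moreover have "(\<Sum>a\<in>A. f a * poly p (ternary a)) = f c * poly p (ternary c)" for f
  proof -
    have "poly p (ternary a) = 0" if "a \<in> A - {c}" for a
      unfolding p_def poly_prod using assms(1) that by (auto intro!: bexI[of _ a])
    then show ?thesis
      using assms(1) c by (subst sum.remove[of _ c]) auto
  qed
  moreover have "poly p (ternary c) \<noteq> 0"
    unfolding p_def poly_prod
    using assms(1,2) c ternary_inj by (auto simp: inj_on_def)
  ultimately show ?thesis
    by simp
qed

text \<open>Uniqueness of the weights is what makes the support of a point accessible: the point
  avoids the hull of \<open>A - C\<close> iff its weights charge \<open>C\<close>.\<close>

lemma moment_hull_diff_Un:
  assumes "finite A" "A \<subseteq> cantor" "card A \<le> Suc n"
    and "x \<in> moment_hull n (A - C)" "x \<in> moment_hull n (A - D)"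
  shows "x \<in> moment_hull n (A - (C \<union> D))"
proof -
  obtain \<mu> where \<mu>: "\<forall>a\<in>A - C. 0 \<le> \<mu> a" "\<forall>j\<le>n. (\<Sum>a\<in>A - C. \<mu> a * ternary a ^ j) = homogeneous x j"
    using assms(4) by (auto simp: moment_hull_def)
  obtain \<nu> where \<nu>: "\<forall>a\<in>A - D. 0 \<le> \<nu> a" "\<forall>j\<le>n. (\<Sum>a\<in>A - D. \<nu> a * ternary a ^ j) = homogeneous x j"
    using assms(5) by (auto simp: moment_hull_def)
  let ?\<mu> = "\<lambda>a. if a \<in> C then 0 else \<mu> a" and ?\<nu> = "\<lambda>a. if a \<in> D then 0 else \<nu> a"
  have mu: "(\<Sum>a\<in>A. ?\<mu> a * ternary a ^ j) = homogeneous x j" if "j \<le> n" for j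
  proof -
    have "(\<Sum>a\<in>A. ?\<mu> a * ternary a ^ j) = (\<Sum>a\<in>A - C. \<mu> a * ternary a ^ j)"
      by (rule sum.mono_neutral_cong_right) (use assms(1) in auto)
    with \<mu>(2) that show ?thesis by simp
  qed
  have nu: "(\<Sum>a\<in>A. ?\<nu> a * ternary a ^ j) = homogeneous x j" if "j \<le> n" for j
  proof -
    have "(\<Sum>a\<in>A. ?\<nu> a * ternary a ^ j) = (\<Sum>a\<in>A - D. \<nu> a * ternary a ^ j)"
      by (rule sum.mono_neutral_cong_right) (use assms(1) in auto)
    with \<nu>(2) that show ?thesis by simp
  qed
  have "?\<mu> a = ?\<nu> a" if "a \<in> A" for a
    by (rule moment_weights_unique[OF assms(1-3) _ that]) (simp add: mu nu)
  \<comment> \<open>The weights \<mu>, extended by zero, agree with the extended \<nu>, which vanish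
    on D.\<close>
  then have zero: "\<mu> a = 0" if "a \<in> A" "a \<in> D" "a \<notin> C" for a
    using that by fastforce
  have "(\<Sum>a\<in>A - (C \<union> D). \<mu> a * ternary a ^ j) = homogeneous x j" if "j \<le> n" for j
  proof -
    have "(\<Sum>a\<in>A. ?\<mu> a * ternary a ^ j) = (\<Sum>a\<in>A - (C \<union> D). \<mu> a * ternary a ^ j)"
      by (rule sum.mono_neutral_cong_right) (use assms(1) zero in auto)
    with mu that show ?thesis by simp
  qed
  with \<mu>(1) assms(4) show ?thesis
    by (auto simp: moment_hull_def)
qed

subsection \<open>Representing points of the hull by binary sequences\<close>

text \<open>A binary sequence codes \<open>n + 1\<close> points of Cantor space and \<open>n + 1\<close> weights.\<close>

definition hull_point :: "nat \<Rightarrow> baire \<Rightarrow> nat \<Rightarrow> baire" where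
  "hull_point n b i j = b ((2 * n + 2) * j + i)"

definition hull_weight :: "nat \<Rightarrow> baire \<Rightarrow> nat \<Rightarrow> baire" where
  "hull_weight n b i j = b ((2 * n + 2) * j + (n + 1 + i))"

lemma hull_point_in_cantor: "b \<in> cantor \<Longrightarrow> hull_point n b i \<in> cantor"
  and hull_weight_in_cantor: "b \<in> cantor \<Longrightarrow> hull_weight n b i \<in> cantor"
  by (simp_all add: cantor_def hull_point_def hull_weight_def)

text \<open>Repeated points and zero weights are allowed, so the same n + 1 slots serve for any
  number of points from 1 to n + 1.\<close>

definition hull_rep :: "nat \<Rightarrow> baire set \<Rightarrow> (nat \<Rightarrow> real) \<Rightarrow> baire \<Rightarrow> bool" where
  "hull_rep n S x b \<longleftrightarrow> (\<forall>i<n + 1. hull_point n b i \<in> S) \<and>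
     (\<forall>j<n + 1. (\<Sum>i<n + 1. value_of 2 (hull_weight n b i) * ternary (hull_point n b i) ^ j) =
        homogeneous x j)"

lemma hull_combine:
  assumes "\<And>i. i \<le> n \<Longrightarrow> a i \<in> cantor" "\<And>i. i \<le> n \<Longrightarrow> \<beta> i \<in> cantor"
  obtains b where "b \<in> cantor" "\<And>i. i \<le> n \<Longrightarrow> hull_point n b i = a i"
    "\<And>i. i \<le> n \<Longrightarrow> hull_weight n b i = \<beta> i"
proof -
  define b where "b k = (let j = k div (2 * n + 2); i = k mod (2 * n + 2) in
    if i \<le> n then a i j else \<beta> (i - (n + 1)) j)" for k
  have dm: "((2 * n + 2) * j + i) div (2 * n + 2) = j" "((2 * n + 2) * j + i) mod (2 * n + 2) = i"
    if "i < 2 * n + 2" for i j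
    using that by (simp_all only: div_mult_self4 mod_mult_self4 div_less mod_less)
  show thesis
  proof
    have "b k < 2" for k
    proof -
      have "k mod (2 * n + 2) < 2 * n + 2" by simp
      then have "k mod (2 * n + 2) \<le> n \<or> k mod (2 * n + 2) - (n + 1) \<le> n"
        by linarith
      then show ?thesis
        using assms unfolding b_def Let_def cantor_def by auto
    qed
    then show "b \<in> cantor" by (simp add: cantor_def)
    show "hull_point n b i = a i" if "i \<le> n" for i
      using that dm[of i] by (simp add: fun_eq_iff hull_point_def b_def)
    show "hull_weight n b i = \<beta> i" if "i \<le> n" for i
      using that dm[of "n + 1 + i"] by (auto simp: fun_eq_iff hull_weight_def b_def Let_def)
  qed
qed

text \<open>Parametrizes the hull by binary sequences, to which compactness applies. Weights of
  slots with the same point are added up; conversely, surplus slots repeat the point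
  \<open>h 0\<close> with weight 0.\<close>

lemma moment_hull_iff_rep:
  assumes "finite S" "S \<subseteq> cantor" "card S \<le> n + 1" "\<forall>i\<ge>n. x i = 0"
  shows "x \<in> moment_hull n S \<longleftrightarrow> (\<exists>b\<in>cantor. hull_rep n S x b)"
proof
  assume "\<exists>b\<in>cantor. hull_rep n S x b"
  then obtain b where b: "b \<in> cantor" and S: "\<And>i. i < n + 1 \<Longrightarrow> hull_point n b i \<in> S"
    and eq: "\<And>j. j < n + 1 \<Longrightarrow> (\<Sum>i<n + 1. value_of 2 (hull_weight n b i) * ternary (hull_point n b i) ^ j) =
        homogeneous x j"
    unfolding hull_rep_def by blast
  define \<mu> where "\<mu> a = (\<Sum>i\<in>{i\<in>{..<n + 1}. hull_point n b i = a}. value_of 2 (hull_weight n b i))" for a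
  have "(\<Sum>a\<in>S. \<mu> a * ternary a ^ j) = homogeneous x j" if "j \<le> n" for j
  proof -
    have "(\<Sum>a\<in>S. \<mu> a * ternary a ^ j) = (\<Sum>a\<in>S. \<Sum>i\<in>{i\<in>{..<n + 1}. hull_point n b i = a}.
        value_of 2 (hull_weight n b i) * ternary (hull_point n b i) ^ j)"
      unfolding \<mu>_def sum_distrib_right by (intro sum.cong) auto
    also have "\<dots> = (\<Sum>i<n + 1. value_of 2 (hull_weight n b i) * ternary (hull_point n b i) ^ j)"
      by (rule sum.group) (use S assms(1) in auto)
    finally show ?thesis using eq that by simp
  qed
  moreover have "0 \<le> value_of 2 (hull_weight n b i)" for i
    using has_value_bounds[OF has_value_value_of, of 2 "hull_weight n b i"]
      hull_weight_in_cantor[OF b, of n i] by (auto simp: cantor_def)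
  then have "0 \<le> \<mu> a" for a
    unfolding \<mu>_def by (intro sum_nonneg)
  ultimately show "x \<in> moment_hull n S"
    using assms(4) unfolding moment_hull_def by blast
next
  assume x: "x \<in> moment_hull n S"
  then obtain \<mu> where \<mu>: "\<forall>a\<in>S. 0 \<le> \<mu> a" "\<forall>j\<le>n. (\<Sum>a\<in>S. \<mu> a * ternary a ^ j) = homogeneous x j"
    by (auto simp: moment_hull_def)
  have "S \<noteq> {}"
    using x moment_hull_empty[of n] by auto
  have sum1: "(\<Sum>a\<in>S. \<mu> a) = 1"
    using \<mu>(2)[rule_format, of 0] by (simp add: homogeneous_def)
  have \<mu>1: "\<mu> a \<le> 1" if "a \<in> S" for a
    using member_le_sum[of a S \<mu>] that \<mu>(1) assms(1) sum1 by auto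
  obtain h where h: "bij_betw h {0..<card S} S"
    using ex_bij_betw_nat_finite[OF assms(1)] by blast
  have card: "0 < card S"
    using \<open>S \<noteq> {}\<close> assms(1) by (simp add: card_gt_0_iff)
  define a where "a i = (if i < card S then h i else h 0)" for i
  define l where "l i = (if i < card S then \<mu> (h i) else 0)" for i
  have hS: "h i \<in> S" if "i < card S" for i
    using bij_betwE[OF h] that by simp
  have a: "a i \<in> S" for i
    using hS card by (simp add: a_def)
  have "0 \<le> l i \<and> l i \<le> 1" for i
    using hS \<mu>(1) \<mu>1 by (simp add: l_def)
  then have "\<forall>i. \<exists>\<beta>. \<beta> \<in> cantor \<and> has_value 2 \<beta> (l i)"
    using ex_binary by (simp add: Bex_def)
  then have "\<exists>\<beta>. \<forall>i. \<beta> i \<in> cantor \<and> has_value 2 (\<beta> i) (l i)"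
    by (rule choice)
  then obtain \<beta> where \<beta>: "\<And>i. \<beta> i \<in> cantor" "\<And>i. has_value 2 (\<beta> i) (l i)"
    by blast
  obtain b where b: "b \<in> cantor" "\<And>i. i \<le> n \<Longrightarrow> hull_point n b i = a i"
    "\<And>i. i \<le> n \<Longrightarrow> hull_weight n b i = \<beta> i"
    by (rule hull_combine[of n a \<beta>]) (use a \<beta>(1) assms(2) in auto)
  have "(\<Sum>i<n + 1. value_of 2 (hull_weight n b i) * ternary (hull_point n b i) ^ j) = homogeneous x j"
    if "j < n + 1" for j
  proof -
    have "(\<Sum>i<n + 1. value_of 2 (hull_weight n b i) * ternary (hull_point n b i) ^ j) =
        (\<Sum>i<n + 1. l i * ternary (a i) ^ j)"
      by (intro sum.cong) (auto simp: b value_of_eq[OF \<beta>(2)])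
    also have "\<dots> = (\<Sum>i\<in>{0..<card S}. \<mu> (h i) * ternary (h i) ^ j)"
      by (rule sum.mono_neutral_cong_right) (use assms(3) in \<open>auto simp: l_def a_def\<close>)
    also have "\<dots> = (\<Sum>a\<in>S. \<mu> a * ternary a ^ j)"
      using h by (rule sum.reindex_bij_betw)
    finally show ?thesis using \<mu>(2) that by simp
  qed
  then have "hull_rep n S x b"
    using a b(2) by (auto simp: hull_rep_def)
  with b(1) show "\<exists>b\<in>cantor. hull_rep n S x b" by blast
qed

subsection \<open>Testing that a point avoids the hull\<close>

text \<open>Functionals have natural values; splitting the numerator into its positive and negative
  part allows rationals to be compared without signs.\<close>

definition code_pos :: "nat \<Rightarrow> nat" where
  "code_pos c = (if even (\<pi>1 c) then \<pi>1 c div 2 else 0)"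

definition code_neg :: "nat \<Rightarrow> nat" where
  "code_neg c = (if even (\<pi>1 c) then 0 else \<pi>1 c div 2 + 1)"

lemma rat_code_eq: "rat_code c = (real (code_pos c) - real (code_neg c)) / real (Suc (\<pi>2 c))"
  by (auto simp: rat_code_def code_pos_def code_neg_def int_decode_def sum_decode_def case_prod_beta)

text \<open>The distance of the coded rational from Y / Z exceeds W / Z: denominators are cleared
  and terms are moved so that no truncated subtraction occurs.\<close>

definition far :: "nat \<Rightarrow> nat \<Rightarrow> nat \<Rightarrow> nat \<Rightarrow> bool" where
  "far c Y W Z \<longleftrightarrow>
     code_neg c * Z + Y * Suc (\<pi>2 c) + W * Suc (\<pi>2 c) < code_pos c * Z \<or>
     code_pos c * Z + W * Suc (\<pi>2 c) < Y * Suc (\<pi>2 c) + code_neg c * Z"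

lemma far_iff:
  assumes "Z > 0"
  shows "far c Y W Z \<longleftrightarrow> real W / real Z < \<bar>rat_code c - real Y / real Z\<bar>"
proof -
  define D where "D = real (Suc (\<pi>2 c))"
  have D: "D > 0" by (simp add: D_def)
  have Z: "real Z > 0" using assms by simp
  define P where "P = real (code_pos c)"
  define N where "N = real (code_neg c)"
  have "far c Y W Z \<longleftrightarrow> N * Z + Y * D + W * D < P * Z \<or> P * Z + W * D < Y * D + N * Z"
    unfolding far_def D_def P_def N_def of_nat_mult[symmetric] of_nat_add[symmetric] of_nat_less_iff ..
  also have "N * Z + Y * D + W * D < P * Z \<longleftrightarrow> W / Z < (P - N) / D - Y / Z"
    using D Z by (simp add: field_simps)
  also have "P * Z + W * D < Y * D + N * Z \<longleftrightarrow> W / Z < Y / Z - (P - N) / D"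
    using D Z by (simp add: field_simps)
  finally show ?thesis
    unfolding rat_code_eq D_def[symmetric] P_def[symmetric] N_def[symmetric] by linarith
qed

lemma cfd_even [cf_intros]: "cf f \<Longrightarrow> cfd (\<lambda>p n. even (f p n))"
  unfolding even_iff_mod_2_eq_zero by (intro cf_intros)

lemma cf_code_pos [cf_intros]: "cf f \<Longrightarrow> cf (\<lambda>p n. code_pos (f p n))"
  unfolding code_pos_def by (intro cf_intros)

lemma cf_code_neg [cf_intros]: "cf f \<Longrightarrow> cf (\<lambda>p n. code_neg (f p n))"
  unfolding code_neg_def by (intro cf_intros)

lemma cfd_far [cf_intros]:
  "cf c \<Longrightarrow> cf Y \<Longrightarrow> cf W \<Longrightarrow> cf Z \<Longrightarrow> cfd (\<lambda>p n. far (c p n) (Y p n) (W p n) (Z p n))"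
  unfolding far_def by (intro cf_intros)

text \<open>The bound on u makes l = 0, u = 1 a code of the empty cylinder. Removing it leaves A
  unchanged, which is how \<open>hull_name\<close> tests the whole hull.\<close>

definition in_cylinder :: "nat \<Rightarrow> nat \<Rightarrow> baire \<Rightarrow> bool" where
  "in_cylinder l u a \<longleftrightarrow> u < 2 ^ l \<and> (\<forall>i<l. a i = bits u i)"

text \<open>The number \<open>prod_encode (2, 0)\<close> codes the rational 1, the moment of order 0.\<close>

definition moment_code :: "nat \<Rightarrow> baire \<Rightarrow> nat \<Rightarrow> nat \<Rightarrow> nat" where
  "moment_code n q j M = (if j = 0 then prod_encode (2, 0) else q (n * M + (j - 1)))"

text \<open>Numerator of the j-th moment computed from M digits, over the common denominator
  \<open>2 ^ M * 3 ^ (M * j)\<close>.\<close>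

definition moment_sum :: "nat \<Rightarrow> baire \<Rightarrow> nat \<Rightarrow> nat \<Rightarrow> nat" where
  "moment_sum n b j M = (\<Sum>i<n + 1. digits 2 (hull_weight n b i) M *
     digits 3 (\<lambda>k. 2 * hull_point n b i k) M ^ j)"

text \<open>The tolerance \<open>(n + 2) ^ 2 / 2 ^ M\<close> covers the error
  \<open>(n + 1) ^ 2 / 2 ^ M\<close> of the truncated moments plus the error
  \<open>1 / 2 ^ M\<close> of the name of x. The condition \<open>l \<le> M\<close> lets the
  cylinder test read only the first M bits of a point.\<close>

definition hull_reject :: "nat \<Rightarrow> baire \<Rightarrow> baire \<Rightarrow> nat \<Rightarrow> nat \<Rightarrow> baire \<Rightarrow> nat \<Rightarrow> bool" where
  "hull_reject n p q l u b M \<longleftrightarrow>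
     (\<exists>i<n + 1. rejects p (hull_point n b i) M \<or> l \<le> M \<and> in_cylinder l u (hull_point n b i)) \<or>
     (\<exists>j<n + 1. far (moment_code n q j M) (moment_sum n b j M) ((n + 2) ^ 2 * 3 ^ (M * j))
        (2 ^ M * 3 ^ (M * j)))"

text \<open>Stage M reads M bits of each of the \<open>2 * n + 2\<close> interleaved tracks.\<close>

definition off_hull :: "nat \<Rightarrow> baire \<Rightarrow> baire \<Rightarrow> nat \<Rightarrow> nat \<Rightarrow> nat \<Rightarrow> bool" where
  "off_hull n p q l u s \<longleftrightarrow> exhausted (\<lambda>M. (2 * n + 2) * M) (hull_reject n p q l u) s"

lemma cfd_off_hull:
  assumes P: "cf (\<lambda>p z. P p (\<pi>1 z) (\<pi>2 z))" and Q: "cf (\<lambda>p z. Q p (\<pi>1 z) (\<pi>2 z))"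
    and l: "cf l" and u: "cf u" and s: "cf s"
  shows "cfd (\<lambda>p z. off_hull n (P p z) (Q p z) (l p z) (u p z) (s p z))"
  unfolding off_hull_def
  by (intro cfd_exhausted; (unfold hull_reject_def in_cylinder_def moment_code_def moment_sum_def
      hull_weight_def hull_point_def)?)
    (intro cf_intros cf_comp2[OF P] cf_comp2[OF Q] cf_comp[OF l] cf_comp[OF u] s)+

lemma hull_reject_local:
  assumes "hull_reject n p q l u b M" "\<forall>k<(2 * n + 2) * M. b' k = b k"
  shows "hull_reject n p q l u b' M"
proof -
  have lt: "(2 * n + 2) * j + i < (2 * n + 2) * M" if "j < M" "i < 2 * n + 2" for i j
  proof -
    have "(2 * n + 2) * j + i < (2 * n + 2) * Suc j"
      using that(2) by simp
    also have "\<dots> \<le> (2 * n + 2) * M"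
      using that(1) by (intro mult_le_mono2) simp
    finally show ?thesis .
  qed
  have pt: "hull_point n b' i j = hull_point n b i j" if "j < M" "i < n + 1" for i j
    unfolding hull_point_def using assms(2) lt[OF that(1), of i] that(2) by simp
  have wt: "hull_weight n b' i j = hull_weight n b i j" if "j < M" "i < n + 1" for i j
    unfolding hull_weight_def using assms(2)[rule_format, OF lt[OF that(1), of "n + 1 + i"]] that(2) by simp
  have "moment_sum n b' j M = moment_sum n b j M" for j
    unfolding moment_sum_def
    by (intro sum.cong refl arg_cong2[where f = "(*)"] arg_cong[where f = "\<lambda>z. z ^ j"] digits_cong)
      (use pt wt in auto)
  moreover have "rejects p (hull_point n b i) M \<or> l \<le> M \<and> in_cylinder l u (hull_point n b i) \<Longrightarrow>
      rejects p (hull_point n b' i) M \<or> l \<le> M \<and> in_cylinder l u (hull_point n b' i)" if "i < n + 1" for i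
    using rejects_cong[of p "hull_point n b i" M "hull_point n b' i"] pt that
    by (auto simp: in_cylinder_def)
  ultimately show ?thesis
    using assms(1) unfolding hull_reject_def by metis
qed

text \<open>Powers of order at most n are n-Lipschitz on the unit interval. So each of the n + 1
  summands is off by at most \<open>1 / 2 ^ M\<close> from the weight and \<open>n / 2 ^ M\<close>
  from the node.\<close>

lemma moment_sum_error:
  assumes "b \<in> cantor" "j \<le> n"
  shows "\<bar>real (moment_sum n b j M) / (2 ^ M * 3 ^ (M * j)) -
     (\<Sum>i<n + 1. value_of 2 (hull_weight n b i) * ternary (hull_point n b i) ^ j)\<bar> \<le> (real n + 1) ^ 2 / 2 ^ M"
proof -
  define L where "L i = real (digits 2 (hull_weight n b i) M) / 2 ^ M" for i
  define T where "T i = real (digits 3 (\<lambda>k. 2 * hull_point n b i k) M) / 3 ^ M" for i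
  define l where "l i = value_of 2 (hull_weight n b i)" for i
  define t where "t i = ternary (hull_point n b i)" for i
  have hl: "has_value 2 (hull_weight n b i) (l i)" for i
    unfolding l_def using hull_weight_in_cantor[OF assms(1), of n i]
    by (intro has_value_value_of) (auto simp: cantor_def)
  have ht: "has_value 3 (\<lambda>k. 2 * hull_point n b i k) (t i)" for i
    unfolding t_def by (intro has_value_ternary hull_point_in_cantor assms)
  have l: "0 \<le> l i" "l i \<le> 1" and t: "0 \<le> t i" "t i \<le> 1" for i
    using has_value_bounds[OF hl] has_value_bounds[OF ht] by auto
  have L: "\<bar>L i - l i\<bar> \<le> 1 / 2 ^ M" for i
    using has_value_error[OF hl[of i], of M] by (simp add: L_def)
  have "\<bar>T i - t i\<bar> \<le> 1 / 3 ^ M" for i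
    using has_value_error[OF ht[of i], of M] by (simp add: T_def)
  also have "1 / 3 ^ M \<le> (1 / 2 ^ M :: real)"
    by (simp add: frac_le power_mono)
  finally have T: "\<bar>T i - t i\<bar> \<le> 1 / 2 ^ M" for i .
  have "real (digits 3 (\<lambda>k. 2 * hull_point n b i k) M) \<le> t i * 3 ^ M" for i
    using ht unfolding has_value_def by (metis of_nat_numeral)
  then have "T i \<le> t i" for i
    by (simp add: T_def divide_le_eq)
  then have T01: "0 \<le> T i" "T i \<le> 1" for i
    using t(2)[of i] order_trans[of "T i" "t i" 1] by (simp_all add: T_def)
  have summand: "\<bar>L i * T i ^ j - l i * t i ^ j\<bar> \<le> (real n + 1) / 2 ^ M" for i
  proof -
    have "\<bar>T i ^ j - t i ^ j\<bar> \<le> real j * \<bar>T i - t i\<bar>"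
      using norm_power_diff[of "T i" "t i" j] T01 t by simp
    also have "\<dots> \<le> real n * (1 / 2 ^ M)"
      using T assms(2) by (intro mult_mono) auto
    finally have pow: "\<bar>T i ^ j - t i ^ j\<bar> \<le> real n / 2 ^ M" by simp
    have "L i * T i ^ j - l i * t i ^ j = (L i - l i) * T i ^ j + l i * (T i ^ j - t i ^ j)"
      by (simp add: algebra_simps)
    then have "\<bar>L i * T i ^ j - l i * t i ^ j\<bar> \<le> \<bar>L i - l i\<bar> * T i ^ j + l i * \<bar>T i ^ j - t i ^ j\<bar>"
      using abs_triangle_ineq[of "(L i - l i) * T i ^ j" "l i * (T i ^ j - t i ^ j)"] T01 l
      by (simp add: abs_mult)
    also have "\<dots> \<le> (1 / 2 ^ M) * 1 + 1 * (real n / 2 ^ M)"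
      using L pow T01 l by (intro add_mono mult_mono) (auto intro: power_le_one)
    finally show ?thesis by (simp add: add_divide_distrib)
  qed
  have "real (moment_sum n b j M) / (2 ^ M * 3 ^ (M * j)) = (\<Sum>i<n + 1. L i * T i ^ j)"
    unfolding moment_sum_def L_def T_def
    by (simp add: sum_divide_distrib power_divide power_mult del: sum.lessThan_Suc)
  then have "\<bar>real (moment_sum n b j M) / (2 ^ M * 3 ^ (M * j)) - (\<Sum>i<n + 1. l i * t i ^ j)\<bar> =
      \<bar>\<Sum>i<n + 1. L i * T i ^ j - l i * t i ^ j\<bar>"
    by (simp add: sum_subtractf)
  also have "\<dots> \<le> (\<Sum>i<n + 1. \<bar>L i * T i ^ j - l i * t i ^ j\<bar>)"
    by (rule sum_abs)
  also have "\<dots> \<le> (\<Sum>i<n + 1. (real n + 1) / 2 ^ M)"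
    by (intro sum_mono summand)
  also have "\<dots> = (real n + 1) ^ 2 / 2 ^ M"
    by (simp add: power2_eq_square algebra_simps del: sum.lessThan_Suc)
  finally show ?thesis by (simp only: l_def t_def)
qed

lemma moment_code_error:
  assumes "cube_name n q x" "j \<le> n"
  shows "\<bar>rat_code (moment_code n q j M) - homogeneous x j\<bar> \<le> 1 / 2 ^ M"
proof (cases j)
  case 0
  have "rat_code (prod_encode (2, 0)) = 1"
    using rat_code_dyadic[of 1 0] by simp
  with 0 show ?thesis by (simp add: moment_code_def homogeneous_def)
next
  case (Suc i)
  with assms have "cauchy_name (\<lambda>m. q (n * m + i)) (x i)"
    by (auto simp: cube_name_def)
  with Suc show ?thesis
    by (simp add: cauchy_name_def moment_code_def homogeneous_def power_one_over)
qed

text \<open>The errors stay within the tolerance, so a rejection is never wrong. A true discrepancy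
  eventually exceeds twice the tolerance and is then noticed.\<close>

lemma ex_hull_reject_iff:
  assumes p: "closed_name (words 2) p A" and q: "cube_name n q x" and b: "b \<in> cantor"
  shows "(\<exists>M. hull_reject n p q l u b M) \<longleftrightarrow> \<not> hull_rep n (A - Collect (in_cylinder l u)) x b"
proof -
  have pt: "words 2 (hull_point n b i) = Some (hull_point n b i)" for i
    using hull_point_in_cantor[OF b] by (simp add: words_2_eq_Some)
  have rej: "(\<exists>M. rejects p (hull_point n b i) M) \<longleftrightarrow> hull_point n b i \<notin> A" for i
    by (rule rejects_iff[OF p, OF pt])
  define \<Sigma> where "\<Sigma> j = (\<Sum>i<n + 1. value_of 2 (hull_weight n b i) * ternary (hull_point n b i) ^ j)" for j
  define V where "V j M = real (moment_sum n b j M) / (2 ^ M * 3 ^ (M * j))" for j M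
  define C where "C j M = rat_code (moment_code n q j M)" for j M
  have far: "far (moment_code n q j M) (moment_sum n b j M) ((n + 2) ^ 2 * 3 ^ (M * j))
        (2 ^ M * 3 ^ (M * j)) \<longleftrightarrow> (real n + 2) ^ 2 / 2 ^ M < \<bar>C j M - V j M\<bar>" for j M
    by (subst far_iff) (simp_all add: C_def V_def add.commute)
  have err: "\<bar>(C j M - V j M) - (homogeneous x j - \<Sigma> j)\<bar> \<le> (real n + 2) ^ 2 / 2 ^ M" if "j < n + 1" for j M
  proof -
    have "\<bar>V j M - \<Sigma> j\<bar> \<le> (real n + 1) ^ 2 / 2 ^ M"
      using moment_sum_error[OF b, of j n M] that by (simp add: V_def \<Sigma>_def del: sum.lessThan_Suc)
    moreover have "\<bar>C j M - homogeneous x j\<bar> \<le> 1 / 2 ^ M"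
      using moment_code_error[OF q, of j M] that by (simp add: C_def)
    moreover have "(real n + 1) ^ 2 / 2 ^ M + 1 / 2 ^ M \<le> (real n + 2) ^ 2 / 2 ^ M"
      unfolding add_divide_distrib[symmetric]
      by (intro divide_right_mono) (simp_all add: power2_eq_square algebra_simps)
    ultimately show ?thesis by linarith
  qed
  show ?thesis
  proof
    assume "\<exists>M. hull_reject n p q l u b M"
    then obtain M where "hull_reject n p q l u b M" ..
    then consider i where "i < n + 1" "hull_point n b i \<notin> A - Collect (in_cylinder l u)" |
      j where "j < n + 1" "(real n + 2) ^ 2 / 2 ^ M < \<bar>C j M - V j M\<bar>"
      unfolding hull_reject_def far using rej by blast
    then show "\<not> hull_rep n (A - Collect (in_cylinder l u)) x b"
    proof cases
      case 2
      then have "\<Sigma> j \<noteq> homogeneous x j"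
        using err[of j M] by auto
      with 2 show ?thesis
        unfolding hull_rep_def \<Sigma>_def by blast
    qed (auto simp: hull_rep_def)
  next
    assume "\<not> hull_rep n (A - Collect (in_cylinder l u)) x b"
    then consider i where "i < n + 1" "hull_point n b i \<notin> A" |
      i where "i < n + 1" "in_cylinder l u (hull_point n b i)" |
      j where "j < n + 1" "\<Sigma> j \<noteq> homogeneous x j"
      unfolding hull_rep_def \<Sigma>_def by blast
    then show "\<exists>M. hull_reject n p q l u b M"
    proof cases
      case 1
      then show ?thesis using rej unfolding hull_reject_def by blast
    next
      case 2
      then show ?thesis unfolding hull_reject_def by blast
    next
      case 3
      have "\<exists>M. (real n + 2) ^ 2 / 2 ^ M < \<bar>C j M - V j M\<bar>"
      proof (rule ccontr)
        assume "\<not> ?thesis"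
        then have near: "\<bar>C j M - V j M\<bar> \<le> (real n + 2) ^ 2 / 2 ^ M" for M
          by (meson not_le)
        have "\<bar>homogeneous x j - \<Sigma> j\<bar> \<le> (2 * (real n + 2) ^ 2) / real 2 ^ M" for M
        proof -
          have "\<bar>homogeneous x j - \<Sigma> j\<bar> \<le> (real n + 2) ^ 2 / 2 ^ M + (real n + 2) ^ 2 / 2 ^ M"
            using near[of M] err[OF 3(1), of M] by linarith
          then show ?thesis by simp
        qed
        then have "\<bar>homogeneous x j - \<Sigma> j\<bar> \<le> 0"
          by (rule le_all_inverse_power_imp_le_0[rotated]) simp
        with 3(2) show False by simp
      qed
      with 3(1) show ?thesis
        unfolding hull_reject_def far by blast
    qed
  qed
qed

lemma mono_mult_left: "mono (\<lambda>M :: nat. c * M)"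
  by (simp add: mono_def)

lemma off_hull_mono: "off_hull n p q l u s \<Longrightarrow> s \<le> t \<Longrightarrow> off_hull n p q l u t"
  unfolding off_hull_def
  by (rule exhausted_mono[OF hull_reject_local mono_mult_left])

text \<open>With the empty cylinder this yields a name of the hull; with other cylinders it
  recognizes that the weights of a point of the hull charge the cylinder.\<close>

lemma ex_off_hull_iff:
  assumes p: "closed_name (words 2) p A" and q: "cube_name n q x" and A: "finite A" "card A \<le> n + 1"
  shows "(\<exists>s. off_hull n p q l u s) \<longleftrightarrow> x \<notin> moment_hull n (A - Collect (in_cylinder l u))"
proof -
  have "A \<subseteq> cantor"
    using p unfolding closed_name_def by (auto simp: ran_def words_2_eq_Some)
  moreover have "card (A - Collect (in_cylinder l u)) \<le> n + 1"
    using A card_mono[of A "A - Collect (in_cylinder l u)"] by (meson Diff_subset order_trans)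
  ultimately have "x \<in> moment_hull n (A - Collect (in_cylinder l u)) \<longleftrightarrow>
      (\<exists>b\<in>cantor. hull_rep n (A - Collect (in_cylinder l u)) x b)"
    using A q by (intro moment_hull_iff_rep) (auto simp: cube_name_def)
  moreover have "(\<exists>s. off_hull n p q l u s) \<longleftrightarrow> (\<forall>b\<in>cantor. \<exists>M. hull_reject n p q l u b M)"
    unfolding off_hull_def by (rule ex_exhausted_iff[OF hull_reject_local mono_mult_left])
  ultimately show ?thesis
    using ex_hull_reject_iff[OF p q] by auto
qed

text \<open>Stages up to s consult approximations of precision at most s. This fixes the amount of
  input for which \<open>hull_name\<close> waits.\<close>

lemma off_hull_cong:
  assumes "n \<ge> 1" "\<And>k. k < n * Suc s \<Longrightarrow> q' k = q k"
  shows "off_hull n p q' l u s \<longleftrightarrow> off_hull n p q l u s"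
proof -
  have code: "moment_code n q' j M = moment_code n q j M" if "M \<le> s" "j < n + 1" for j M
  proof (cases "j = 0")
    case False
    have "n * M + (j - 1) < n * Suc M"
      using that(2) False by auto
    also have "\<dots> \<le> n * Suc s"
      using that(1) by (intro mult_le_mono2) simp
    finally show ?thesis
      using assms(2) by (simp add: moment_code_def)
  qed (simp add: moment_code_def)
  have "hull_reject n p q' l u b M \<longleftrightarrow> hull_reject n p q l u b M" if "M < Suc s" for b M
    unfolding hull_reject_def using that by (simp add: code less_Suc_eq_le cong: conj_cong)
  then show ?thesis
    unfolding off_hull_def exhausted_def by (simp cong: conj_cong)
qed

subsection \<open>The reduction\<close>

text \<open>An associate asks for more input by \<open>0\<close> and gives the output \<open>r\<close> by \<open>Suc r\<close>.\<close>

definition hull_name :: "nat \<Rightarrow> baire \<Rightarrow> baire" where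
  "hull_name n p c = (if code_length c = n * Suc (code_nth c 0) + 1
     then if off_hull n p (\<lambda>i. code_nth c (Suc i)) 0 1 (code_nth c 0) then 2 else 1
     else 0)"

lemma cf_hull_name: "cf (hull_name n)"
  unfolding hull_name_def by (intro cf_intros cfd_off_hull)

lemma hull_name_list_encode:
  "hull_name n p (list_encode (m # map q [0..<k])) =
     (if k = n * Suc m then if off_hull n p (\<lambda>i. code_nth (list_encode (m # map q [0..<k])) (Suc i)) 0 1 m
      then 2 else 1 else 0)"
proof -
  have "code_length (list_encode (m # map q [0..<k])) = Suc k"
    by (simp only: code_length_list_encode) simp
  moreover have "code_nth (list_encode (m # map q [0..<k])) 0 = m"
    by (subst code_nth_list_encode) simp_all
  ultimately show ?thesis
    unfolding hull_name_def by (simp only: Suc_eq_plus1[symmetric] nat.inject)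
qed

lemma associate_hull_name:
  assumes "n \<ge> 1"
  shows "associate (hull_name n p) q (\<lambda>m. if off_hull n p q 0 1 m then 1 else 0)"
  unfolding associate_def
proof (intro allI exI conjI impI)
  fix m
  have "off_hull n p (\<lambda>i. code_nth (list_encode (m # map q [0..<n * Suc m])) (Suc i)) 0 1 m \<longleftrightarrow>
      off_hull n p q 0 1 m"
    using assms by (intro off_hull_cong) (simp_all add: code_nth_list_encode del: list_encode.simps mult_Suc_right)
  then show "hull_name n p (list_encode (m # map q [0..<n * Suc m])) =
      Suc (if off_hull n p q 0 1 m then 1 else 0)"
    by (simp add: hull_name_list_encode del: list_encode.simps mult_Suc_right)
  show "hull_name n p (list_encode (m # map q [0..<l])) = 0" if "l < n * Suc m" for l
    using that by (simp add: hull_name_list_encode del: list_encode.simps mult_Suc_right)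
qed

definition coordinate :: "nat \<Rightarrow> baire \<Rightarrow> nat \<Rightarrow> baire" where
  "coordinate n b i j = b (n * j + i)"

lemma coordinate_in_cantor: "b \<in> cantor \<Longrightarrow> coordinate n b i \<in> cantor"
  by (simp add: coordinate_def cantor_def)

lemma coordinate_combine:
  assumes "n \<ge> 1" "\<And>i. i < n \<Longrightarrow> \<beta> i \<in> cantor"
  obtains b where "b \<in> cantor" "\<And>i. i < n \<Longrightarrow> coordinate n b i = \<beta> i"
proof
  let ?b = "\<lambda>k. \<beta> (k mod n) (k div n)"
  show "?b \<in> cantor"
    using assms by (simp add: cantor_def)
  show "coordinate n ?b i = \<beta> i" if "i < n" for i
    using that by (simp add: coordinate_def fun_eq_iff)
qed

text \<open>Every binary sequence yields a name of a point of the cube in this way, which carries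
  compactness of Cantor space over to the cube.\<close>

definition bit_name :: "nat \<Rightarrow> baire \<Rightarrow> baire" where
  "bit_name n b t = prod_encode (2 * digits 2 (coordinate n b (t mod n)) (t div n), 2 ^ (t div n) - 1)"

lemma cube_name_bit_name:
  assumes "\<And>i. i < n \<Longrightarrow> has_value 2 (coordinate n b i) (x i)" "\<forall>i\<ge>n. x i = 0"
  shows "cube_name n (bit_name n b) x"
proof -
  have "cauchy_name (\<lambda>m. bit_name n b (n * m + i)) (x i)" if "i < n" for i
    unfolding cauchy_name_def
  proof
    fix m
    have "bit_name n b (n * m + i) = prod_encode (2 * digits 2 (coordinate n b i) m, 2 ^ m - 1)"
      using that by (simp add: bit_name_def)
    then show "\<bar>rat_code (bit_name n b (n * m + i)) - x i\<bar> \<le> (1 / 2) ^ m"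
      using has_value_error[OF assms(1)[OF that], of m]
      by (simp add: rat_code_dyadic[simplified] power_one_over)
  qed
  then show ?thesis
    using has_value_bounds[OF assms(1)] assms(2) by (simp add: cube_name_def)
qed

lemma ex_cube_bits:
  assumes "n \<ge> 1" "\<And>i. i < n \<Longrightarrow> 0 \<le> x i \<and> x i \<le> 1"
  obtains b where "b \<in> cantor" "\<And>i. i < n \<Longrightarrow> has_value 2 (coordinate n b i) (x i)"
proof -
  have "\<forall>i. \<exists>\<beta>. i < n \<longrightarrow> \<beta> \<in> cantor \<and> has_value 2 \<beta> (x i)"
    using assms(2) ex_binary by blast
  from choice[OF this] obtain \<beta> where \<beta>: "\<And>i. i < n \<Longrightarrow> \<beta> i \<in> cantor"
    "\<And>i. i < n \<Longrightarrow> has_value 2 (\<beta> i) (x i)"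
    by blast
  obtain b where b: "b \<in> cantor" "\<And>i. i < n \<Longrightarrow> coordinate n b i = \<beta> i"
    by (rule coordinate_combine[OF assms(1), of \<beta>]) (use \<beta>(1) in auto)
  show thesis
    by (rule that[OF b(1)]) (simp add: b(2) \<beta>(2))
qed

lemma closed_name_words_2_subset: "closed_name (words 2) p A \<Longrightarrow> A \<subseteq> cantor"
  unfolding closed_name_def by (auto simp: ran_def words_2_eq_Some)

lemma closed_name_hull_name:
  assumes "n \<ge> 1" and p: "closed_name (words 2) p A" and A: "finite A" "card A \<le> n + 1"
  shows "closed_name (cube n) (hull_name n p) (moment_hull n A)"
  unfolding closed_name_def
proof
  have "x \<in> ran (cube n)" if x: "x \<in> moment_hull n A" for x
  proof -
    obtain b where b: "\<And>i. i < n \<Longrightarrow> has_value 2 (coordinate n b i) (x i)"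
      by (rule ex_cube_bits[of n x])
        (use assms(1) moment_hull_bounds[OF x closed_name_words_2_subset[OF p]] in auto)
    have "cube_name n (bit_name n b) x"
      by (rule cube_name_bit_name[OF b]) (use x in \<open>auto simp: moment_hull_def\<close>)
    then show ?thesis
      by (auto simp: ran_def cube_eq_Some)
  qed
  then show "moment_hull n A \<subseteq> ran (cube n)" by blast
  have "\<not> in_cylinder 0 1 a" for a
    by (simp add: in_cylinder_def)
  then have "A - Collect (in_cylinder 0 1) = A" by auto
  then have "sierpinski (\<lambda>m. if off_hull n p q 0 1 m then 1 else 0) = Some (x \<notin> moment_hull n A)"
    if "cube n q = Some x" for q x
    using ex_off_hull_iff[OF p _ A, of q x 0 1] that by (simp add: sierpinski_def cube_eq_Some)
  then show "fun_name (cube n) sierpinski (hull_name n p) (\<lambda>x. x \<notin> moment_hull n A)"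
    unfolding fun_name_def using associate_hull_name[OF assms(1)] by blast
qed

text \<open>The state codes a word as its length and its value; the word is extended whenever its
  cylinder is found to carry weight.\<close>

definition branch_step :: "nat \<Rightarrow> baire \<Rightarrow> baire \<Rightarrow> nat \<Rightarrow> nat \<Rightarrow> nat" where
  "branch_step n p q s z =
     (if off_hull n p q (Suc (\<pi>1 z)) (\<pi>2 z) s then prod_encode (Suc (\<pi>1 z), \<pi>2 z)
      else if off_hull n p q (Suc (\<pi>1 z)) (\<pi>2 z + 2 ^ \<pi>1 z) s
      then prod_encode (Suc (\<pi>1 z), \<pi>2 z + 2 ^ \<pi>1 z)
      else z)"

definition branch_state :: "nat \<Rightarrow> baire \<Rightarrow> baire \<Rightarrow> nat \<Rightarrow> nat" where
  "branch_state n p q s = rec_nat (prod_encode (0, 0)) (branch_step n p q) s"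

definition branch :: "nat \<Rightarrow> baire \<Rightarrow> baire \<Rightarrow> baire" where
  "branch n p q i = bits (\<pi>2 (branch_state n p q (LEAST s. i < \<pi>1 (branch_state n p q s)))) i"

definition branch_map :: "nat \<Rightarrow> baire \<rightharpoonup> baire" where
  "branch_map n r = (let p = \<lambda>i. r (2 * i); q = \<lambda>i. r (2 * i + 1) in
     if \<forall>i. \<exists>s. i < \<pi>1 (branch_state n p q s) then Some (branch n p q) else None)"

lemma cf_branch_state:
  "cf (\<lambda>r z. branch_state n (\<lambda>i. r (2 * i)) (\<lambda>i. r (2 * i + 1)) (\<pi>2 z))"
  unfolding branch_state_def branch_step_def by (intro cf_intros cfd_off_hull)

lemma computable_branch_map: "computable (branch_map n)"
proof (rule computable_search)
  let ?S = "\<lambda>r. branch_state n (\<lambda>i. r (2 * i)) (\<lambda>i. r (2 * i + 1))"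
  show "cfd (\<lambda>r z. \<pi>1 z < \<pi>1 (?S r (\<pi>2 z)))"
    by (intro cf_intros cf_branch_state)
  show "cf (\<lambda>r z. bits (\<pi>2 (?S r (\<pi>2 z))) (\<pi>1 z))"
    by (intro cf_intros cf_branch_state)
qed (auto simp: branch_map_def branch_def Let_def split: if_splits)

text \<open>Words are stored with the least significant bit first: appending 0 keeps the value,
  appending 1 adds \<open>2 ^ l\<close>.\<close>

lemma bits_extend:
  assumes "u < 2 ^ l"
  shows "bits u l = 0" "bits (u + 2 ^ l) l = 1" "i < l \<Longrightarrow> bits (u + 2 ^ l) i = bits u i"
proof -
  show "bits u l = 0" "bits (u + 2 ^ l) l = 1"
    using assms by (simp_all add: bits_def)
  assume "i < l"
  then have "(2 :: nat) ^ l = 2 ^ i * (2 * 2 ^ (l - Suc i))"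
    by (simp flip: power_add power_Suc)
  then have "(u + 2 ^ l) div 2 ^ i = u div 2 ^ i + 2 * 2 ^ (l - Suc i)"
    by simp
  then show "bits (u + 2 ^ l) i = bits u i"
    by (simp add: bits_def)
qed

text \<open>Invariant: the current cylinder carries weight. If neither half were ever found to carry
  weight, x would lie in the hull without the one half and in the hull without the other, hence by
  \<open>moment_hull_diff_Un\<close> in the hull without the whole cylinder. So the words grow, and
  their limit lies in A because each of its cylinders meets A.\<close>

lemma branch_in_set:
  assumes p: "closed_name (words 2) p A" and q: "cube_name n q x" and A: "finite A" "card A \<le> n + 1"
    and x: "x \<in> moment_hull n A"
  shows "\<forall>i. \<exists>s. i < \<pi>1 (branch_state n p q s)" "branch n p q \<in> A"
proof -
  define L where "L s = \<pi>1 (branch_state n p q s)" for s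
  define U where "U s = \<pi>2 (branch_state n p q s)" for s
  note off = ex_off_hull_iff[OF p q A]
  let ?good = "\<lambda>l u. x \<notin> moment_hull n (A - Collect (in_cylinder l u))"
  have split: "in_cylinder (Suc l) u a \<or> in_cylinder (Suc l) (u + 2 ^ l) a \<longleftrightarrow> in_cylinder l u a"
    if "a \<in> cantor" "u < 2 ^ l" for l u a
  proof
    assume *: "in_cylinder l u a"
    from that(1) have "a l = 0 \<or> a l = 1"
      by (auto simp: cantor_def less_2_cases_iff)
    with * show "in_cylinder (Suc l) u a \<or> in_cylinder (Suc l) (u + 2 ^ l) a"
      using bits_extend[of u l] by (auto simp: in_cylinder_def less_Suc_eq)
  qed (use bits_extend(3)[OF that(2)] that(2) in \<open>auto simp: in_cylinder_def\<close>)
  have cases: "(L (Suc s) = L s \<and> U (Suc s) = U s \<and>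
      \<not> off_hull n p q (Suc (L s)) (U s) s \<and> \<not> off_hull n p q (Suc (L s)) (U s + 2 ^ L s) s) \<or>
    (L (Suc s) = Suc (L s) \<and> U (Suc s) \<in> {U s, U s + 2 ^ L s} \<and>
      off_hull n p q (L (Suc s)) (U (Suc s)) s)" for s
    unfolding L_def U_def branch_state_def by (simp add: branch_step_def)
  have U: "U s < 2 ^ L s" for s
  proof (induction s)
    case (Suc s)
    then show ?case using cases[of s] by auto
  qed (simp add: U_def L_def branch_state_def)
  have good: "?good (L s) (U s)" for s
  proof (induction s)
    case 0
    have "A - Collect (in_cylinder (L 0) (U 0)) = {}"
      by (auto simp: in_cylinder_def L_def U_def branch_state_def)
    then show ?case by (simp only: moment_hull_empty) simp
  next
    case (Suc s)
    then show ?case using cases[of s] off by auto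
  qed
  have progress: "\<exists>t. L t = Suc (L s)" for s
  proof (rule ccontr)
    assume no: "\<not> ?thesis"
    have const: "L (s + t) = L s \<and> U (s + t) = U s" for t
    proof (induction t)
      case (Suc t)
      then show ?case using cases[of "s + t"] no by auto
    qed simp
    have "\<not> off_hull n p q (Suc (L s)) (U s) t \<and> \<not> off_hull n p q (Suc (L s)) (U s + 2 ^ L s) t" for t
      using cases[of "s + t"] const[of t] const[of "Suc t"]
        off_hull_mono[of n p q _ _ t "s + t"] by auto
    then have "x \<in> moment_hull n (A - Collect (in_cylinder (Suc (L s)) (U s)))"
      "x \<in> moment_hull n (A - Collect (in_cylinder (Suc (L s)) (U s + 2 ^ L s)))"
      using off by blast+
    then have "x \<in> moment_hull n (A - (Collect (in_cylinder (Suc (L s)) (U s)) \<union>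
        Collect (in_cylinder (Suc (L s)) (U s + 2 ^ L s))))"
      using A closed_name_words_2_subset[OF p] by (intro moment_hull_diff_Un) auto
    moreover have "A - (Collect (in_cylinder (Suc (L s)) (U s)) \<union>
        Collect (in_cylinder (Suc (L s)) (U s + 2 ^ L s))) = A - Collect (in_cylinder (L s) (U s))"
      using split[OF _ U[of s]] closed_name_words_2_subset[OF p] by blast
    ultimately show False
      using good[of s] by simp
  qed
  have unbounded: "\<exists>s. i \<le> L s" for i
  proof (induction i)
    case (Suc i)
    then obtain s where "i \<le> L s" ..
    with progress[of s] show ?case
      by (metis Suc_le_mono)
  qed simp
  then show ex: "\<forall>i. \<exists>s. i < \<pi>1 (branch_state n p q s)"
    unfolding L_def by (meson Suc_le_lessD)
  have "L s \<le> L (Suc s) \<and> (\<forall>i<L s. bits (U (Suc s)) i = bits (U s) i)" for s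
    using cases[of s] bits_extend(3)[OF U[of s]] by auto
  then have mono: "L s \<le> L (s + k) \<and> (\<forall>i<L s. bits (U (s + k)) i = bits (U s) i)" for s k
  proof (induction k)
    case (Suc k)
    then show ?case
      by (metis add_Suc_right order_less_le_trans order_trans)
  qed simp
  have branch: "branch n p q i = bits (U s) i" if "i < L s" for i s
  proof -
    let ?t = "LEAST s. i < L s"
    have "?t \<le> s" "i < L ?t"
      using that by (auto intro: Least_le LeastI)
    then show ?thesis
      using mono[of ?t "s - ?t"] by (simp add: branch_def L_def[symmetric] U_def[symmetric])
  qed
  have cantor: "branch n p q \<in> cantor"
    using bits_in_cantor by (auto simp: branch_def cantor_def)
  show "branch n p q \<in> A"
  proof (rule ccontr)
    assume "branch n p q \<notin> A"
    then obtain M where M: "rejects p (branch n p q) M"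
      using rejects_iff[OF p, of "branch n p q" "branch n p q"] cantor by (auto simp: words_2_eq_Some)
    obtain s where s: "M \<le> L s"
      using unbounded by blast
    \<comment> \<open>The rejection reads only M bits. Some point of A shares them, since otherwise
      removing the cylinder would not change the hull, which contains x.\<close>
    have "\<exists>a\<in>A. in_cylinder (L s) (U s) a"
    proof (rule ccontr)
      assume "\<not> ?thesis"
      then have "A - Collect (in_cylinder (L s) (U s)) = A" by auto
      with good[of s] x show False by simp
    qed
    then obtain a where a: "a \<in> A" "in_cylinder (L s) (U s) a" by blast
    have "rejects p a M"
    proof (rule rejects_cong[OF M], intro allI impI)
      fix j assume "j < M"
      with s have "j < L s" by simp
      with a(2) branch show "a j = branch n p q j"
        by (simp add: in_cylinder_def)
    qed
    moreover have "words 2 a = Some a"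
      using a(1) closed_name_words_2_subset[OF p] by (auto simp: words_2_eq_Some)
    ultimately show False
      using rejects_iff[OF p] a(1) by blast
  qed
qed

lemma pairing_even [simp]: "(\<lambda>i. pairing p q (2 * i)) = p"
  and pairing_odd [simp]: "(\<lambda>i. pairing p q (2 * i + 1)) = q" "(\<lambda>i. pairing p q (Suc (2 * i))) = q"
  by (simp_all add: pairing_def fun_eq_iff)

theorem finite_choice_le_XC:
  assumes "n \<ge> 1"
  shows "finite_choice (n + 1) \<le>\<^sub>W XC n"
  unfolding weihrauch_le_def
proof (intro exI conjI allI impI)
  show "computable (\<lambda>p. Some (hull_name n p))"
    by (rule computable_cf[OF cf_hull_name])
  show "computable (branch_map n)"
    by (rule computable_branch_map)
  fix G assume G: "G \<turnstile> XC n"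
  show "(\<lambda>p. Option.bind (Some (hull_name n p)) (\<lambda>h. Option.bind (G h) (\<lambda>q. branch_map n (pairing p q))))
      \<turnstile> finite_choice (n + 1)"
    unfolding realizes_def
  proof (intro allI impI)
    fix p A
    assume "source (finite_choice (n + 1)) p = Some A \<and> val (finite_choice (n + 1)) A \<noteq> {}"
    then have p: "closed_name (words 2) p A" and A: "finite A" "card A \<le> n + 1" "1 \<le> card A"
      by (auto simp: finite_choice_def restrict_problem_def closed_choice_def closed_sets_eq_Some
          split: if_splits)
    have "A \<noteq> {}"
      using A(3) by auto
    then have "moment_hull n A \<noteq> {}"
      using moment_hull_nonempty[OF A(1)] by auto
    moreover have "source (XC n) (hull_name n p) = Some (moment_hull n A)"
      using closed_name_hull_name[OF assms p A(1,2)]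
      by (simp add: XC_def restrict_problem_def closed_choice_def closed_sets_eq_Some)
    moreover have "val (XC n) (moment_hull n A) = moment_hull n A"
      using convex_moment_hull by (simp add: XC_def restrict_problem_def closed_choice_def)
    ultimately obtain q x where q: "G (hull_name n p) = Some q" "target (XC n) q = Some x"
      "x \<in> moment_hull n A"
      using G unfolding realizes_def by metis
    then have "cube_name n q x"
      by (simp add: XC_def restrict_problem_def closed_choice_def cube_eq_Some)
    from branch_in_set[OF p this A(1,2) q(3)]
    have "branch_map n (pairing p q) = Some (branch n p q)" "branch n p q \<in> A"
      by (auto simp: branch_map_def)
    moreover have "branch n p q \<in> cantor"
      using calculation(2) closed_name_words_2_subset[OF p] by auto
    ultimately show "\<exists>y z. Option.bind (Some (hull_name n p))
        (\<lambda>h. Option.bind (G h) (\<lambda>q. branch_map n (pairing p q))) = Some y \<and>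
        target (finite_choice (n + 1)) y = Some z \<and> z \<in> val (finite_choice (n + 1)) A"
      using q(1) A by (auto simp: finite_choice_def restrict_problem_def closed_choice_def words_2_eq_Some)
  qed
qed

section \<open>Sorting\<close>

definition occurrences :: "baire \<Rightarrow> nat \<Rightarrow> nat set" where
  "occurrences e l = {t. e t = l}"

definition occurrences_before :: "baire \<Rightarrow> nat \<Rightarrow> nat \<Rightarrow> nat" where
  "occurrences_before e k l = (\<Sum>t<k. if e t = l then 1 else 0)"

lemma occurrences_before_eq: "occurrences_before e k l = card {t. t < k \<and> e t = l}"
proof -
  have "occurrences_before e k l = (\<Sum>t\<in>{t. t < k \<and> e t = l}. 1)"
    unfolding occurrences_before_def by (rule sum.mono_neutral_cong_right) auto
  then show ?thesis by simp
qed

lemma cf_occurrences_before: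
  assumes "cf (\<lambda>p z. e p (\<pi>1 z) (\<pi>2 z))" "cf k" "cf l"
  shows "cf (\<lambda>p z. occurrences_before (e p z) (k p z) (l p z))"
  unfolding occurrences_before_def by (intro cf_intros cf_comp2[OF assms(1)] cf_comp[OF assms(3)] assms)

text \<open>The start of the block of l in the sorted sequence, provided that the symbols below l
  occur finitely often. An infinite set has cardinality 0, hence the alternatives with
  \<open>infinite\<close> below.\<close>

definition block_start :: "baire \<Rightarrow> nat \<Rightarrow> nat" where
  "block_start e l = (\<Sum>i<l. card (occurrences e i))"

lemma sort_seq_block:
  assumes fin: "\<And>i. i < l \<Longrightarrow> finite (occurrences e i)"
    and inf: "\<exists>s. infinite (occurrences e s)"
    and k: "block_start e l \<le> k" "infinite (occurrences e l) \<or> k < block_start e (Suc l)"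
  shows "sort_seq e k = l"
proof -
  define m where "m = (LEAST s. infinite (occurrences e s))"
  define w where "w l = concat (map (\<lambda>l. replicate (card (occurrences e l)) l) [0..<l])" for l
  have len: "length (w l) = block_start e l" for l
    by (induction l) (simp_all add: w_def block_start_def)
  have sort: "sort_seq e k = (if k < length (w m) then w m ! k else m)"
    by (simp add: sort_seq_def m_def w_def occurrences_def Let_def)
  have m: "infinite (occurrences e m)"
    unfolding m_def using inf by (rule LeastI_ex)
  then have "l \<le> m"
    using fin by (meson not_le)
  show ?thesis
  proof (cases "l = m")
    case True
    then show ?thesis using sort k(1) len by simp
  next
    case False
    then have "l < m" using \<open>l \<le> m\<close> by simp
    then have "finite (occurrences e l)"
      unfolding m_def using not_less_Least by blast
    with k have k': "k < block_start e (Suc l)" by blast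
    have "[0..<m] = [0..<Suc l] @ [Suc l..<m]"
      using upt_add_eq_append[of 0 "Suc l" "m - Suc l"] \<open>l < m\<close> by simp
    then obtain r where r: "w m = w (Suc l) @ r"
      by (simp add: w_def)
    moreover have "w (Suc l) = w l @ replicate (card (occurrences e l)) l"
      by (simp add: w_def)
    moreover have "k - length (w l) < card (occurrences e l)"
      using k(1) k' by (simp add: len block_start_def)
    ultimately show ?thesis
      using k' k(1) len[of "Suc l"] len[of l] by (simp add: sort nth_append)
  qed
qed

lemma ex_block:
  assumes "k < block_start e m"
  shows "\<exists>l<m. block_start e l \<le> k \<and> k < block_start e (Suc l)"
  using assms
proof (induction m)
  case (Suc m)
  then show ?case
    by (cases "k < block_start e m") (auto simp: less_Suc_eq)
qed (simp add: block_start_def)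

lemma block_start_mono: "l \<le> l' \<Longrightarrow> block_start e l \<le> block_start e l'"
  unfolding block_start_def by (intro sum_mono2) auto

text \<open>All blocks before the symbol at position k are complete. So whatever prefix the backward
  map reads, the counts it takes for the smaller symbols are final.\<close>

lemma sort_seq_counts:
  assumes m: "infinite (occurrences e m)" "\<And>i. i < m \<Longrightarrow> finite (occurrences e i)"
  shows "sort_seq e k \<le> m"
    and "l' < sort_seq e k \<Longrightarrow> occurrences_before (sort_seq e) k l' = card (occurrences e l')"
proof -
  have inf: "\<exists>s. infinite (occurrences e s)"
    using m(1) by blast
  have block: "\<exists>l\<le>m. sort_seq e j = l \<and> block_start e l \<le> j \<and> (l = m \<or> j < block_start e (Suc l))" for j
  proof (cases "j < block_start e m")
    case True
    then obtain l where "l < m" "block_start e l \<le> j" "j < block_start e (Suc l)"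
      using ex_block by blast
    moreover from this have "sort_seq e j = l"
      using m(2) inf by (intro sort_seq_block) auto
    ultimately show ?thesis by auto
  next
    case False
    moreover from this have "sort_seq e j = m"
      using m inf by (intro sort_seq_block) auto
    ultimately show ?thesis by auto
  qed
  then show "sort_seq e k \<le> m" by blast
  assume l': "l' < sort_seq e k"
  from block[of k] obtain l where l: "l \<le> m" "sort_seq e k = l" "block_start e l \<le> k" by blast
  have iff: "sort_seq e j = l' \<longleftrightarrow> j \<in> {block_start e l'..<block_start e (Suc l')}" for j
  proof
    assume "sort_seq e j = l'"
    then show "j \<in> {block_start e l'..<block_start e (Suc l')}"
      using block[of j] l' l by auto
  next
    assume "j \<in> {block_start e l'..<block_start e (Suc l')}"
    then show "sort_seq e j = l'"
      using m(2) inf l' l by (intro sort_seq_block) auto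
  qed
  have "block_start e (Suc l') \<le> k"
    using block_start_mono[of "Suc l'" l e] l' l by simp
  then have "{j. j < k \<and> sort_seq e j = l'} = {block_start e l'..<block_start e (Suc l')}"
    unfolding iff by (intro set_eqI) (simp, linarith)
  then show "occurrences_before (sort_seq e) k l' = card (occurrences e l')"
    by (simp add: occurrences_before_eq block_start_def)
qed

lemma ex_sort_seq_eq:
  assumes m: "infinite (occurrences e m)" "\<And>i. i < m \<Longrightarrow> finite (occurrences e i)"
  shows "\<exists>k. sort_seq e k = m"
  using sort_seq_block[of m e "block_start e m"] assms by blast

section \<open>Convex choice reduces to sorting\<close>

subsection \<open>Faces of the cube\<close>

definition cube_point :: "nat \<Rightarrow> baire \<Rightarrow> nat \<Rightarrow> real" where
  "cube_point n b i = (if i < n then value_of 2 (coordinate n b i) else 0)"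

lemma has_value_coordinate:
  assumes "b \<in> cantor" "i < n"
  shows "has_value 2 (coordinate n b i) (cube_point n b i)"
  unfolding cube_point_def using assms coordinate_in_cantor[OF assms(1), of n i]
  by (auto simp: cantor_def intro: has_value_value_of)

lemma cube_bit_name: "b \<in> cantor \<Longrightarrow> cube n (bit_name n b) = Some (cube_point n b)"
  unfolding cube_eq_Some
  by (intro cube_name_bit_name has_value_coordinate) (simp_all add: cube_point_def)

lemma cube_point_eqI:
  assumes "\<And>i. i < n \<Longrightarrow> has_value 2 (coordinate n b i) (x i)" "\<forall>i\<ge>n. x i = 0"
  shows "cube_point n b = x"
  using assms by (auto simp: cube_point_def fun_eq_iff value_of_eq)

text \<open>A number \<open>c\<close> codes the guess that the coordinate \<open>guess_index c\<close> of the solution has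
  the dyadic value with the finitely many bits of \<open>guess_value c\<close>; every guess has infinitely
  many codes. The guesses \<open>g 0, \<dots>, g (l - 1)\<close> describe an axis-parallel face of the cube.\<close>

definition guess_index :: "nat \<Rightarrow> nat" where "guess_index c = \<pi>1 (\<pi>2 c)"
definition guess_value :: "nat \<Rightarrow> nat" where "guess_value c = \<pi>2 (\<pi>2 c)"

text \<open>Each valid guess fixes a new coordinate, so at most n guesses can be valid
  together.\<close>

definition valid_guesses :: "nat \<Rightarrow> (nat \<Rightarrow> nat) \<Rightarrow> nat \<Rightarrow> bool" where
  "valid_guesses n g l \<longleftrightarrow> (\<forall>k<l. guess_index (g k) < n \<and> (\<forall>k'<k. guess_index (g k') \<noteq> guess_index (g k)))"

text \<open>A condition on the expansion and not on the value, since inequality of sequences shows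
  in finitely many bits. A point with the guessed dyadic values has some expansion that meets
  it.\<close>

definition on_face :: "nat \<Rightarrow> (nat \<Rightarrow> nat) \<Rightarrow> nat \<Rightarrow> baire \<Rightarrow> bool" where
  "on_face n g l b \<longleftrightarrow> (\<forall>k<l. coordinate n b (guess_index (g k)) = bits (guess_value (g k)))"

definition face_reject :: "nat \<Rightarrow> baire \<Rightarrow> (nat \<Rightarrow> nat) \<Rightarrow> nat \<Rightarrow> baire \<Rightarrow> nat \<Rightarrow> bool" where
  "face_reject n p g l b s \<longleftrightarrow>
     (\<exists>k<l. \<exists>j<s. coordinate n b (guess_index (g k)) j \<noteq> bits (guess_value (g k)) j) \<or>
     rejects p (bit_name n b) s"

text \<open>Invalid guesses count as refuted from the start, so the search passes over codes of
  coordinates that do not exist or are already fixed.\<close>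

definition refuted :: "nat \<Rightarrow> baire \<Rightarrow> (nat \<Rightarrow> nat) \<Rightarrow> nat \<Rightarrow> nat \<Rightarrow> bool" where
  "refuted n p g l s \<longleftrightarrow> \<not> valid_guesses n g l \<or> exhausted (\<lambda>s. n * s) (face_reject n p g l) s"

text \<open>All points of the closed set on the face have \<open>E / 2 ^ M\<close> as an approximation of their
  coordinate \<open>i\<close>.\<close>

definition pinned :: "nat \<Rightarrow> baire \<Rightarrow> (nat \<Rightarrow> nat) \<Rightarrow> nat \<Rightarrow> nat \<Rightarrow> nat \<Rightarrow> nat \<Rightarrow> nat \<Rightarrow> bool" where
  "pinned n p g l i M E s \<longleftrightarrow> exhausted (\<lambda>s. n * s) (\<lambda>b s. face_reject n p g l b s \<or>
     M \<le> s \<and> (digits 2 (coordinate n b i) M = E \<or> Suc (digits 2 (coordinate n b i) M) = E)) s"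

lemma cfd_refuted:
  assumes P: "cf (\<lambda>p z. P p (\<pi>1 z) (\<pi>2 z))" and g: "cf (\<lambda>p z. g p (\<pi>1 z) (\<pi>2 z))"
    and l: "cf l" and s: "cf s"
  shows "cfd (\<lambda>p z. refuted n (P p z) (g p z) (l p z) (s p z))"
  unfolding refuted_def valid_guesses_def guess_index_def
  by (intro cfd_disj cfd_not cfd_exhausted; (unfold face_reject_def guess_index_def guess_value_def
      coordinate_def bit_name_def)?)
    (intro cf_intros cf_comp2[OF P] cf_comp2[OF g] cf_comp[OF l] l s)+

lemma cfd_pinned:
  assumes P: "cf (\<lambda>p z. P p (\<pi>1 z) (\<pi>2 z))" and g: "cf (\<lambda>p z. g p (\<pi>1 z) (\<pi>2 z))"
    and l: "cf l" and i: "cf i" and M: "cf M" and E: "cf E" and s: "cf s"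
  shows "cfd (\<lambda>p z. pinned n (P p z) (g p z) (l p z) (i p z) (M p z) (E p z) (s p z))"
  unfolding pinned_def
  by (intro cfd_exhausted; (unfold face_reject_def guess_index_def guess_value_def
      coordinate_def bit_name_def)?)
    (intro cf_intros cf_comp2[OF P] cf_comp2[OF g] cf_comp[OF l] cf_comp[OF i] cf_comp[OF M] cf_comp[OF E] s)+

lemma coordinate_local:
  assumes "\<forall>k<n * s. b' k = b k" "i < n" "j < s"
  shows "coordinate n b' i j = coordinate n b i j"
proof -
  have "n * j + i < n * Suc j"
    using assms(2) by simp
  also have "\<dots> \<le> n * s"
    using assms(3) by (intro mult_le_mono2) simp
  finally show ?thesis
    using assms(1) by (simp add: coordinate_def)
qed

lemma face_reject_local:
  assumes "n \<ge> 1" "valid_guesses n g l" "face_reject n p g l b s" "\<forall>k<n * s. b' k = b k"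
  shows "face_reject n p g l b' s"
proof -
  have name: "bit_name n b' t = bit_name n b t" if "t < s" for t
  proof -
    have "digits 2 (coordinate n b' (t mod n)) (t div n) = digits 2 (coordinate n b (t mod n)) (t div n)"
    proof (rule digits_cong)
      fix j assume "j < t div n"
      then have "j < s"
        using that div_le_dividend[of t n] by linarith
      then show "coordinate n b' (t mod n) j = coordinate n b (t mod n) j"
        using assms(1,4) by (intro coordinate_local) auto
    qed
    then show ?thesis by (simp add: bit_name_def)
  qed
  have coord: "coordinate n b' (guess_index (g k)) j = coordinate n b (guess_index (g k)) j"
    if "k < l" "j < s" for k j
    by (rule coordinate_local[OF assms(4) _ that(2)]) (use assms(2) that(1) in \<open>simp add: valid_guesses_def\<close>)
  show ?thesis
  proof (cases "rejects p (bit_name n b) s")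
    case True
    then have "rejects p (bit_name n b') s"
      by (rule rejects_cong) (simp add: name)
    then show ?thesis by (simp add: face_reject_def)
  next
    case False
    with assms(3) show ?thesis
      by (simp add: face_reject_def coord cong: conj_cong)
  qed
qed

lemma ex_face_reject_iff:
  assumes "closed_name (cube n) p A" "b \<in> cantor"
  shows "(\<exists>s. face_reject n p g l b s) \<longleftrightarrow> \<not> (on_face n g l b \<and> cube_point n b \<in> A)"
proof -
  have "on_face n g l b \<longleftrightarrow>
      \<not> (\<exists>s. \<exists>k<l. \<exists>j<s. coordinate n b (guess_index (g k)) j \<noteq> bits (guess_value (g k)) j)"
    unfolding on_face_def by (auto simp: fun_eq_iff)
  moreover have "(\<exists>s. rejects p (bit_name n b) s) \<longleftrightarrow> cube_point n b \<notin> A"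
    by (rule rejects_iff[OF assms(1)]) (rule cube_bit_name[OF assms(2)])
  ultimately show ?thesis
    unfolding face_reject_def by blast
qed

lemma refuted_mono: "n \<ge> 1 \<Longrightarrow> refuted n p g l s \<Longrightarrow> s \<le> t \<Longrightarrow> refuted n p g l t"
  unfolding refuted_def
  using exhausted_mono[of "face_reject n p g l" "\<lambda>s. n * s", OF face_reject_local[of n g l] mono_mult_left]
  by auto

lemma ex_refuted_iff:
  assumes "n \<ge> 1" "closed_name (cube n) p A"
  shows "(\<exists>s. refuted n p g l s) \<longleftrightarrow>
    \<not> (valid_guesses n g l \<and> (\<exists>b\<in>cantor. on_face n g l b \<and> cube_point n b \<in> A))"
proof (cases "valid_guesses n g l")
  case True
  have "(\<exists>s. exhausted (\<lambda>s. n * s) (face_reject n p g l) s) \<longleftrightarrow> (\<forall>b\<in>cantor. \<exists>s. face_reject n p g l b s)"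
    by (rule ex_exhausted_iff[OF face_reject_local[OF assms(1) True] mono_mult_left])
  with True show ?thesis
    unfolding refuted_def using ex_face_reject_iff[OF assms(2)] by auto
qed (simp add: refuted_def)

lemma refuted_cong:
  assumes "\<And>k. k < l \<Longrightarrow> g' k = g k"
  shows "refuted n p g' l s \<longleftrightarrow> refuted n p g l s"
proof -
  have "valid_guesses n g' l \<longleftrightarrow> valid_guesses n g l"
    unfolding valid_guesses_def using assms by auto
  moreover have "face_reject n p g' l = face_reject n p g l"
    unfolding face_reject_def fun_eq_iff by (simp add: assms cong: conj_cong)
  ultimately show ?thesis
    by (simp add: refuted_def)
qed

text \<open>The midpoint is truncated to M bits: sequences that share M digits have values at
  distance at most \<open>2 / 2 ^ M\<close>.\<close>

lemma ex_dyadic_between: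
  assumes "0 \<le> x" "x < y" "y \<le> 1"
  shows "\<exists>u v. has_value 2 (bits u) v \<and> x < v \<and> v < y"
proof -
  obtain b where b: "b \<in> cantor" "has_value 2 b ((x + y) / 2)"
    using ex_binary[of "(x + y) / 2"] assms by auto
  obtain M where M: "2 / 2 ^ M < (y - x) / 2"
    using real_arch_pow_inv[of "(y - x) / 4" "1 / 2"] assms(2) by (auto simp: power_one_over)
  obtain u where "\<forall>j<M. bits u j = b j"
    using ex_bits[OF b(1)] by blast
  then have eq: "digits 2 (bits u) M = digits 2 b M"
    by (intro digits_cong) auto
  have v: "has_value 2 (bits u) (value_of 2 (bits u))"
    using bits_in_cantor[of u] by (intro has_value_value_of) (auto simp: cantor_def)
  have "\<bar>value_of 2 (bits u) - (x + y) / 2\<bar> \<le> 2 / 2 ^ M"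
    using has_value_error[OF v, of M] has_value_error[OF b(2), of M] by (simp add: eq)
  with M have "\<bar>value_of 2 (bits u) - (x + y) / 2\<bar> < (y - x) / 2"
    by linarith
  then have "x < value_of 2 (bits u)" "value_of 2 (bits u) < y"
    by (simp_all add: abs_less_iff field_simps)
  with v show ?thesis by blast
qed

subsection \<open>The reduction\<close>

text \<open>Symbol \<open>l\<close> is emitted whenever the current guesses \<open>0, \<dots>, l\<close> are refuted; its number of
  occurrences so far is the code of guess \<open>l\<close>. The emitted symbols are the digits of \<open>E\<close> in
  base \<open>n + 1\<close>.\<close>

definition next_symbol :: "nat \<Rightarrow> baire \<Rightarrow> nat \<Rightarrow> nat \<Rightarrow> nat" where
  "next_symbol n p E s =
     (LEAST l. n \<le> l \<or> refuted n p (occurrences_before (\<lambda>t. E div Suc n ^ t mod Suc n) s) (Suc l) s)"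

text \<open>Course-of-values recursion: the current guesses depend on all symbols emitted so far, so
  these are carried along as one number.\<close>

definition history :: "nat \<Rightarrow> baire \<Rightarrow> nat \<Rightarrow> nat" where
  "history n p s = rec_nat 0 (\<lambda>s E. E + next_symbol n p E s * Suc n ^ s) s"

definition refutation_log :: "nat \<Rightarrow> baire \<Rightarrow> baire" where
  "refutation_log n p s = next_symbol n p (history n p s) s"

lemma cf_refutation_log: "cf (refutation_log n)"
proof -
  have *: "cf (\<lambda>p z. next_symbol n p (E p z) (s p z))" if "cf E" "cf s" for E s
    unfolding next_symbol_def
    by (intro cf_intros cfd_refuted cf_occurrences_before cf_comp[OF that(1)] cf_comp[OF that(2)]) auto
  show ?thesis
    unfolding refutation_log_def history_def by (intro cf_intros *)
qed

lemma next_symbol_le: "next_symbol n p E s \<le> n"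
  unfolding next_symbol_def by (rule Least_le) simp

lemma refutation_log_le: "refutation_log n p s \<le> n"
  unfolding refutation_log_def by (rule next_symbol_le)

lemma history_Suc: "history n p (Suc s) = history n p s + refutation_log n p s * Suc n ^ s"
  by (simp add: history_def refutation_log_def)

lemma history_less: "history n p s < Suc n ^ s"
proof (induction s)
  case (Suc s)
  have "refutation_log n p s * Suc n ^ s \<le> n * Suc n ^ s"
    using refutation_log_le by (intro mult_le_mono1)
  with Suc show ?case
    unfolding history_Suc power_Suc mult_Suc by linarith
qed (simp add: history_def)

lemma history_digit: "t < s \<Longrightarrow> history n p s div Suc n ^ t mod Suc n = refutation_log n p t"
proof (induction s)
  case (Suc s)
  show ?case
  proof (cases "t = s")
    case True
    then show ?thesis
      using history_less[of n p s] refutation_log_le[of n p s]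
      by (simp add: history_Suc del: power_Suc)
  next
    case False
    then have "t < s" using Suc.prems by simp
    then have "Suc n ^ s = Suc n ^ t * (Suc n * Suc n ^ (s - Suc t))"
      by (simp flip: power_add power_Suc)
    then have "history n p (Suc s) = history n p s + Suc n ^ t * (Suc n * (Suc n ^ (s - Suc t) * refutation_log n p s))"
      by (simp add: history_Suc algebra_simps)
    then have "history n p (Suc s) div Suc n ^ t =
        history n p s div Suc n ^ t + Suc n * (Suc n ^ (s - Suc t) * refutation_log n p s)"
      by (simp del: power_Suc mult_Suc)
    then show ?thesis
      using Suc.IH[OF \<open>t < s\<close>] by (simp del: mult_Suc power_Suc)
  qed
qed simp

text \<open>The recursion of the log freed from its numerical code. The alternative
  \<open>n \<le> l\<close> supplies the symbol n at stages without a refutation.\<close>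

lemma refutation_log_eq:
  "refutation_log n p s =
     (LEAST l. n \<le> l \<or> refuted n p (occurrences_before (refutation_log n p) s) (Suc l) s)"
proof -
  have "occurrences_before (\<lambda>t. history n p s div Suc n ^ t mod Suc n) s =
      occurrences_before (refutation_log n p) s"
    unfolding occurrences_before_def fun_eq_iff
    by (intro allI sum.cong refl) (simp add: history_digit del: power_Suc)
  then show ?thesis
    unfolding refutation_log_def next_symbol_def by simp
qed

lemma refuted_refutation_log:
  "refutation_log n p s < n \<Longrightarrow>
     refuted n p (occurrences_before (refutation_log n p) s) (Suc (refutation_log n p s)) s"
  using LeastI[of "\<lambda>l. n \<le> l \<or> refuted n p (occurrences_before (refutation_log n p) s) (Suc l) s" n]
  unfolding refutation_log_eq[of n p s, symmetric] by simp

lemma refutation_log_le_refuted: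
  "refuted n p (occurrences_before (refutation_log n p) s) (Suc l) s \<Longrightarrow> refutation_log n p s \<le> l"
  by (subst refutation_log_eq) (simp add: Least_le)

text \<open>A symbol that occurs infinitely often runs through all guesses: each v is current at
  some stage at which the symbol is emitted.\<close>

lemma ex_occurrence_at_count:
  assumes "infinite (occurrences e m)"
  shows "\<exists>t. e t = m \<and> occurrences_before e t m = v"
proof -
  have Suc: "occurrences_before e (Suc t) m = occurrences_before e t m + (if e t = m then 1 else 0)" for t
    by (simp add: occurrences_before_def)
  have ex: "\<exists>t. Suc v \<le> occurrences_before e (Suc t) m"
  proof -
    obtain T where T: "T \<subseteq> occurrences e m" "finite T" "card T = Suc v"
      using infinite_arbitrarily_large[OF assms] by blast
    then have "T \<subseteq> {t. t < Suc (Max T) \<and> e t = m}"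
      by (auto simp: occurrences_def less_Suc_eq_le)
    then have "card T \<le> card {t. t < Suc (Max T) \<and> e t = m}"
      by (intro card_mono) auto
    with T(3) show ?thesis
      unfolding occurrences_before_eq by metis
  qed
  define t where "t = (LEAST t. Suc v \<le> occurrences_before e (Suc t) m)"
  have t: "Suc v \<le> occurrences_before e (Suc t) m"
    unfolding t_def using ex by (rule LeastI_ex)
  have "occurrences_before e t m \<le> v"
  proof (cases t)
    case 0
    then show ?thesis by (simp add: occurrences_before_def)
  next
    case (Suc t')
    then have "\<not> Suc v \<le> occurrences_before e (Suc t') m"
      unfolding t_def by (intro not_less_Least) simp
    with Suc show ?thesis by simp
  qed
  with t Suc[of t] show ?thesis
    by (intro exI[of _ t]) (auto split: if_splits)
qed

lemma occurrences_before_mono: "s \<le> t \<Longrightarrow> occurrences_before e s m \<le> occurrences_before e t m"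
  unfolding occurrences_before_def by (intro sum_mono2) auto

lemma occurrences_before_finite:
  assumes "\<And>t. S \<le> t \<Longrightarrow> e t \<noteq> l" "S \<le> s"
  shows "occurrences_before e s l = card (occurrences e l)"
proof -
  have "{t. t < s \<and> e t = l} = occurrences e l"
    using assms unfolding occurrences_def by (metis le_less_linear less_le_trans)
  then show ?thesis
    by (simp add: occurrences_before_eq)
qed

lemma ex_infinite_occurrences:
  assumes "\<And>t. e t \<le> n"
  shows "\<exists>s\<le>n. infinite (occurrences e s)"
proof (rule ccontr)
  assume "\<not> ?thesis"
  then have "finite (\<Union>s\<le>n. occurrences e s)" by auto
  moreover have "(\<Union>s\<le>n. occurrences e s) = UNIV"
    using assms by (auto simp: occurrences_def)
  ultimately show False by simp
qed

text \<open>The least symbol \<open>m\<close> emitted infinitely often yields final guesses on a face that meets the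
  convex set in a single point: otherwise a further dyadic guess would never be refuted.\<close>

lemma refutation_log_limit:
  assumes n: "n \<ge> 1" and p: "closed_name (cube n) p A" and A: "convex_set A" "A \<noteq> {}"
    and e: "e = refutation_log n p"
  obtains m x where "infinite (occurrences e m)" "\<And>i. i < m \<Longrightarrow> finite (occurrences e i)"
    "valid_guesses n (\<lambda>i. card (occurrences e i)) m"
    "\<exists>b\<in>cantor. on_face n (\<lambda>i. card (occurrences e i)) m b \<and> cube_point n b = x" "x \<in> A"
    "\<And>b. b \<in> cantor \<Longrightarrow> on_face n (\<lambda>i. card (occurrences e i)) m b \<Longrightarrow> cube_point n b \<in> A \<Longrightarrow>
       cube_point n b = x"
proof -
  define c where "c i = card (occurrences e i)" for i
  have ex_le: "\<exists>s\<le>n. infinite (occurrences e s)"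
    unfolding e by (rule ex_infinite_occurrences[OF refutation_log_le])
  then have ex: "\<exists>s. infinite (occurrences e s)" by blast
  define m where "m = (LEAST s. infinite (occurrences e s))"
  have inf: "infinite (occurrences e m)"
    unfolding m_def using ex by (rule LeastI_ex)
  have fin: "finite (occurrences e i)" if "i < m" for i
    using not_less_Least[of i] that unfolding m_def by blast
  have mn: "m \<le> n"
    using ex_le unfolding m_def by (meson Least_le order_trans)
  have "finite (\<Union>i<m. occurrences e i)"
    using fin by blast
  then have "\<exists>S. \<forall>t\<in>(\<Union>i<m. occurrences e i). t < S"
    by (simp only: finite_nat_set_iff_bounded)
  then obtain S where S: "\<And>t. t \<in> (\<Union>i<m. occurrences e i) \<Longrightarrow> t < S"
    by blast
  have late: "m \<le> e t" if "S \<le> t" for t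
    using S[of t] that by (force simp: occurrences_def not_le)
  have count: "occurrences_before e s l = c l" if "l < m" "S \<le> s" for l s
    unfolding c_def by (rule occurrences_before_finite[of S]) (use late that in fastforce)+
  \<comment> \<open>From stage S on, the counts of the symbols below m are those in c. A refutation
    of these m guesses would persist and produce a symbol below m after S. For m = 0 it would refute
    that A is nonempty.\<close>
  have "\<not> refuted n p c m s" for s
  proof
    assume r: "refuted n p c m s"
    show False
    proof (cases m)
      case 0
      obtain x where x: "x \<in> A" using A(2) by blast
      then obtain q where "cube_name n q x"
        using p unfolding closed_name_def by (auto simp: ran_def cube_eq_Some)
      then have xb: "\<And>i. i < n \<Longrightarrow> 0 \<le> x i \<and> x i \<le> 1" "\<forall>i\<ge>n. x i = 0"
        by (auto simp: cube_name_def)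
      obtain b where b: "b \<in> cantor" "\<And>i. i < n \<Longrightarrow> has_value 2 (coordinate n b i) (x i)"
        by (rule ex_cube_bits[of n x]) (use n xb(1) in auto)
      then have "cube_point n b = x"
        using xb(2) by (intro cube_point_eqI)
      then show False
        using ex_refuted_iff[OF n p, of c m] r b(1) x 0 by (auto simp: valid_guesses_def on_face_def)
    next
      case (Suc l)
      define s' where "s' = max s S"
      have "refuted n p c (Suc l) s'"
        using refuted_mono[OF n r] by (simp add: s'_def Suc)
      then have "refuted n p (occurrences_before e s') (Suc l) s'"
        by (subst refuted_cong[of _ _ c]) (use count in \<open>auto simp: s'_def Suc\<close>)
      then have "e s' \<le> l"
        using refutation_log_le_refuted by (simp add: e)
      with late[of s'] show False
        by (simp add: s'_def Suc)
    qed
  qed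
  then have valid: "valid_guesses n c m" and "\<exists>b\<in>cantor. on_face n c m b \<and> cube_point n b \<in> A"
    using ex_refuted_iff[OF n p, of c m] by blast+
  then obtain b0 where b0: "b0 \<in> cantor" "on_face n c m b0" "cube_point n b0 \<in> A"
    by blast
  have no_guess: False if "m < n" "i < n" "\<And>k. k < m \<Longrightarrow> guess_index (c k) \<noteq> i"
    "b \<in> cantor" "on_face n c m b" "coordinate n b i = bits u" "cube_point n b \<in> A" for i u b
  proof -
    \<comment> \<open>The first component of a code is free and serves as padding: it makes v exceed
      the count at stage S, so that v is the current guess only after the guesses below m have
      settled.\<close>
    define v where "v = prod_encode (Suc (occurrences_before e S m), prod_encode (i, u))"
    have v: "guess_index v = i" "guess_value v = u" "occurrences_before e S m < v"
      using le_prod_encode_1[of "Suc (occurrences_before e S m)" "prod_encode (i, u)"]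
      by (simp_all add: v_def guess_index_def guess_value_def)
    obtain t where t: "e t = m" "occurrences_before e t m = v"
      using ex_occurrence_at_count[OF inf] by blast
    then have "S \<le> t"
      using occurrences_before_mono[of t S e m] v(3) by (meson not_le order.strict_implies_order)
    have "refuted n p (occurrences_before e t) (Suc m) t"
      using refuted_refutation_log[of n p t] t(1) that(1) by (simp add: e)
    then have "refuted n p (c(m := v)) (Suc m) t"
      by (subst refuted_cong[of _ _ "occurrences_before e t"])
        (use count \<open>S \<le> t\<close> t(2) in \<open>auto simp: less_Suc_eq\<close>)
    then have "\<not> (valid_guesses n (c(m := v)) (Suc m) \<and>
        (\<exists>b\<in>cantor. on_face n (c(m := v)) (Suc m) b \<and> cube_point n b \<in> A))"
      using ex_refuted_iff[OF n p] by blast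
    moreover have "valid_guesses n (c(m := v)) (Suc m)"
      using valid that(2,3) v(1) by (auto simp: valid_guesses_def less_Suc_eq)
    moreover have "on_face n (c(m := v)) (Suc m) b"
      using that(5,6) v by (auto simp: on_face_def less_Suc_eq)
    ultimately show False
      using that(4,7) by blast
  qed
  \<comment> \<open>If two points of A on the face differ in coordinate i, the segment between them
    stays in A and has the same fixed coordinates. It crosses a dyadic value, and the crossing point
    supports a guess that could never be refuted, against \<open>no_guess\<close>.\<close>
  have not_less: False if bb: "b \<in> cantor" "on_face n c m b" "cube_point n b \<in> A"
      "b' \<in> cantor" "on_face n c m b'" "cube_point n b' \<in> A" and i: "i < n"
      and less: "cube_point n b i < cube_point n b' i" for b b' i
  proof -
    let ?x = "cube_point n b" and ?y = "cube_point n b'"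
    have xy: "has_value 2 (coordinate n b j) (?x j)" "has_value 2 (coordinate n b' j) (?y j)" if "j < n" for j
      using bb that by (simp_all add: has_value_coordinate)
    have new: "guess_index (c k) \<noteq> i" if "k < m" for k
    proof
      assume "guess_index (c k) = i"
      then have "coordinate n b i = coordinate n b' i"
        using bb(2,5) that by (auto simp: on_face_def)
      then show False
        using less i by (simp add: cube_point_def)
    qed
    have "m < n"
    proof -
      have "inj_on (\<lambda>k. guess_index (c k)) {..<m}"
        using valid unfolding valid_guesses_def by (intro linorder_inj_onI') auto
      moreover have "(\<lambda>k. guess_index (c k)) ` {..<m} \<subseteq> {..<n} - {i}"
        using valid new by (auto simp: valid_guesses_def)
      ultimately have "card {..<m} \<le> card ({..<n} - {i})"
        by (intro card_inj_on_le) auto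
      then show ?thesis using i by simp
    qed
    obtain u v where u: "has_value 2 (bits u) v" "?x i < v" "v < ?y i"
      using ex_dyadic_between[OF _ less] has_value_bounds[OF xy(1)[OF i]] has_value_bounds[OF xy(2)[OF i]]
      by blast
    define t where "t = (v - ?x i) / (?y i - ?x i)"
    have t: "0 \<le> t" "t \<le> 1"
      using u(2,3) by (simp_all add: t_def divide_simps)
    define z where "z = (\<lambda>j. (1 - t) * ?x j + t * ?y j)"
    have "z \<in> A"
      using A(1) bb(3,6) t unfolding convex_set_def z_def by blast
    have "z i = ?x i + t * (?y i - ?x i)"
      by (simp add: z_def algebra_simps)
    also have "\<dots> = v"
      using less by (simp add: t_def)
    finally have zi: "z i = v" .
    have z01: "0 \<le> z j \<and> z j \<le> 1" if "j < n" for j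
      using has_value_bounds[OF xy(1)[OF that]] has_value_bounds[OF xy(2)[OF that]] t
        convex_bound_le[of "?x j" 1 "?y j" "1 - t" t] by (simp add: z_def)
    obtain b1 where b1: "b1 \<in> cantor" "\<And>j. j < n \<Longrightarrow> has_value 2 (coordinate n b1 j) (z j)"
      by (rule ex_cube_bits[of n z]) (use n z01 in auto)
    \<comment> \<open>A name of z on the face: fixed coordinates keep the expansions of b, as z has
      there the common value of both end points; coordinate i gets the dyadic expansion, and the
      others get any.\<close>
    define \<beta> where "\<beta> j = (if j = i then bits u else if \<exists>k<m. guess_index (c k) = j
      then coordinate n b j else coordinate n b1 j)" for j
    have \<beta>: "\<beta> j \<in> cantor" for j
      by (simp add: \<beta>_def bits_in_cantor coordinate_in_cantor bb b1)
    obtain b2 where b2: "b2 \<in> cantor" "\<And>j. j < n \<Longrightarrow> coordinate n b2 j = \<beta> j"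
      by (rule coordinate_combine[OF n, of \<beta>]) (use \<beta> in auto)
    have face: "on_face n c m b2"
      using bb(2) valid new b2(2) by (auto simp: on_face_def valid_guesses_def \<beta>_def)
    have "has_value 2 (\<beta> j) (z j)" if "j < n" for j
    proof (cases "j \<noteq> i \<and> (\<exists>k<m. guess_index (c k) = j)")
      case True
      then have "coordinate n b j = coordinate n b' j"
        using bb(2,5) by (auto simp: on_face_def)
      then have "?x j = ?y j"
        using that by (simp add: cube_point_def)
      then have "z j = ?x j"
        by (simp add: z_def algebra_simps)
      with True xy(1)[OF that] show ?thesis
        by (simp add: \<beta>_def)
    next
      case False
      then show ?thesis
        using u(1) zi b1(2)[OF that] by (auto simp: \<beta>_def)
    qed
    then have "cube_point n b2 = z"
      by (intro cube_point_eqI) (simp_all add: b2(2) z_def cube_point_def)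
    then show False
      using no_guess[OF \<open>m < n\<close> i new b2(1) face, of u] b2(2)[OF i] \<open>z \<in> A\<close> by (simp add: \<beta>_def)
  qed
  have c: "(\<lambda>i. card (occurrences e i)) = c"
    by (simp add: c_def fun_eq_iff)
  show thesis
  proof (rule that[of m "cube_point n b0", unfolded c])
    show "cube_point n b = cube_point n b0"
      if b: "b \<in> cantor" "on_face n c m b" "cube_point n b \<in> A" for b
    proof
      fix i
      show "cube_point n b i = cube_point n b0 i"
      proof (cases "i < n")
        case True
        then show ?thesis
          using not_less[OF b b0 True] not_less[OF b0 b True] by (meson linorder_neqE)
      qed (simp add: cube_point_def)
    qed
  qed (use inf fin valid b0 in auto)
qed

text \<open>The first component \<open>k\<close> of a certificate is the number of symbols of the sorted sequence
  that are taken into account; the guesses are read off from the counts of the smaller symbols.\<close>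

definition pin_certificate :: "nat \<Rightarrow> baire \<Rightarrow> baire \<Rightarrow> nat \<Rightarrow> nat \<Rightarrow> bool" where
  "pin_certificate n p q t \<tau> \<longleftrightarrow> pinned n p (occurrences_before q (\<pi>1 \<tau>)) (q (\<pi>1 \<tau>))
     (t mod n) (t div n) (\<pi>2 (\<pi>2 \<tau>)) (\<pi>1 (\<pi>2 \<tau>))"

definition pin_map :: "nat \<Rightarrow> baire \<rightharpoonup> baire" where
  "pin_map n r = (let R = pin_certificate n (\<lambda>i. r (2 * i)) (\<lambda>i. r (2 * i + 1)) in
     if \<forall>t. \<exists>\<tau>. R t \<tau>
     then Some (\<lambda>t. prod_encode (2 * \<pi>2 (\<pi>2 (LEAST \<tau>. R t \<tau>)), 2 ^ (t div n) - 1)) else None)"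

lemma computable_pin_map: "computable (pin_map n)"
proof (rule computable_search)
  show "cfd (\<lambda>r z. pin_certificate n (\<lambda>i. r (2 * i)) (\<lambda>i. r (2 * i + 1)) (\<pi>1 z) (\<pi>2 z))"
    unfolding pin_certificate_def by (intro cfd_pinned cf_intros cf_occurrences_before)
  show "cf (\<lambda>r z. prod_encode (2 * \<pi>2 (\<pi>2 (\<pi>2 z)), 2 ^ (\<pi>1 z div n) - 1))"
    by (intro cf_intros)
qed (auto simp: pin_map_def Let_def split: if_splits)

lemma pinned_iff:
  assumes n: "n \<ge> 1" and valid: "valid_guesses n g l" and i: "i < n"
  shows "pinned n p g l i M E s \<longleftrightarrow> (\<forall>b\<in>cantor. \<exists>s'\<le>s. face_reject n p g l b s' \<or>
     M \<le> s' \<and> (digits 2 (coordinate n b i) M = E \<or> Suc (digits 2 (coordinate n b i) M) = E))" (is ?A)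
    and "(\<exists>s. pinned n p g l i M E s) \<longleftrightarrow> (\<forall>b\<in>cantor. \<exists>s. face_reject n p g l b s \<or>
     M \<le> s \<and> (digits 2 (coordinate n b i) M = E \<or> Suc (digits 2 (coordinate n b i) M) = E))" (is ?B)
proof -
  let ?R = "\<lambda>b s. face_reject n p g l b s \<or>
     M \<le> s \<and> (digits 2 (coordinate n b i) M = E \<or> Suc (digits 2 (coordinate n b i) M) = E)"
  have local: "?R b' s" if "?R b s" "\<forall>k<n * s. b' k = b k" for b b' s
  proof (cases "face_reject n p g l b s")
    case True
    then show ?thesis
      using face_reject_local[OF n valid] that(2) by blast
  next
    case False
    with that(1) have "M \<le> s" by simp
    then have "digits 2 (coordinate n b' i) M = digits 2 (coordinate n b i) M"
      by (intro digits_cong coordinate_local[OF that(2) i]) simp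
    with that(1) False show ?thesis by simp
  qed
  show ?A
    unfolding pinned_def by (rule exhausted_iff[OF local mono_mult_left])
  show ?B
    unfolding pinned_def by (rule ex_exhausted_iff[OF local mono_mult_left])
qed

text \<open>Every certificate is sound, even for a k that is too small: the counts taken are final,
  so the face they describe still contains x. A certificate exists because some k reaches the symbol
  m, where the face meets A in x alone. All certificates approximate the same x, so the outputs fit
  together.\<close>

lemma pin_map_correct:
  assumes n: "n \<ge> 1" and p: "closed_name (cube n) p A" and A: "convex_set A" "A \<noteq> {}"
  shows "\<exists>q x. pin_map n (pairing p (sort_seq (refutation_log n p))) = Some q \<and> cube_name n q x \<and> x \<in> A"
proof -
  define e where "e = refutation_log n p"
  define c where "c = (\<lambda>i. card (occurrences e i))"
  obtain m x b where m: "infinite (occurrences e m)" "\<And>i. i < m \<Longrightarrow> finite (occurrences e i)"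
    and valid: "valid_guesses n c m"
    and b: "b \<in> cantor" "on_face n c m b" "cube_point n b = x" and x: "x \<in> A"
    and unique: "\<And>b. b \<in> cantor \<Longrightarrow> on_face n c m b \<Longrightarrow> cube_point n b \<in> A \<Longrightarrow> cube_point n b = x"
    by (rule refutation_log_limit[OF n p A e_def]) (auto simp: c_def)
  define q where "q = sort_seq e"
  let ?R = "pin_certificate n p q"
  have q_le: "q k \<le> m" and q_count: "l < q k \<Longrightarrow> occurrences_before q k l = c l" for k l
    unfolding q_def c_def using sort_seq_counts[OF m, where k = k] by auto
  have bounds: "real (digits 2 (coordinate n b i) M) \<le> cube_point n b i * 2 ^ M"
    "cube_point n b i * 2 ^ M \<le> real (digits 2 (coordinate n b i) M) + 1"
    if "b \<in> cantor" "i < n" for b i M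
    using has_value_coordinate[OF that] by (simp_all add: has_value_def)
  have sound: "\<bar>real (\<pi>2 (\<pi>2 \<tau>)) / 2 ^ M - x i\<bar> \<le> (1 / 2) ^ M"
    if R: "?R (n * M + i) \<tau>" and i: "i < n" for M i \<tau>
  proof -
    define k where "k = \<pi>1 \<tau>"
    define E where "E = \<pi>2 (\<pi>2 \<tau>)"
    let ?g = "occurrences_before q k"
    have g: "valid_guesses n ?g (q k)" "on_face n ?g (q k) b"
      using valid b(2) q_le[of k] q_count[of _ k] by (auto simp: valid_guesses_def on_face_def)
    have "pinned n p ?g (q k) i M E (\<pi>1 (\<pi>2 \<tau>))"
      using R i n by (simp add: pin_certificate_def k_def E_def)
    then obtain s where "face_reject n p ?g (q k) b s \<or>
       M \<le> s \<and> (digits 2 (coordinate n b i) M = E \<or> Suc (digits 2 (coordinate n b i) M) = E)"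
      unfolding pinned_iff(1)[OF n g(1) i] using b(1) by blast
    moreover have "\<not> face_reject n p ?g (q k) b s"
      using ex_face_reject_iff[OF p b(1)] g(2) b(3) x by blast
    ultimately have "real E - 1 \<le> x i * 2 ^ M \<and> x i * 2 ^ M \<le> real E + 1"
      using bounds[OF b(1) i, of M] b(3) by auto
    then have "\<bar>real E - x i * 2 ^ M\<bar> \<le> 1"
      by linarith
    then have "\<bar>real E - x i * 2 ^ M\<bar> / 2 ^ M \<le> 1 / 2 ^ M"
      by (intro divide_right_mono) auto
    also have "\<bar>real E - x i * 2 ^ M\<bar> / 2 ^ M = \<bar>(real E - x i * 2 ^ M) / 2 ^ M\<bar>"
      by simp
    also have "(real E - x i * 2 ^ M) / 2 ^ M = real E / 2 ^ M - x i"
      by (simp add: diff_divide_distrib)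
    finally show ?thesis
      by (simp add: E_def power_one_over)
  qed
  have total: "\<exists>\<tau>. ?R t \<tau>" for t
  proof -
    define i where "i = t mod n"
    define M where "M = t div n"
    \<comment> \<open>The digits depend on the expansion of \<open>x i\<close>, but every truncation
      d satisfies \<open>d \<le> x i * 2 ^ M \<le> d + 1\<close>, so the floor is d or d + 1. These
      are the two cases in \<open>pinned\<close>.\<close>
    define E where "E = nat \<lfloor>x i * 2 ^ M\<rfloor>"
    have i: "i < n" using n by (simp add: i_def)
    obtain k where k: "q k = m"
      unfolding q_def using ex_sort_seq_eq[OF m] by blast
    let ?g = "occurrences_before q k"
    have g: "valid_guesses n ?g m" "on_face n ?g m b' \<longleftrightarrow> on_face n c m b'" for b'
      using valid q_count[of _ k] k by (auto simp: valid_guesses_def on_face_def)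
    have "\<exists>s. face_reject n p ?g m b' s \<or>
        M \<le> s \<and> (digits 2 (coordinate n b' i) M = E \<or> Suc (digits 2 (coordinate n b' i) M) = E)"
      if b': "b' \<in> cantor" for b'
    proof (cases "on_face n c m b' \<and> cube_point n b' \<in> A")
      case True
      then have x': "cube_point n b' = x"
        using unique b' by blast
      let ?d = "digits 2 (coordinate n b' i) M"
      have "real ?d \<le> x i * 2 ^ M" "x i * 2 ^ M \<le> real ?d + 1"
        using bounds[OF b' i, of M] x' by auto
      then have "int ?d \<le> \<lfloor>x i * 2 ^ M\<rfloor>" "\<lfloor>x i * 2 ^ M\<rfloor> \<le> int ?d + 1"
        by linarith+
      then have "?d = E \<or> Suc ?d = E"
        by (auto simp: E_def)
      then show ?thesis by blast
    next
      case False
      then show ?thesis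
        using ex_face_reject_iff[OF p b', of ?g m] g(2) by blast
    qed
    then obtain s where "pinned n p ?g m i M E s"
      using pinned_iff(2)[OF n g(1) i, of p M E] by blast
    then have "?R t (prod_encode (k, prod_encode (s, E)))"
      by (simp add: pin_certificate_def k i_def M_def)
    then show ?thesis ..
  qed
  define z where "z t = prod_encode (2 * \<pi>2 (\<pi>2 (LEAST \<tau>. ?R t \<tau>)), 2 ^ (t div n) - 1)" for t
  have "pin_map n (pairing p q) = Some z"
    using total by (auto simp: pin_map_def z_def)
  moreover have "cube_name n z x"
    unfolding cube_name_def
  proof (intro conjI allI impI)
    fix i assume i: "i < n"
    show "0 \<le> x i" "x i \<le> 1"
      using has_value_bounds[OF has_value_coordinate[OF b(1) i]] b(3) by auto
    show "cauchy_name (\<lambda>m. z (n * m + i)) (x i)"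
      unfolding cauchy_name_def
    proof
      fix M
      have "?R (n * M + i) (LEAST \<tau>. ?R (n * M + i) \<tau>)"
        using total by (rule LeastI_ex)
      from sound[OF this i] show "\<bar>rat_code (z (n * M + i)) - x i\<bar> \<le> (1 / 2) ^ M"
        using i n by (simp add: z_def rat_code_dyadic[simplified])
    qed
  qed (use b(3) in \<open>auto simp: cube_point_def\<close>)
  ultimately show ?thesis
    using x by (auto simp: q_def e_def)
qed

lemma sort_seq_le:
  assumes "\<And>t. e t \<le> n"
  shows "sort_seq e k \<le> n"
proof -
  obtain s where s: "s \<le> n" "infinite (occurrences e s)"
    using ex_infinite_occurrences[of e n] assms by auto
  define m where "m = (LEAST s. infinite (occurrences e s))"
  have "infinite (occurrences e m)"
    unfolding m_def using s(2) by (rule LeastI)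
  moreover have "finite (occurrences e i)" if "i < m" for i
    using not_less_Least[of i] that unfolding m_def by blast
  ultimately have "sort_seq e k \<le> m"
    by (rule sort_seq_counts(1))
  moreover have "m \<le> s"
    unfolding m_def using s(2) by (rule Least_le)
  ultimately show ?thesis
    using s(1) by simp
qed

theorem XC_le_Sort:
  assumes "n \<ge> 1"
  shows "XC n \<le>\<^sub>W Sort (n + 1)"
  unfolding weihrauch_le_def
proof (intro exI conjI allI impI)
  show "computable (\<lambda>p. Some (refutation_log n p))"
    by (rule computable_cf[OF cf_refutation_log])
  show "computable (pin_map n)"
    by (rule computable_pin_map)
  fix G assume G: "G \<turnstile> Sort (n + 1)"
  show "(\<lambda>p. Option.bind (Some (refutation_log n p)) (\<lambda>h. Option.bind (G h) (\<lambda>q. pin_map n (pairing p q))))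
      \<turnstile> XC n"
    unfolding realizes_def
  proof (intro allI impI)
    fix p A
    assume "source (XC n) p = Some A \<and> val (XC n) A \<noteq> {}"
    then have p: "closed_name (cube n) p A" and A: "convex_set A" "A \<noteq> {}"
      by (auto simp: XC_def restrict_problem_def closed_choice_def closed_sets_eq_Some split: if_splits)
    have "source (Sort (n + 1)) (refutation_log n p) = Some (refutation_log n p)"
      using refutation_log_le[of n p] by (simp add: Sort_def words_def less_Suc_eq_le)
    then obtain q y where "G (refutation_log n p) = Some q" "target (Sort (n + 1)) q = Some y"
      "y = sort_seq (refutation_log n p)"
      using G unfolding realizes_def by (fastforce simp: Sort_def)
    then have q: "G (refutation_log n p) = Some (sort_seq (refutation_log n p))"
      by (auto simp: Sort_def words_def split: if_splits)
    from pin_map_correct[OF assms p A]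
    show "\<exists>r z. Option.bind (Some (refutation_log n p))
        (\<lambda>h. Option.bind (G h) (\<lambda>q. pin_map n (pairing p q))) = Some r \<and>
        target (XC n) r = Some z \<and> z \<in> val (XC n) A"
      using A by (simp add: q XC_def restrict_problem_def closed_choice_def cube_eq_Some)
  qed
qed

section \<open>Continuous reducibility\<close>

definition cont_map :: "(baire \<rightharpoonup> baire) \<Rightarrow> bool" where
  "cont_map F \<longleftrightarrow> (\<forall>p q N. F p = Some q \<longrightarrow>
     (\<exists>M. \<forall>p' q'. (\<forall>i<M. p' i = p i) \<longrightarrow> F p' = Some q' \<longrightarrow> (\<forall>i<N. q' i = q i)))"

lemma cont_mapD:
  "cont_map F \<Longrightarrow> F p = Some q \<Longrightarrow>
    \<exists>M. \<forall>p' q'. (\<forall>i<M. p' i = p i) \<longrightarrow> F p' = Some q' \<longrightarrow> (\<forall>i<N. q' i = q i)"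
  unfolding cont_map_def by simp

lemma computable_imp_cont_map:
  assumes "computable F"
  shows "cont_map F"
  unfolding cont_map_def
proof (intro allI impI)
  fix p q N assume q: "F p = Some q"
  obtain e where e: "\<And>p q n. F p = Some q \<Longrightarrow> eval p e [n] (q n)"
    using assms unfolding computable_def by auto
  have "\<exists>m. \<forall>p'. (\<forall>i<m. p' i = p i) \<longrightarrow> eval p' e [n] (q n)" for n
    by (rule eval_use[OF e[OF q]])
  then obtain m where m: "\<And>n p'. (\<forall>i<m n. p' i = p i) \<Longrightarrow> eval p' e [n] (q n)"
    by metis
  show "\<exists>M. \<forall>p' q'. (\<forall>i<M. p' i = p i) \<longrightarrow> F p' = Some q' \<longrightarrow> (\<forall>i<N. q' i = q i)"
  proof (intro exI allI impI)
    fix p' q' i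
    assume *: "\<forall>i<(\<Sum>n<N. m n). p' i = p i" "F p' = Some q'" "i < N"
    have "m i \<le> (\<Sum>n<N. m n)"
      using *(3) by (intro member_le_sum) auto
    then have "eval p' e [i] (q i)"
      using *(1) by (intro m) auto
    with e[OF *(2)] show "q' i = q i"
      by (rule eval_det)
  qed
qed

lemma cont_map_bind:
  assumes "cont_map F" "cont_map G"
  shows "cont_map (\<lambda>p. Option.bind (F p) G)"
  unfolding cont_map_def
proof (intro allI impI)
  fix p r N assume "Option.bind (F p) G = Some r"
  then obtain q where q: "F p = Some q" "G q = Some r"
    by (auto simp: bind_eq_Some_conv)
  obtain L where L: "\<forall>q' r'. (\<forall>i<L. q' i = q i) \<longrightarrow> G q' = Some r' \<longrightarrow> (\<forall>i<N. r' i = r i)"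
    using cont_mapD[OF assms(2), OF q(2), of N] ..
  obtain M where M: "\<forall>p' q'. (\<forall>i<M. p' i = p i) \<longrightarrow> F p' = Some q' \<longrightarrow> (\<forall>i<L. q' i = q i)"
    using cont_mapD[OF assms(1), OF q(1), of L] ..
  show "\<exists>M. \<forall>p' q'. (\<forall>i<M. p' i = p i) \<longrightarrow> Option.bind (F p') G = Some q' \<longrightarrow> (\<forall>i<N. q' i = r i)"
  proof (intro exI allI impI)
    fix p' r' i
    assume *: "\<forall>i<M. p' i = p i" "Option.bind (F p') G = Some r'" "i < N"
    then obtain q' where q': "F p' = Some q'" "G q' = Some r'"
      by (auto simp: bind_eq_Some_conv)
    have "\<forall>i<L. q' i = q i"
      using M *(1) q'(1) by simp
    then show "r' i = r i"
      using L q'(2) *(3) by simp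
  qed
qed

lemma cont_map_pairing:
  assumes "cont_map F" "cont_map G"
  shows "cont_map (\<lambda>p. Option.bind (F p) (\<lambda>x. Option.bind (G p) (\<lambda>y. Some (pairing x y))))"
  unfolding cont_map_def
proof (intro allI impI)
  fix p r N assume "Option.bind (F p) (\<lambda>x. Option.bind (G p) (\<lambda>y. Some (pairing x y))) = Some r"
  then obtain x y where q: "F p = Some x" "G p = Some y" and r: "r = pairing x y"
    by (auto simp: bind_eq_Some_conv)
  obtain L where L: "\<forall>p' q'. (\<forall>i<L. p' i = p i) \<longrightarrow> F p' = Some q' \<longrightarrow> (\<forall>i<N. q' i = x i)"
    using cont_mapD[OF assms(1), OF q(1), of N] ..
  obtain M where M: "\<forall>p' q'. (\<forall>i<M. p' i = p i) \<longrightarrow> G p' = Some q' \<longrightarrow> (\<forall>i<N. q' i = y i)"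
    using cont_mapD[OF assms(2), OF q(2), of N] ..
  show "\<exists>M. \<forall>p' q'. (\<forall>i<M. p' i = p i) \<longrightarrow>
      Option.bind (F p') (\<lambda>x. Option.bind (G p') (\<lambda>y. Some (pairing x y))) = Some q' \<longrightarrow> (\<forall>i<N. q' i = r i)"
  proof (intro exI allI impI)
    fix p' r' i
    assume *: "\<forall>i<max L M. p' i = p i"
      "Option.bind (F p') (\<lambda>x. Option.bind (G p') (\<lambda>y. Some (pairing x y))) = Some r'" "i < N"
    then obtain x' y' where q': "F p' = Some x'" "G p' = Some y'" and r': "r' = pairing x' y'"
      by (auto simp: bind_eq_Some_conv)
    have "\<forall>i<L. p' i = p i" "\<forall>i<M. p' i = p i"
      using *(1) by simp_all
    then have "\<forall>i<N. x' i = x i" "\<forall>i<N. y' i = y i"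
      using L M q' by simp_all
    moreover have "i div 2 < N" using *(3) by simp
    ultimately show "r' i = r i"
      by (simp add: r r' pairing_def)
  qed
qed

lemma cont_map_even: "cont_map (\<lambda>r. Some (\<lambda>i. r (2 * i)))"
  and cont_map_odd: "cont_map (\<lambda>r. Some (\<lambda>i. r (2 * i + 1)))"
proof -
  show "cont_map (\<lambda>r. Some (\<lambda>i. r (2 * i)))"
    unfolding cont_map_def
  proof (intro allI impI)
    fix p q :: baire and N
    assume "Some (\<lambda>i. p (2 * i)) = Some q"
    then show "\<exists>M. \<forall>p' q'. (\<forall>i<M. p' i = p i) \<longrightarrow> Some (\<lambda>i. p' (2 * i)) = Some q' \<longrightarrow> (\<forall>i<N. q' i = q i)"
      by (intro exI[of _ "2 * N"]) auto
  qed
  show "cont_map (\<lambda>r. Some (\<lambda>i. r (2 * i + 1)))"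
    unfolding cont_map_def
  proof (intro allI impI)
    fix p q :: baire and N
    assume "Some (\<lambda>i. p (2 * i + 1)) = Some q"
    then show "\<exists>M. \<forall>p' q'. (\<forall>i<M. p' i = p i) \<longrightarrow> Some (\<lambda>i. p' (2 * i + 1)) = Some q' \<longrightarrow> (\<forall>i<N. q' i = q i)"
      by (intro exI[of _ "2 * N + 1"]) auto
  qed
qed

text \<open>The lower bound is topological. Transitivity for continuous maps only composes moduli,
  whereas for programs one would have to run on the computed output of another.\<close>

definition cont_le :: "('a, 'b) problem \<Rightarrow> ('c, 'd) problem \<Rightarrow> bool" where
  "cont_le f g \<longleftrightarrow> (\<exists>H K. cont_map H \<and> cont_map K \<and>
     (\<forall>G. G \<turnstile> g \<longrightarrow>
       (\<lambda>p. Option.bind (H p) (\<lambda>h. Option.bind (G h) (\<lambda>q. K (pairing p q)))) \<turnstile> f))"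

lemma weihrauch_le_imp_cont_le: "f \<le>\<^sub>W g \<Longrightarrow> cont_le f g"
  unfolding weihrauch_le_def cont_le_def using computable_imp_cont_map by blast

lemma cont_le_trans:
  assumes "cont_le f g" "cont_le g h"
  shows "cont_le f h"
proof -
  obtain H1 K1 where 1: "cont_map H1" "cont_map K1" "\<And>G. G \<turnstile> g \<Longrightarrow>
       (\<lambda>p. Option.bind (H1 p) (\<lambda>h. Option.bind (G h) (\<lambda>q. K1 (pairing p q)))) \<turnstile> f"
    using assms(1) unfolding cont_le_def by auto
  obtain H2 K2 where 2: "cont_map H2" "cont_map K2" "\<And>G. G \<turnstile> h \<Longrightarrow>
       (\<lambda>p. Option.bind (H2 p) (\<lambda>h. Option.bind (G h) (\<lambda>q. K2 (pairing p q)))) \<turnstile> g"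
    using assms(2) unfolding cont_le_def by auto
  let ?ev = "\<lambda>r :: baire. Some (\<lambda>i. r (2 * i))" and ?od = "\<lambda>r :: baire. Some (\<lambda>i. r (2 * i + 1))"
  \<comment> \<open>The composite backward map is given p and the final answer. It recomputes
    \<open>H1 p\<close> to feed \<open>K2\<close>, and passes the outcome together with p to
    \<open>K1\<close>.\<close>
  let ?h1 = "\<lambda>r. Option.bind (?ev r) H1"
  let ?s = "\<lambda>r. Option.bind (Option.bind (?h1 r) (\<lambda>x. Option.bind (?od r) (\<lambda>y. Some (pairing x y)))) K2"
  let ?K = "\<lambda>r. Option.bind (Option.bind (?ev r) (\<lambda>x. Option.bind (?s r) (\<lambda>y. Some (pairing x y)))) K1"
  let ?H = "\<lambda>p. Option.bind (H1 p) H2"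
  have "cont_map ?H"
    by (intro cont_map_bind 1 2)
  moreover have "cont_map ?K"
    by (intro cont_map_bind cont_map_pairing cont_map_even cont_map_odd 1 2)
  moreover have "(\<lambda>p. Option.bind (?H p) (\<lambda>h. Option.bind (G h) (\<lambda>q. ?K (pairing p q)))) \<turnstile> f"
    if "G \<turnstile> h" for G
  proof -
    have eq: "(\<lambda>p. Option.bind (?H p) (\<lambda>h. Option.bind (G h) (\<lambda>q. ?K (pairing p q)))) =
      (\<lambda>p. Option.bind (H1 p) (\<lambda>h. Option.bind (Option.bind (H2 h) (\<lambda>h'. Option.bind (G h')
         (\<lambda>q. K2 (pairing h q)))) (\<lambda>q. K1 (pairing p q))))"
    proof
      fix p
      show "Option.bind (?H p) (\<lambda>h. Option.bind (G h) (\<lambda>q. ?K (pairing p q))) =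
        Option.bind (H1 p) (\<lambda>h. Option.bind (Option.bind (H2 h) (\<lambda>h'. Option.bind (G h')
         (\<lambda>q. K2 (pairing h q)))) (\<lambda>q. K1 (pairing p q)))"
        by (cases "H1 p") simp_all
    qed
    show ?thesis
      unfolding eq by (intro 1(3) 2(3) that)
  qed
  ultimately show ?thesis
    unfolding cont_le_def by blast
qed

section \<open>Finite choice does not reduce to sorting with fewer symbols\<close>

subsection \<open>Trees as names of closed sets\<close>

definition prefix_of :: "nat \<Rightarrow> baire \<Rightarrow> nat list" where
  "prefix_of s x = map x [0..<s]"

lemma prefix_of_eq_iff: "prefix_of s x = prefix_of s y \<longleftrightarrow> (\<forall>j<s. x j = y j)"
  by (auto simp: prefix_of_def)

lemma length_prefix_of [simp]: "length (prefix_of s x) = s"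
  by (simp add: prefix_of_def)

lemma prefix_of_mono: "prefix_of t x = prefix_of t y \<Longrightarrow> s \<le> t \<Longrightarrow> prefix_of s x = prefix_of s y"
  by (auto simp: prefix_of_eq_iff)

text \<open>The trees below need not be closed under prefixes and may have dead ends: the latter account
  for delays in the negative information.\<close>

definition paths :: "nat list set \<Rightarrow> baire set" where
  "paths T = {x \<in> cantor. \<forall>s. prefix_of s x \<in> T}"

text \<open>Output position m is answered after exactly m bits: 1 codes the output 0 (no objection),
  2 codes the output 1 (the branch leaves T). An initial part of the name therefore depends on
  bounded levels of T only.\<close>

definition tree_name :: "nat list set \<Rightarrow> baire" where
  "tree_name T c = (case list_decode c of [] \<Rightarrow> 0 | m # w \<Rightarrow>
     if length w = m then if w \<in> T then 1 else 2 else 0)"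

lemma closed_name_tree_name: "closed_name (words 2) (tree_name T) (paths T)"
proof -
  have assoc: "associate (tree_name T) q (\<lambda>m. if prefix_of m q \<in> T then 0 else 1)" for q
    unfolding associate_def tree_name_def list_encode_inverse prefix_of_def[symmetric] by auto
  have "fun_name (words 2) sierpinski (tree_name T) (\<lambda>x. x \<notin> paths T)"
    unfolding fun_name_def
  proof (intro allI impI exI conjI)
    fix q x assume "words 2 q = Some x"
    then have "q \<in> cantor" "x = q"
      by (auto simp: words_2_eq_Some)
    then show "sierpinski (\<lambda>m. if prefix_of m q \<in> T then 0 else 1) = Some (x \<notin> paths T)"
      by (simp add: sierpinski_def paths_def)
  qed (rule assoc)
  moreover have "paths T \<subseteq> ran (words 2)"
    by (auto simp: words_2_eq_Some ran_def paths_def)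
  ultimately show ?thesis
    by (simp add: closed_name_def)
qed

definition agree :: "nat \<Rightarrow> nat list set \<Rightarrow> nat list set \<Rightarrow> bool" where
  "agree N T T' \<longleftrightarrow> (\<forall>w. length w \<le> N \<longrightarrow> (w \<in> T \<longleftrightarrow> w \<in> T'))"

lemma agree_refl: "agree N T T"
  and agree_sym: "agree N T T' \<Longrightarrow> agree N T' T"
  and agree_trans: "agree N T T' \<Longrightarrow> agree N T' T'' \<Longrightarrow> agree N T T''"
  and agree_le: "agree N T T' \<Longrightarrow> M \<le> N \<Longrightarrow> agree M T T'"
  by (auto simp: agree_def)

lemma length_le_list_encode: "length xs \<le> list_encode xs"
proof (induction xs)
  case (Cons x xs)
  then show ?case
    using le_prod_encode_2[of "list_encode xs" x] by simp
qed simp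

lemma tree_name_cong:
  assumes "agree N T T'" "c < N"
  shows "tree_name T' c = tree_name T c"
proof (cases "list_decode c")
  case (Cons m w)
  have "length (list_decode c) \<le> c"
    using length_le_list_encode[of "list_decode c"] by simp
  with Cons assms show ?thesis
    by (auto simp: tree_name_def agree_def)
qed (simp add: tree_name_def)

text \<open>Up to level N the tree is that of T, dead ends included; beyond N only Y continues. The
  set of paths changes while the name stays as it has been read so far.\<close>

definition prune :: "nat list set \<Rightarrow> nat \<Rightarrow> baire set \<Rightarrow> nat list set" where
  "prune T N Y = {w \<in> T. length w \<le> N} \<union> {prefix_of s y |s y. N < s \<and> y \<in> Y}"

lemma agree_prune: "agree N T (prune T N Y)"
  by (auto simp: agree_def prune_def)

lemma inj_on_prefix_of_mono: "inj_on (prefix_of N) Y \<Longrightarrow> N \<le> M \<Longrightarrow> inj_on (prefix_of M) Y"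
  by (intro inj_onI) (erule inj_onD, erule prefix_of_mono)

lemma ex_separating_level:
  assumes "finite Y"
  shows "\<exists>N. inj_on (prefix_of N) Y"
  using assms
proof (induction Y)
  case (insert y Y)
  then obtain N where N: "inj_on (prefix_of N) Y" by blast
  have "\<forall>x. \<exists>j. x \<in> Y \<longrightarrow> x j \<noteq> y j"
  proof
    fix x
    show "\<exists>j. x \<in> Y \<longrightarrow> x j \<noteq> y j"
    proof (cases "x \<in> Y")
      case True
      then have "x \<noteq> y" using insert(2) by blast
      then show ?thesis by (simp add: fun_eq_iff)
    qed simp
  qed
  then have "\<exists>J. \<forall>x. x \<in> Y \<longrightarrow> x (J x) \<noteq> y (J x)"
    by (rule choice)
  then obtain J where J: "\<And>x. x \<in> Y \<Longrightarrow> x (J x) \<noteq> y (J x)"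
    by auto
  define M where "M = N + Suc (\<Sum>x\<in>Y. J x)"
  have "J x < M" if "x \<in> Y" for x
    using member_le_sum[of x Y J] that insert(1) by (simp add: M_def)
  then have "prefix_of M x \<noteq> prefix_of M y" if "x \<in> Y" for x
    using J that by (auto simp: prefix_of_eq_iff)
  moreover have "inj_on (prefix_of M) Y"
    using N by (rule inj_on_prefix_of_mono) (simp add: M_def)
  ultimately have "inj_on (prefix_of M) (insert y Y)"
    using insert(2) by fastforce
  then show ?case ..
qed simp

lemma paths_prune:
  assumes "finite Y" "Y \<subseteq> cantor" "\<And>y s. y \<in> Y \<Longrightarrow> s \<le> N \<Longrightarrow> prefix_of s y \<in> T"
  shows "paths (prune T N Y) = Y"
proof
  show "Y \<subseteq> paths (prune T N Y)"
  proof
    fix y assume "y \<in> Y"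
    have "prefix_of s y \<in> prune T N Y" for s
    proof (cases "s \<le> N")
      case True
      with \<open>y \<in> Y\<close> assms(3) show ?thesis by (simp add: prune_def)
    next
      case False
      then have "\<exists>s' y'. prefix_of s y = prefix_of s' y' \<and> N < s' \<and> y' \<in> Y"
        using \<open>y \<in> Y\<close> by (intro exI[of _ s] exI[of _ y]) simp
      then show ?thesis by (simp add: prune_def)
    qed
    then show "y \<in> paths (prune T N Y)"
      using \<open>y \<in> Y\<close> assms(2) by (auto simp: paths_def)
  qed
  show "paths (prune T N Y) \<subseteq> Y"
  proof
    fix x assume x: "x \<in> paths (prune T N Y)"
    show "x \<in> Y"
    proof (rule ccontr)
      assume "x \<notin> Y"
      obtain M where M: "inj_on (prefix_of M) (insert x Y)"
        using ex_separating_level[of "insert x Y"] assms(1) by blast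
      define s where "s = Suc (max M N)"
      have "prefix_of s x \<in> prune T N Y"
        using x by (simp add: paths_def)
      then obtain t y where y: "y \<in> Y" "prefix_of s x = prefix_of t y"
        by (auto simp: prune_def s_def)
      have "t = s"
        using arg_cong[OF y(2), of length] by simp
      moreover have "inj_on (prefix_of s) (insert x Y)"
        using inj_on_prefix_of_mono[OF M] by (simp add: s_def)
      ultimately show False
        using \<open>x \<notin> Y\<close> y by (auto simp: inj_on_def)
    qed
  qed
qed

subsection \<open>Occurrences of symbols\<close>

text \<open>Unlike an exact count, a lower bound is witnessed by finitely many entries of the log,
  so it persists under small changes of the tree.\<close>

definition occurs_at_least :: "baire \<Rightarrow> nat \<Rightarrow> nat \<Rightarrow> bool" where
  "occurs_at_least e l v \<longleftrightarrow> (\<exists>t. v \<le> occurrences_before e t l)"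

lemma occurs_at_least_0: "occurs_at_least e l 0"
  by (simp add: occurs_at_least_def)

lemma infinite_occurs_at_least: "infinite (occurrences e l) \<Longrightarrow> occurs_at_least e l v"
  unfolding occurs_at_least_def using ex_occurrence_at_count[of e l v] by (metis order_refl)

lemma occurs_at_least_le_card:
  assumes "occurs_at_least e l v" "finite (occurrences e l)"
  shows "v \<le> card (occurrences e l)"
proof -
  obtain t where "v \<le> card {s. s < t \<and> e s = l}"
    using assms(1) by (auto simp: occurs_at_least_def occurrences_before_eq)
  also have "\<dots> \<le> card (occurrences e l)"
    using assms(2) by (intro card_mono) (auto simp: occurrences_def)
  finally show ?thesis .
qed

lemma card_occurs_at_least:
  assumes "finite (occurrences e l)"
  shows "occurs_at_least e l (card (occurrences e l))"
proof -
  obtain S where "\<forall>t\<in>occurrences e l. t < S"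
    using assms finite_nat_set_iff_bounded by auto
  then have "occurrences_before e S l = card (occurrences e l)"
    by (intro occurrences_before_finite[of S]) (auto simp: occurrences_def)
  then show ?thesis
    by (metis occurs_at_least_def order_refl)
qed

lemma not_occurs_at_least_Suc:
  assumes "\<not> occurs_at_least e l (Suc v)"
  shows "finite (occurrences e l)" "card (occurrences e l) \<le> v"
proof -
  show fin: "finite (occurrences e l)"
    using assms infinite_occurs_at_least by blast
  show "card (occurrences e l) \<le> v"
  proof (rule ccontr)
    assume "\<not> ?thesis"
    then have "Suc v \<le> card (occurrences e l)" by simp
    with card_occurs_at_least[OF fin] assms show False
      unfolding occurs_at_least_def using order_trans by blast
  qed
qed

text \<open>Equal counts below l give equal blocks, after which both sequences have at least M
  copies of l. Together these cover the first M positions.\<close>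

lemma sort_seq_prefix_eq:
  assumes inf: "\<exists>s. infinite (occurrences e s)" "\<exists>s. infinite (occurrences e' s)"
    and fin: "\<And>i. i < l \<Longrightarrow> finite (occurrences e i)" "\<And>i. i < l \<Longrightarrow> finite (occurrences e' i)"
    and card: "\<And>i. i < l \<Longrightarrow> card (occurrences e i) = card (occurrences e' i)"
    and M: "occurs_at_least e l M" "occurs_at_least e' l M" and k: "k < M"
  shows "sort_seq e k = sort_seq e' k"
proof -
  have start: "block_start e i = block_start e' i" if "i \<le> l" for i
    unfolding block_start_def using card that by (intro sum.cong) auto
  show ?thesis
  proof (cases "k < block_start e l")
    case True
    then obtain i where i: "i < l" "block_start e i \<le> k" "k < block_start e (Suc i)"
      using ex_block by blast
    then have "sort_seq e k = i"
      using fin inf by (intro sort_seq_block) auto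
    moreover have "sort_seq e' k = i"
      using fin inf i start[of i] start[of "Suc i"] by (intro sort_seq_block) auto
    ultimately show ?thesis by simp
  next
    case False
    have next_start: "infinite (occurrences e'' l) \<or> k < block_start e'' (Suc l)"
      if "occurs_at_least e'' l M" for e''
      using occurs_at_least_le_card[OF that] k by (auto simp: block_start_def)
    have "sort_seq e k = l"
      using False fin inf next_start[OF M(1)] by (intro sort_seq_block) auto
    moreover have "sort_seq e' k = l"
      using False fin inf next_start[OF M(2)] start[of l] by (intro sort_seq_block) auto
    ultimately show ?thesis by simp
  qed
qed

subsection \<open>Defeating a reduction\<close>

locale choice_by_sorting =
  fixes n :: nat and H K :: "baire \<rightharpoonup> baire"
  assumes cont_H: "cont_map H" and cont_K: "cont_map K"
    and solves: "\<And>p A. closed_name (words 2) p A \<Longrightarrow> finite A \<Longrightarrow> A \<noteq> {} \<Longrightarrow> card A \<le> n + 1 \<Longrightarrow>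
      \<exists>h y. H p = Some h \<and> (\<forall>t. h t < n) \<and> K (pairing p (sort_seq h)) = Some y \<and> y \<in> A"
begin

definition good :: "nat list set \<Rightarrow> bool" where
  "good T \<longleftrightarrow> finite (paths T) \<and> paths T \<noteq> {} \<and> card (paths T) \<le> n + 1"

definition log :: "nat list set \<Rightarrow> baire" where
  "log T = the (H (tree_name T))"

definition answer :: "nat list set \<Rightarrow> baire" where
  "answer T = the (K (pairing (tree_name T) (sort_seq (log T))))"

lemma good_solved:
  assumes "good T"
  shows "H (tree_name T) = Some (log T)" "log T t < n"
    "K (pairing (tree_name T) (sort_seq (log T))) = Some (answer T)" "answer T \<in> paths T"
proof -
  obtain h y where "H (tree_name T) = Some h" "\<forall>t. h t < n"
    "K (pairing (tree_name T) (sort_seq h)) = Some y" "y \<in> paths T"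
    using solves[OF closed_name_tree_name, of T] assms unfolding good_def by auto
  then show "H (tree_name T) = Some (log T)" "log T t < n"
    "K (pairing (tree_name T) (sort_seq (log T))) = Some (answer T)" "answer T \<in> paths T"
    by (simp_all add: log_def answer_def)
qed

lemma log_continuous:
  assumes "good T"
  shows "\<exists>N. \<forall>T'. agree N T T' \<longrightarrow> good T' \<longrightarrow> (\<forall>t<M. log T' t = log T t)"
proof -
  obtain N where N: "\<forall>p' q'. (\<forall>i<N. p' i = tree_name T i) \<longrightarrow> H p' = Some q' \<longrightarrow> (\<forall>i<M. q' i = log T i)"
    using cont_mapD[OF cont_H, OF good_solved(1)[OF assms], of M] ..
  show ?thesis
  proof (intro exI impI allI)
    fix T' t assume *: "agree N T T'" "good T'" "t < M"
    have "\<forall>i<N. tree_name T' i = tree_name T i"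
      using tree_name_cong[OF *(1)] by simp
    then show "log T' t = log T t"
      using N good_solved(1)[OF *(2)] *(3) by simp
  qed
qed

text \<open>Agreement of the sorted logs is a separate hypothesis, because it does not follow from
  agreement of the trees.\<close>

lemma answer_continuous:
  assumes "good T"
  shows "\<exists>N. \<forall>T'. agree N T T' \<longrightarrow> good T' \<longrightarrow> (\<forall>k<N. sort_seq (log T') k = sort_seq (log T) k) \<longrightarrow>
     prefix_of M (answer T') = prefix_of M (answer T)"
proof -
  obtain N where N: "\<forall>p' q'. (\<forall>i<N. p' i = pairing (tree_name T) (sort_seq (log T)) i) \<longrightarrow> K p' = Some q' \<longrightarrow>
      (\<forall>i<M. q' i = answer T i)"
    using cont_mapD[OF cont_K, OF good_solved(3)[OF assms], of M] ..
  show ?thesis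
  proof (intro exI impI allI)
    fix T' assume *: "agree N T T'" "good T'" "\<forall>k<N. sort_seq (log T') k = sort_seq (log T) k"
    have "pairing (tree_name T') (sort_seq (log T')) i = pairing (tree_name T) (sort_seq (log T)) i"
      if "i < N" for i
    proof -
      have "i div 2 < N" using that by simp
      then show ?thesis
        using tree_name_cong[OF *(1), of "i div 2"] *(3) by (simp add: pairing_def)
    qed
    then have "\<forall>i<N. pairing (tree_name T') (sort_seq (log T')) i = pairing (tree_name T) (sort_seq (log T)) i"
      by simp
    then show "prefix_of M (answer T') = prefix_of M (answer T)"
      using N good_solved(3)[OF *(2)] by (simp add: prefix_of_eq_iff)
  qed
qed

lemma occurs_at_least_continuous:
  assumes "good T" "occurs_at_least (log T) l v"
  shows "\<exists>N. \<forall>T'. agree N T T' \<longrightarrow> good T' \<longrightarrow> occurs_at_least (log T') l v"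
proof -
  obtain t where t: "v \<le> occurrences_before (log T) t l"
    using assms(2) by (auto simp: occurs_at_least_def)
  obtain N where N: "\<forall>T'. agree N T T' \<longrightarrow> good T' \<longrightarrow> (\<forall>s<t. log T' s = log T s)"
    using log_continuous[OF assms(1), of t] ..
  show ?thesis
  proof (intro exI allI impI)
    fix T' assume "agree N T T'" "good T'"
    then have "occurrences_before (log T') t l = occurrences_before (log T) t l"
      unfolding occurrences_before_def using N by (intro sum.cong) auto
    with t show "occurs_at_least (log T') l v"
      unfolding occurs_at_least_def by metis
  qed
qed

text \<open>The pair (T, N) acts as a forcing condition: the words of length N that carry paths are
  fixed, while the number of paths above each of them may change.\<close>

definition ext :: "nat list set \<Rightarrow> nat \<Rightarrow> nat list set set" where
  "ext T N = {T'. agree N T T' \<and> good T' \<and> prefix_of N ` paths T' = prefix_of N ` paths T}"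

lemma ext_refl: "good T \<Longrightarrow> T \<in> ext T N"
  by (simp add: ext_def agree_refl)

lemma prefix_of_image_le:
  assumes "prefix_of N ` A = prefix_of N ` B" "M \<le> N"
  shows "prefix_of M ` A = prefix_of M ` B"
proof -
  have "prefix_of M x = take M (prefix_of N x)" for x
    using assms(2) by (simp add: prefix_of_def take_map)
  then have "prefix_of M ` C = take M ` prefix_of N ` C" for C
    by (simp add: image_image)
  with assms(1) show ?thesis by simp
qed

lemma ext_subset:
  assumes "T1 \<in> ext T N" "N \<le> N1"
  shows "ext T1 N1 \<subseteq> ext T N"
proof
  fix T2 assume "T2 \<in> ext T1 N1"
  then show "T2 \<in> ext T N"
    using assms prefix_of_image_le[of N1 "paths T2" "paths T1" N] agree_le[of N1 T1 T2 N] agree_trans[of N T T1 T2]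
    by (auto simp: ext_def)
qed

lemma ext_inj_on:
  assumes "T1 \<in> ext T N" "inj_on (prefix_of N) (paths T)" "card (paths T1) = card (paths T)"
  shows "inj_on (prefix_of N) (paths T1)"
proof (rule eq_card_imp_inj_on)
  show "finite (paths T1)"
    using assms(1) by (simp add: ext_def good_def)
  show "card (prefix_of N ` paths T1) = card (paths T1)"
    using assms(1,3) card_image[OF assms(2)] by (simp add: ext_def)
qed

text \<open>No dead ends from level M on. Otherwise a limit of trees could acquire new paths out of
  longer and longer dead ends.\<close>

definition clean :: "nat list set \<Rightarrow> nat \<Rightarrow> bool" where
  "clean T M \<longleftrightarrow> (\<forall>w\<in>T. M \<le> length w \<longrightarrow> w \<in> prefix_of (length w) ` paths T)"

text \<open>One path is kept above each word of level N, and all others are cut after level M. This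
  restores the number of paths of T without touching what has been read of T'.\<close>

lemma ex_thin:
  assumes "inj_on (prefix_of N) (paths T)" "T' \<in> ext T N" "N \<le> M"
  shows "\<exists>T1. agree M T' T1 \<and> T1 \<in> ext T N \<and> card (paths T1) = card (paths T) \<and> clean T1 (Suc M)"
proof -
  have T': "agree N T T'" "finite (paths T')" "paths T' \<noteq> {}" "card (paths T') \<le> n + 1"
    "prefix_of N ` paths T' = prefix_of N ` paths T"
    using assms(2) by (auto simp: ext_def good_def)
  have "prefix_of N ` paths T \<subseteq> prefix_of N ` paths T'"
    using T'(5) by simp
  then obtain Y where Y: "Y \<subseteq> paths T'" "inj_on (prefix_of N) Y" "prefix_of N ` paths T = prefix_of N ` Y"
    unfolding subset_image_inj by auto
  have fin: "finite Y"
    using Y(1) T'(2) by (rule finite_subset)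
  define T1 where "T1 = prune T' M Y"
  have paths: "paths T1 = Y"
    unfolding T1_def using Y(1) by (intro paths_prune fin) (auto simp: paths_def)
  have agree: "agree M T' T1"
    unfolding T1_def by (rule agree_prune)
  have card: "card Y = card (paths T)"
    using card_image[OF Y(2)] card_image[OF assms(1)] Y(3) by simp
  have "card Y \<le> n + 1"
    using card_mono[OF T'(2) Y(1)] T'(4) by simp
  moreover have "Y \<noteq> {}"
    using Y(3) T'(3,5) by auto
  ultimately have "good T1"
    using fin by (simp add: good_def paths)
  moreover have "agree N T T1"
    using agree_trans[OF T'(1) agree_le[OF agree assms(3)]] .
  ultimately have "T1 \<in> ext T N"
    by (simp add: ext_def paths Y(3))
  moreover have "clean T1 (Suc M)"
    by (auto simp: clean_def paths) (auto simp: T1_def prune_def)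
  ultimately show ?thesis
    using agree card paths by auto
qed

text \<open>Fusion. Cleanliness bounds the paths of the limit from above: at level
  \<open>L (Suc v)\<close> each runs through a word that carries a path of \<open>S (Suc v)\<close>.
  From below, a path of \<open>S 0\<close> is followed through the successive trees; step v changes
  it only from position \<open>L v\<close> on, so it converges to a path of the limit.\<close>

lemma ex_limit:
  assumes S: "\<And>v. S (Suc v) \<in> ext (S v) (L v)" and L: "\<And>v. L v < L (Suc v)"
    and clean: "\<And>v. clean (S (Suc v)) (L (Suc v))" and good: "good (S 0)"
    and card: "\<And>v. card (paths (S v)) = d" and inj: "inj_on (prefix_of (L 0)) (paths (S 0))"
  shows "\<exists>T. (\<forall>v. agree (L v) (S v) T) \<and> T \<in> ext (S 0) (L 0) \<and> card (paths T) = d"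
proof -
  have L_mono: "L v \<le> L v'" if "v \<le> v'" for v v'
    using that by (rule lift_Suc_mono_le[of L, OF less_imp_le[OF L]])
  have L_ge: "v \<le> L v" for v
  proof (induction v)
    case (Suc v)
    then show ?case using L[of v] by simp
  qed simp
  have good: "good (S v)" for v
    using good S by (cases v) (auto simp: ext_def)
  have in_ext: "S (v + k) \<in> ext (S v) (L v)" for v k
  proof (induction k)
    case (Suc k)
    have "S (Suc (v + k)) \<in> ext (S (v + k)) (L (v + k))"
      by (rule S)
    also have "\<dots> \<subseteq> ext (S v) (L v)"
      using Suc by (rule ext_subset) (simp add: L_mono)
    finally show ?case by simp
  qed (simp add: ext_refl good)
  have S_agree: "agree (L v) (S v) (S v')" if "v \<le> v'" for v v'
    using in_ext[of v "v' - v"] that by (simp add: ext_def)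
  \<comment> \<open>Since \<open>v \<le> L v\<close>, the tree with index \<open>length w\<close>
    has already decided w.\<close>
  define T where "T = {w. w \<in> S (length w)}"
  have agree: "agree (L v) (S v) T" for v
    unfolding agree_def
  proof (intro allI impI)
    fix w :: "nat list" assume w: "length w \<le> L v"
    show "w \<in> S v \<longleftrightarrow> w \<in> T"
    proof (cases "v \<le> length w")
      case True
      then show ?thesis
        using S_agree[OF True] w by (simp add: agree_def T_def)
    next
      case False
      then show ?thesis
        using S_agree[of "length w" v] L_ge[of "length w"] by (simp add: agree_def T_def)
    qed
  qed
  have sub: "prefix_of (L (Suc v)) ` paths T \<subseteq> prefix_of (L (Suc v)) ` paths (S (Suc v))" for v
  proof
    fix w assume "w \<in> prefix_of (L (Suc v)) ` paths T"
    then have "w \<in> T" "length w = L (Suc v)"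
      by (auto simp: paths_def)
    then have "w \<in> S (Suc v)"
      using agree[of "Suc v"] by (simp add: agree_def)
    with clean[of v] \<open>length w = L (Suc v)\<close> show "w \<in> prefix_of (L (Suc v)) ` paths (S (Suc v))"
      unfolding clean_def by auto
  qed
  have fin: "finite (paths (S v))" for v
    using good[of v] by (simp add: good_def)
  have bound: "card F \<le> d" if F: "finite F" "F \<subseteq> paths T" for F
  proof -
    obtain M where "inj_on (prefix_of M) F"
      using ex_separating_level[OF F(1)] ..
    then have "inj_on (prefix_of (L (Suc M))) F"
      by (rule inj_on_prefix_of_mono) (use L_ge[of "Suc M"] in simp)
    then have "card F = card (prefix_of (L (Suc M)) ` F)"
      by (simp add: card_image)
    also have "\<dots> \<le> card (prefix_of (L (Suc M)) ` paths (S (Suc M)))"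
      using sub[of M] F(2) fin by (intro card_mono) auto
    also have "\<dots> \<le> d"
      using card_image_le[OF fin, of "prefix_of (L (Suc M))" "Suc M"] card by simp
    finally show ?thesis .
  qed
  have fin_T: "finite (paths T)"
  proof (rule ccontr)
    assume "infinite (paths T)"
    then obtain F where "F \<subseteq> paths T" "finite F" "card F = Suc d"
      using infinite_arbitrarily_large by blast
    with bound[of F] show False by simp
  qed
  have "prefix_of (L 0) ` paths (S 0) \<subseteq> prefix_of (L 0) ` paths T"
  proof
    fix w assume "w \<in> prefix_of (L 0) ` paths (S 0)"
    then obtain y0 where y0: "y0 \<in> paths (S 0)" "w = prefix_of (L 0) y0" by blast
    have "\<exists>y. \<forall>v. (y v \<in> paths (S v) \<and> (v = 0 \<longrightarrow> y v = y0)) \<and> prefix_of (L v) (y (Suc v)) = prefix_of (L v) (y v)"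
    proof (rule dependent_nat_choice)
      show "\<exists>y. y \<in> paths (S 0) \<and> ((0::nat) = 0 \<longrightarrow> y = y0)"
        using y0 by auto
      fix x v assume "x \<in> paths (S v) \<and> (v = 0 \<longrightarrow> x = y0)"
      then have "prefix_of (L v) x \<in> prefix_of (L v) ` paths (S (Suc v))"
        using S[of v] by (auto simp: ext_def)
      then show "\<exists>y. (y \<in> paths (S (Suc v)) \<and> (Suc v = 0 \<longrightarrow> y = y0)) \<and> prefix_of (L v) y = prefix_of (L v) x"
        by auto
    qed
    then obtain y where y: "\<And>v. y v \<in> paths (S v)" "y 0 = y0"
      "\<And>v. prefix_of (L v) (y (Suc v)) = prefix_of (L v) (y v)"
      by auto
    have y_stable: "prefix_of (L v) (y (v + k)) = prefix_of (L v) (y v)" for v k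
    proof (induction k)
      case (Suc k)
      have "prefix_of (L v) (y (Suc (v + k))) = prefix_of (L v) (y (v + k))"
        using y(3)[of "v + k"] by (rule prefix_of_mono) (simp add: L_mono)
      with Suc show ?case by simp
    qed simp
    define x where "x j = y (Suc j) j" for j
    have x: "prefix_of (L v) x = prefix_of (L v) (y v)" for v
      unfolding prefix_of_eq_iff
    proof (intro allI impI)
      fix j assume j: "j < L v"
      show "x j = y v j"
      proof (cases "v \<le> Suc j")
        case True
        then show ?thesis
          using y_stable[of v "Suc j - v"] j by (simp add: prefix_of_eq_iff x_def)
      next
        case False
        then show ?thesis
          using y_stable[of "Suc j" "v - Suc j"] L_ge[of "Suc j"] by (simp add: prefix_of_eq_iff x_def)
      qed
    qed
    have "prefix_of s x \<in> T" for s
    proof -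
      have "prefix_of s x = prefix_of s (y s)"
        using x[of s] L_ge[of s] by (rule prefix_of_mono)
      then show ?thesis
        using y(1)[of s] by (simp add: T_def paths_def)
    qed
    moreover have "x \<in> cantor"
      using y(1) by (auto simp: x_def cantor_def paths_def)
    ultimately have "x \<in> paths T"
      by (simp add: paths_def)
    then show "w \<in> prefix_of (L 0) ` paths T"
      using x[of 0] y(2) y0(2) by (metis imageI)
  qed
  moreover have "prefix_of (L 0) ` paths T \<subseteq> prefix_of (L 0) ` paths (S 0)"
  proof -
    have "prefix_of (L 0) ` C = take (L 0) ` prefix_of (L 1) ` C" for C
      using L[of 0] by (simp add: image_image prefix_of_def take_map)
    then have "prefix_of (L 0) ` paths T \<subseteq> prefix_of (L 0) ` paths (S 1)"
      using sub[of 0] by (metis One_nat_def image_mono)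
    then show ?thesis
      using S[of 0] by (simp add: ext_def)
  qed
  ultimately have image: "prefix_of (L 0) ` paths T = prefix_of (L 0) ` paths (S 0)"
    by blast
  have "d = card (prefix_of (L 0) ` paths T)"
    using card_image[OF inj] card by (simp add: image)
  also have "\<dots> \<le> card (paths T)"
    using fin_T by (rule card_image_le)
  finally have card_T: "card (paths T) = d"
    using bound[OF fin_T] by simp
  have "d \<le> n + 1" "paths T \<noteq> {}"
    using good[of 0] card[of 0] image by (auto simp: good_def)
  then have "T \<in> ext (S 0) (L 0)"
    using agree[of 0] fin_T card_T image by (simp add: ext_def good_def)
  with agree card_T show ?thesis by blast
qed

text \<open>If the count of l is bounded on some condition with the same number of paths, passing to
  a tree with the largest count attained there fixes it. Otherwise the count can be raised again and
  again, and fusion yields infinitely many l. Thinning preserves the number of paths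
  throughout.\<close>

lemma dichotomy:
  assumes good: "good T" and inj: "inj_on (prefix_of N) (paths T)"
  shows "(\<exists>T1 N1 c. T1 \<in> ext T N \<and> N \<le> N1 \<and> card (paths T1) = card (paths T) \<and>
      (\<forall>T'\<in>ext T1 N1. finite (occurrences (log T') l) \<and> card (occurrences (log T') l) = c)) \<or>
    (\<exists>T1. T1 \<in> ext T N \<and> card (paths T1) = card (paths T) \<and> infinite (occurrences (log T1) l))"
proof -
  define sub where "sub T1 N1 \<longleftrightarrow> T1 \<in> ext T N \<and> N \<le> N1 \<and> card (paths T1) = card (paths T)" for T1 N1
  have sub_inj: "inj_on (prefix_of N1) (paths T1)" if "sub T1 N1" for T1 N1
    using that ext_inj_on[OF _ inj, of T1] inj_on_prefix_of_mono[of N "paths T1" N1] by (auto simp: sub_def)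
  have extend: "\<exists>T2 N2. sub T2 N2 \<and> T2 \<in> ext T1 N1 \<and> N1 < N2 \<and> clean T2 N2 \<and>
      (\<forall>T'. good T' \<longrightarrow> agree N2 T2 T' \<longrightarrow> occurs_at_least (log T') l v)"
    if sub: "sub T1 N1" and T': "T' \<in> ext T1 N1" "occurs_at_least (log T') l v" for T1 N1 T' v
  proof -
    have "good T'" using T'(1) by (simp add: ext_def)
    then obtain N0 where N0: "\<forall>T''. agree N0 T' T'' \<longrightarrow> good T'' \<longrightarrow> occurs_at_least (log T'') l v"
      using occurs_at_least_continuous[OF _ T'(2)] by blast
    define M where "M = max N0 N1"
    obtain T2 where T2: "agree M T' T2" "T2 \<in> ext T1 N1" "card (paths T2) = card (paths T1)" "clean T2 (Suc M)"
      using ex_thin[OF sub_inj[OF sub], OF T'(1), of M] by (auto simp: M_def)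
    have "sub T2 (Suc M)"
      using sub T2(2,3) ext_subset[of T1 T N N1] by (auto simp: sub_def M_def)
    moreover have "occurs_at_least (log T'') l v" if "good T''" "agree (Suc M) T2 T''" for T''
    proof -
      have "agree M T' T''"
        using T2(1) agree_le[OF that(2), of M] by (auto intro: agree_trans)
      then have "agree N0 T' T''"
        by (rule agree_le) (simp add: M_def)
      with N0 that(1) show ?thesis by blast
    qed
    moreover have "N1 < Suc M" by (simp add: M_def)
    ultimately show ?thesis
      using T2(2,4) by blast
  qed
  show ?thesis
  proof (cases "\<exists>T1 N1 v. sub T1 N1 \<and> (\<forall>T'\<in>ext T1 N1. \<not> occurs_at_least (log T') l v)")
    case True
    then obtain T1 N1 v where sub: "sub T1 N1"
      and v: "\<forall>T'\<in>ext T1 N1. \<not> occurs_at_least (log T') l v" by blast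
    define u where "u = (LEAST v. \<forall>T'\<in>ext T1 N1. \<not> occurs_at_least (log T') l v)"
    have u: "\<forall>T'\<in>ext T1 N1. \<not> occurs_at_least (log T') l u"
      unfolding u_def using v by (rule LeastI)
    have "T1 \<in> ext T1 N1"
      using sub by (auto simp: sub_def ext_def agree_refl)
    then have "u \<noteq> 0"
      using u occurs_at_least_0 by metis
    then obtain u' where u': "u = Suc u'"
      using not0_implies_Suc by blast
    then have "\<not> (\<forall>T'\<in>ext T1 N1. \<not> occurs_at_least (log T') l u')"
      using not_less_Least[of u' "\<lambda>v. \<forall>T'\<in>ext T1 N1. \<not> occurs_at_least (log T') l v"]
      by (simp add: u_def)
    then obtain T' where "T' \<in> ext T1 N1" "occurs_at_least (log T') l u'" by blast
    from extend[OF sub this] obtain T2 N2 where T2: "sub T2 N2" "T2 \<in> ext T1 N1" "N1 < N2"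
      "\<forall>T'. good T' \<longrightarrow> agree N2 T2 T' \<longrightarrow> occurs_at_least (log T') l u'" by blast
    have "finite (occurrences (log T') l) \<and> card (occurrences (log T') l) = u'" if T': "T' \<in> ext T2 N2" for T'
    proof -
      have "T' \<in> ext T1 N1"
        using ext_subset[OF T2(2), of N2] T2(3) T' by auto
      then have "\<not> occurs_at_least (log T') l (Suc u')"
        using u u' by blast
      from not_occurs_at_least_Suc[OF this] have "finite (occurrences (log T') l)"
        "card (occurrences (log T') l) \<le> u'" .
      moreover have "occurs_at_least (log T') l u'"
        using T2(4) T' by (auto simp: ext_def)
      ultimately show ?thesis
        using occurs_at_least_le_card by fastforce
    qed
    then show ?thesis
      using T2(1) unfolding sub_def by blast
  next
    case False
    define P where "P v s \<longleftrightarrow> sub (fst s) (snd s) \<and> (v = (0 :: nat) \<longrightarrow> s = (T, N))" for v s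
    define Q where "Q v s s' \<longleftrightarrow> fst s' \<in> ext (fst s) (snd s) \<and> snd s < snd s' \<and> clean (fst s') (snd s') \<and>
      (\<forall>T'. good T' \<longrightarrow> agree (snd s') (fst s') T' \<longrightarrow> occurs_at_least (log T') l v)" for v s s'
    have "\<exists>f. \<forall>v. P v (f v) \<and> Q v (f v) (f (Suc v))"
    proof (rule dependent_nat_choice)
      show "\<exists>s. P 0 s"
        using good by (auto simp: P_def sub_def ext_refl)
      fix s v assume "P v s"
      then have sub: "sub (fst s) (snd s)" by (simp add: P_def)
      then obtain T' where "T' \<in> ext (fst s) (snd s)" "occurs_at_least (log T') l v"
        using False by blast
      from extend[OF sub this] obtain T2 N2 where "sub T2 N2" "Q v s (T2, N2)"
        by (auto simp: Q_def)
      then show "\<exists>s'. P (Suc v) s' \<and> Q v s s'"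
        by (intro exI[of _ "(T2, N2)"]) (simp add: P_def)
    qed
    then obtain f where f: "\<And>v. P v (f v)" "\<And>v. Q v (f v) (f (Suc v))" by auto
    define S where "S v = fst (f v)" for v
    define L where "L v = snd (f v)" for v
    have f0: "S 0 = T" "L 0 = N"
      using f(1)[of 0] by (simp_all add: P_def S_def L_def)
    have "\<exists>T1. (\<forall>v. agree (L v) (S v) T1) \<and> T1 \<in> ext (S 0) (L 0) \<and> card (paths T1) = card (paths T)"
    proof (rule ex_limit)
      show "S (Suc v) \<in> ext (S v) (L v)" "L v < L (Suc v)" "clean (S (Suc v)) (L (Suc v))" for v
        using f(2)[of v] by (simp_all add: Q_def S_def L_def)
      show "card (paths (S v)) = card (paths T)" for v
        using f(1)[of v] by (simp add: P_def sub_def S_def)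
    qed (use good inj f0 in simp_all)
    then obtain T1 where T1: "\<And>v. agree (L v) (S v) T1" "T1 \<in> ext T N" "card (paths T1) = card (paths T)"
      by (auto simp: f0)
    have "occurs_at_least (log T1) l v" for v
      using f(2)[of v] T1(1)[of "Suc v"] T1(2) by (simp add: Q_def S_def L_def ext_def)
    then have "infinite (occurrences (log T1) l)"
      using occurs_at_least_le_card[of "log T1" l "Suc (card (occurrences (log T1) l))"] by auto
    with T1 show ?thesis by blast
  qed
qed

text \<open>Bit N of y is flipped. The two halves share the first N bits, so the tree is unchanged
  up to level N, and one level higher they are told apart.\<close>

lemma ex_split:
  assumes good: "good T" and inj: "inj_on (prefix_of N) (paths T)" and y: "y \<in> paths T"
    and card: "card (paths T) \<le> n"
  shows "\<exists>T1 y'. T1 \<in> ext T N \<and> paths T1 = insert y' (paths T) \<and> y' \<notin> paths T \<and>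
     prefix_of N y' = prefix_of N y \<and> inj_on (prefix_of (Suc N)) (paths T1)"
proof -
  define y' where "y' = y(N := 1 - y N)"
  have y_cantor: "y \<in> cantor"
    using y by (simp add: paths_def)
  have neq: "y' N \<noteq> y N"
    using y_cantor by (auto simp: y'_def cantor_def less_2_cases_iff dest: spec[of _ N])
  have eq: "prefix_of s y' = prefix_of s y" if "s \<le> N" for s
    using that by (auto simp: prefix_of_eq_iff y'_def)
  have new: "y' \<notin> paths T"
    using inj_onD[OF inj eq[OF order_refl] _ y] neq by auto
  define T1 where "T1 = prune T N (insert y' (paths T))"
  have fin: "finite (paths T)"
    using good by (simp add: good_def)
  have paths: "paths T1 = insert y' (paths T)"
    unfolding T1_def
  proof (rule paths_prune)
    show "insert y' (paths T) \<subseteq> cantor"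
      using y_cantor by (auto simp: paths_def y'_def cantor_def)
    show "prefix_of s z \<in> T" if "z \<in> insert y' (paths T)" "s \<le> N" for z s
      using that y eq by (auto simp: paths_def)
  qed (use fin in simp)
  have "good T1"
    using fin card new by (simp add: good_def paths)
  moreover have "prefix_of N ` paths T1 = prefix_of N ` paths T"
    using y eq[OF order_refl] by (auto simp: paths)
  ultimately have "T1 \<in> ext T N"
    by (simp add: ext_def T1_def agree_prune)
  moreover have "inj_on (prefix_of (Suc N)) (insert y' (paths T))"
  proof -
    have "prefix_of (Suc N) y' \<noteq> prefix_of (Suc N) z" if z: "z \<in> paths T" for z
    proof
      assume *: "prefix_of (Suc N) y' = prefix_of (Suc N) z"
      then have "prefix_of N y = prefix_of N z"
        using prefix_of_mono[OF *, of N] eq[of N] by simp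
      then have "y = z"
        using inj y z by (auto dest: inj_onD)
      with * neq show False
        by (auto simp: prefix_of_eq_iff)
    qed
    then show ?thesis
      using inj_on_prefix_of_mono[OF inj, of "Suc N"] new by (auto simp: image_iff)
  qed
  ultimately show ?thesis
    using paths new eq[OF order_refl] by metis
qed

text \<open>The counts c are uniform over all extensions, so the sorted logs of any two of them
  share the blocks below l.\<close>

definition forced :: "nat \<Rightarrow> bool" where
  "forced l \<longleftrightarrow> (\<exists>T N c. good T \<and> inj_on (prefix_of N) (paths T) \<and> card (paths T) = Suc l \<and>
     (\<forall>T'\<in>ext T N. \<forall>i<l. finite (occurrences (log T') i) \<and> card (occurrences (log T') i) = c i))"

lemma forced_0: "forced 0"
proof -
  define T where "T = prune UNIV 0 {\<lambda>_. 0}"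
  have "paths T = {\<lambda>_. 0}"
    unfolding T_def by (rule paths_prune) (auto simp: cantor_def)
  then show ?thesis
    unfolding forced_def by (intro exI[of _ T]) (auto simp: good_def)
qed

text \<open>If symbol \<open>l\<close> can occur infinitely often, then \<open>K\<close> has to commit itself to one of the paths. Split
  this path. If symbol \<open>l\<close> can still occur infinitely often, then \<open>K\<close> commits itself to one of the two
  halves, and removing this half leaves enough paths to keep the counts of the symbols below \<open>l\<close>,
  so that the input of \<open>K\<close> is unchanged as far as it has been read.\<close>

lemma forced_Suc:
  assumes "forced l" "l < n"
  shows "forced (Suc l)"
proof -
  obtain T N c where T: "good T" "inj_on (prefix_of N) (paths T)" "card (paths T) = Suc l"
    and c: "\<And>T' i. T' \<in> ext T N \<Longrightarrow> i < l \<Longrightarrow> finite (occurrences (log T') i) \<and> card (occurrences (log T') i) = c i"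
    using assms(1) unfolding forced_def by auto
  \<comment> \<open>Extensions of (T, N) inherit the counts below l; what remains is to fix the
    count of l and to gain one path.\<close>
  have forcedI: "forced (Suc l)" if "T1 \<in> ext T N" "N \<le> N1" "inj_on (prefix_of N1) (paths T1)"
    "card (paths T1) = Suc (Suc l)" "\<And>T'. T' \<in> ext T1 N1 \<Longrightarrow>
      finite (occurrences (log T') l) \<and> card (occurrences (log T') l) = d" for T1 N1 d
    unfolding forced_def
  proof (intro exI conjI ballI allI impI)
    show "good T1" using that(1) by (simp add: ext_def)
    fix T' i assume *: "T' \<in> ext T1 N1" "i < Suc l"
    have "T' \<in> ext T N"
      using ext_subset[OF that(1,2)] *(1) by blast
    then show "finite (occurrences (log T') i)" "card (occurrences (log T') i) = (c(l := d)) i"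
      using c[of T' i] that(5)[OF *(1)] *(2) by (auto simp: less_Suc_eq)
  qed (use that in auto)
  \<comment> \<open>\<open>K\<close> reads finitely many sorted symbols: the common blocks below l,
    then copies of l. An extension of T that agrees with T1 far enough presents the same, even if
    its number of paths differs, so the answer is fixed to precision M.\<close>
  have commit: "\<exists>N1. \<forall>T'\<in>ext T N. agree N1 T1 T' \<longrightarrow> prefix_of M (answer T') = prefix_of M (answer T1)"
    if T1: "T1 \<in> ext T N" "infinite (occurrences (log T1) l)" for T1 M
  proof -
    have "good T1" using T1(1) by (simp add: ext_def)
    then obtain N0 where N0: "\<forall>T'. agree N0 T1 T' \<longrightarrow> good T' \<longrightarrow>
      (\<forall>k<N0. sort_seq (log T') k = sort_seq (log T1) k) \<longrightarrow> prefix_of M (answer T') = prefix_of M (answer T1)"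
      using answer_continuous[of T1 M] by blast
    obtain N1 where N1: "\<forall>T'. agree N1 T1 T' \<longrightarrow> good T' \<longrightarrow> occurs_at_least (log T') l N0"
      using occurs_at_least_continuous[OF \<open>good T1\<close> infinite_occurs_at_least[OF T1(2)], of N0] by blast
    have inf: "\<exists>s. infinite (occurrences (log T') s)" if "good T'" for T'
      using ex_infinite_occurrences[of "log T'" n] good_solved(2)[OF that] by (auto simp: less_imp_le)
    show ?thesis
    proof (intro exI ballI impI)
      fix T' assume T': "T' \<in> ext T N" "agree (max N0 N1) T1 T'"
      then have "good T'" "agree N0 T1 T'" "agree N1 T1 T'"
        using agree_le[OF T'(2)] by (auto simp: ext_def)
      moreover have "sort_seq (log T') k = sort_seq (log T1) k" if "k < N0" for k
        using inf[OF \<open>good T'\<close>] inf[OF \<open>good T1\<close>] c[OF T'(1)] c[OF T1(1)] N1 calculation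
          infinite_occurs_at_least[OF T1(2), of N0] that
        by (intro sort_seq_prefix_eq[of _ _ l N0]) auto
      ultimately show "prefix_of M (answer T') = prefix_of M (answer T1)"
        using N0 by blast
    qed
  qed
  from dichotomy[OF T(1,2), of l] show ?thesis
  proof (elim disjE exE conjE)
    fix T1 N1 d
    assume T1: "T1 \<in> ext T N" "N \<le> N1" "card (paths T1) = card (paths T)"
      and d: "\<forall>T'\<in>ext T1 N1. finite (occurrences (log T') l) \<and> card (occurrences (log T') l) = d"
    have "good T1" using T1(1) by (simp add: ext_def)
    then obtain y where y: "y \<in> paths T1" by (auto simp: good_def)
    have inj1: "inj_on (prefix_of N1) (paths T1)"
      using ext_inj_on[OF T1(1) T(2) T1(3)] T1(2) by (rule inj_on_prefix_of_mono)
    have "card (paths T1) \<le> n"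
      using T1(3) T(3) assms(2) by simp
    from ex_split[OF \<open>good T1\<close> inj1 y this] obtain T2 y' where T2: "T2 \<in> ext T1 N1" "paths T2 = insert y' (paths T1)" "y' \<notin> paths T1"
      "inj_on (prefix_of (Suc N1)) (paths T2)"
      by blast
    show ?thesis
    proof (rule forcedI[of T2 "Suc N1" d])
      show "T2 \<in> ext T N"
        using ext_subset[OF T1(1,2)] T2(1) by blast
      show "card (paths T2) = Suc (Suc l)"
        using \<open>good T1\<close> T2(2,3) T1(3) T(3) by (simp add: good_def)
      show "finite (occurrences (log T') l) \<and> card (occurrences (log T') l) = d" if "T' \<in> ext T2 (Suc N1)" for T'
        using d ext_subset[OF T2(1), of "Suc N1"] that by auto
    qed (use T1(2) T2(4) in auto)
  next
    fix T1
    assume T1: "T1 \<in> ext T N" "card (paths T1) = card (paths T)" "infinite (occurrences (log T1) l)"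
    have "good T1" using T1(1) by (simp add: ext_def)
    define y where "y = answer T1"
    have y: "y \<in> paths T1"
      unfolding y_def by (rule good_solved[OF \<open>good T1\<close>])
    obtain N1 where N1: "\<forall>T'\<in>ext T N. agree N1 T1 T' \<longrightarrow> prefix_of N (answer T') = prefix_of N y"
      using commit[OF T1(1,3), of N] unfolding y_def by blast
    define N3 where "N3 = max N N1"
    have inj1: "inj_on (prefix_of N3) (paths T1)"
      using ext_inj_on[OF T1(1) T(2) T1(2)] by (rule inj_on_prefix_of_mono) (simp add: N3_def)
    have "card (paths T1) \<le> n"
      using T1(2) T(3) assms(2) by simp
    from ex_split[OF \<open>good T1\<close> inj1 y this]
    obtain T2 y' where T2: "T2 \<in> ext T1 N3" "paths T2 = insert y' (paths T1)" "y' \<notin> paths T1"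
      "prefix_of N3 y' = prefix_of N3 y" "inj_on (prefix_of (Suc N3)) (paths T2)"
      by blast
    have "good T2" using T2(1) by (simp add: ext_def)
    have card2: "card (paths T2) = Suc (Suc l)"
      using \<open>good T1\<close> T2(2,3) T1(2) T(3) by (simp add: good_def)
    have sub1: "ext T1 N3 \<subseteq> ext T N"
      using T1(1) by (rule ext_subset) (simp add: N3_def)
    have sub2: "ext T2 (Suc N3) \<subseteq> ext T1 N3"
      using T2(1) by (rule ext_subset) simp
    from dichotomy[OF \<open>good T2\<close> T2(5), of l] show ?thesis
    proof (elim disjE exE conjE)
      fix T4 N4 d
      assume T4: "T4 \<in> ext T2 (Suc N3)" "Suc N3 \<le> N4" "card (paths T4) = card (paths T2)"
        and d: "\<forall>T'\<in>ext T4 N4. finite (occurrences (log T') l) \<and> card (occurrences (log T') l) = d"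
      have "inj_on (prefix_of N4) (paths T4)"
        using ext_inj_on[OF T4(1) T2(5) T4(3)] T4(2) by (rule inj_on_prefix_of_mono)
      moreover have "N \<le> N4" using T4(2) by (simp add: N3_def)
      ultimately show ?thesis
        using T4 d card2 sub1 sub2 by (intro forcedI[of T4 N4 d]) auto
    next
      fix T5
      assume T5: "T5 \<in> ext T2 (Suc N3)" "card (paths T5) = card (paths T2)" "infinite (occurrences (log T5) l)"
      have T5_ext: "T5 \<in> ext T1 N3" "T5 \<in> ext T N"
        using T5(1) sub1 sub2 by auto
      have "good T5" using T5(1) by (simp add: ext_def)
      define z where "z = answer T5"
      have z: "z \<in> paths T5"
        unfolding z_def by (rule good_solved[OF \<open>good T5\<close>])
      have "agree N1 T1 T5"
        using T5_ext(1) agree_le[of N3 T1 T5 N1] by (auto simp: ext_def N3_def)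
      then have zy: "prefix_of N z = prefix_of N y"
        using N1 T5_ext(2) by (simp add: z_def)
      obtain N6 where N6: "\<forall>T'\<in>ext T N. agree N6 T5 T' \<longrightarrow> prefix_of (Suc N3) (answer T') = prefix_of (Suc N3) z"
        using commit[OF T5_ext(2) T5(3), of "Suc N3"] unfolding z_def by blast
      define N7 where "N7 = max N6 N3"
      \<comment> \<open>The path z to which \<open>K\<close> is committed is removed. T6 has l + 1
        paths again; it no longer extends the condition of T2, but it still extends (T, N), which
        suffices for the counts below l.\<close>
      define T6 where "T6 = prune T5 N7 (paths T5 - {z})"
      have fin5: "finite (paths T5)" "card (paths T5) = Suc (Suc l)"
        using \<open>good T5\<close> T5(2) card2 by (simp_all add: good_def)
      have paths6: "paths T6 = paths T5 - {z}"
        unfolding T6_def using fin5(1) by (intro paths_prune) (auto simp: paths_def)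
      have card6: "card (paths T6) = Suc l"
        using fin5 z by (simp add: paths6)
      have "finite (paths T6)" "paths T6 \<noteq> {}"
        using fin5(1) card6 by (simp add: paths6, force)
      then have "good T6"
        using card6 assms(2) by (simp add: good_def)
      have agree6: "agree N7 T5 T6"
        unfolding T6_def by (rule agree_prune)
      \<comment> \<open>Both halves y and y' of the split path have continuations in T5, and both
        continue the word of length N below z. One continuation differs from z, so removing z loses
        no word of length N.\<close>
      have "\<exists>w\<in>paths T5 - {z}. prefix_of N w = prefix_of N z"
      proof -
        have image: "prefix_of (Suc N3) ` paths T5 = prefix_of (Suc N3) ` paths T2"
          using T5(1) by (simp add: ext_def)
        have "prefix_of (Suc N3) y \<in> prefix_of (Suc N3) ` paths T5"
          "prefix_of (Suc N3) y' \<in> prefix_of (Suc N3) ` paths T5"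
          unfolding image using y by (simp_all add: T2(2))
        then obtain w w' where w: "w \<in> paths T5" "prefix_of (Suc N3) w = prefix_of (Suc N3) y"
          "w' \<in> paths T5" "prefix_of (Suc N3) w' = prefix_of (Suc N3) y'" by (metis imageE)
        have "prefix_of (Suc N3) y \<noteq> prefix_of (Suc N3) y'"
          using T2(2,3,5) y by (metis inj_onD insertI1 insertI2)
        then have "w \<noteq> w'" using w by auto
        have "N \<le> N3" "N \<le> Suc N3" by (simp_all add: N3_def)
        then have "prefix_of N w = prefix_of N z" "prefix_of N w' = prefix_of N z"
          using prefix_of_mono[OF w(2), of N] prefix_of_mono[OF w(4), of N]
            prefix_of_mono[OF T2(4), of N] zy by simp_all
        with w \<open>w \<noteq> w'\<close> show ?thesis by auto
      qed
      then have "prefix_of N z \<in> prefix_of N ` (paths T5 - {z})"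
        by (metis imageI)
      moreover have "prefix_of N ` paths T5 = insert (prefix_of N z) (prefix_of N ` (paths T5 - {z}))"
        using z by (simp add: insert_absorb flip: image_insert)
      ultimately have "prefix_of N ` paths T6 = prefix_of N ` paths T5"
        by (simp add: paths6 insert_absorb)
      then have "T6 \<in> ext T5 N"
        using agree_le[OF agree6, of N] \<open>good T6\<close> by (simp add: ext_def N7_def N3_def)
      then have "T6 \<in> ext T N"
        using ext_subset[OF T5_ext(2), of N] by auto
      moreover have "agree N6 T5 T6"
        using agree6 by (rule agree_le) (simp add: N7_def)
      \<comment> \<open>The answer for T6 agrees with z in N3 + 1 bits, yet it is another path of
        T5, and the paths of T5 are separated by these bits.\<close>
      ultimately have "prefix_of (Suc N3) (answer T6) = prefix_of (Suc N3) z"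
        using N6 by blast
      moreover have "answer T6 \<in> paths T5 - {z}"
        using good_solved(4)[OF \<open>good T6\<close>] by (simp add: paths6)
      moreover have "inj_on (prefix_of (Suc N3)) (paths T5)"
        by (rule ext_inj_on[OF T5(1) T2(5) T5(2)])
      ultimately show ?thesis
        using z by (auto dest: inj_onD)
    qed
  qed
qed

lemma contradiction: False
proof -
  have "l \<le> n \<Longrightarrow> forced l" for l
    by (induction l) (auto intro: forced_0 forced_Suc)
  then obtain T N c where T: "good T" and c: "\<forall>T'\<in>ext T N. \<forall>i<n. finite (occurrences (log T') i) \<and>
      card (occurrences (log T') i) = c i"
    unfolding forced_def by blast
  then have "finite (\<Union>i<n. occurrences (log T) i)"
    using ext_refl by blast
  moreover have "(\<Union>i<n. occurrences (log T) i) = UNIV"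
    using good_solved(2)[OF T] by (auto simp: occurrences_def)
  ultimately show False by simp
qed

end

theorem not_finite_choice_le_Sort: "\<not> cont_le (finite_choice (n + 1)) (Sort n)"
proof
  assume "cont_le (finite_choice (n + 1)) (Sort n)"
  then obtain H K where HK: "cont_map H" "cont_map K" "\<And>G. G \<turnstile> Sort n \<Longrightarrow>
      (\<lambda>p. Option.bind (H p) (\<lambda>h. Option.bind (G h) (\<lambda>q. K (pairing p q)))) \<turnstile> finite_choice (n + 1)"
    unfolding cont_le_def by auto
  \<comment> \<open>G is undefined outside the domain of sorting, so a successful run of the
    reduction shows that \<open>H\<close> produced symbols below n.\<close>
  define G where "G p = (if \<forall>t. p t < n then Some (sort_seq p) else None)" for p
  have "G \<turnstile> Sort n"
    unfolding realizes_def
  proof (intro allI impI)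
    fix p x assume "source (Sort n) p = Some x \<and> val (Sort n) x \<noteq> {}"
    then have x: "x = p" "\<forall>t. p t < n"
      by (auto simp: Sort_def words_def split: if_splits)
    then have n: "n > 0" by auto
    have "sort_seq p t \<le> n - 1" for t
      using x(2) n by (intro sort_seq_le) (simp add: Suc_le_eq flip: less_Suc_eq_le)
    then have "\<forall>t. sort_seq p t < n"
      using n by (metis Suc_pred' less_Suc_eq_le)
    with x show "\<exists>q y. G p = Some q \<and> target (Sort n) q = Some y \<and> y \<in> val (Sort n) x"
      by (simp add: G_def Sort_def words_def)
  qed
  from HK(3)[OF this] have real:
    "(\<lambda>p. Option.bind (H p) (\<lambda>h. Option.bind (G h) (\<lambda>q. K (pairing p q)))) \<turnstile> finite_choice (n + 1)" .
  interpret choice_by_sorting n H K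
  proof
    fix p A assume A: "closed_name (words 2) p A" "finite A" "A \<noteq> {}" "card A \<le> n + 1"
    then have "1 \<le> card A"
      by (simp add: Suc_le_eq card_gt_0_iff)
    with A have "source (finite_choice (n + 1)) p = Some A" "val (finite_choice (n + 1)) A = A"
      by (simp_all add: finite_choice_def restrict_problem_def closed_choice_def closed_sets_eq_Some)
    with real A(3) obtain y z where "Option.bind (H p) (\<lambda>h. Option.bind (G h) (\<lambda>q. K (pairing p q))) = Some y"
      "target (finite_choice (n + 1)) y = Some z" "z \<in> A"
      unfolding realizes_def by metis
    then show "\<exists>h y. H p = Some h \<and> (\<forall>t. h t < n) \<and> K (pairing p (sort_seq h)) = Some y \<and> y \<in> A"
      by (auto simp: bind_eq_Some_conv G_def finite_choice_def restrict_problem_def closed_choice_def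
          words_2_eq_Some split: if_splits)
  qed (fact HK)+
  show False by (rule contradiction)
qed

section \<open>Monotonicity in the parameters and the equivalence\<close>

lemma weihrauch_le_left_mono:
  assumes "f \<le>\<^sub>W g" "\<And>F. F \<turnstile> f \<Longrightarrow> F \<turnstile> f'"
  shows "f' \<le>\<^sub>W g"
  using assms unfolding weihrauch_le_def by blast

lemma weihrauch_le_right_mono:
  assumes "f \<le>\<^sub>W g" "\<And>G. G \<turnstile> g' \<Longrightarrow> G \<turnstile> g"
  shows "f \<le>\<^sub>W g'"
  using assms unfolding weihrauch_le_def by blast

lemma realizes_finite_choice_mono:
  assumes F: "F \<turnstile> finite_choice m" and "l \<le> m"
  shows "F \<turnstile> finite_choice l"
  unfolding realizes_def
proof (intro allI impI)
  fix p A assume A: "source (finite_choice l) p = Some A \<and> val (finite_choice l) A \<noteq> {}"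
  then have "val (finite_choice m) A = A" "val (finite_choice l) A = A"
    using assms(2) by (auto simp: finite_choice_def restrict_problem_def closed_choice_def split: if_splits)
  moreover have "source (finite_choice m) = source (finite_choice l)"
    "target (finite_choice m) = target (finite_choice l)"
    by (simp_all add: finite_choice_def restrict_problem_def closed_choice_def)
  ultimately show "\<exists>q y. F p = Some q \<and> target (finite_choice l) q = Some y \<and> y \<in> val (finite_choice l) A"
    using F A unfolding realizes_def by metis
qed

lemma realizes_Sort_mono:
  assumes G: "G \<turnstile> Sort (k + 1)" and "j \<le> k"
  shows "G \<turnstile> Sort (j + 1)"
  unfolding realizes_def
proof (intro allI impI)
  fix p x assume "source (Sort (j + 1)) p = Some x \<and> val (Sort (j + 1)) x \<noteq> {}"
  then have x: "x = p" "\<And>t. p t < j + 1"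
    by (auto simp: Sort_def words_def split: if_splits)
  then have "source (Sort (k + 1)) p = Some p" "val (Sort (k + 1)) p \<noteq> {}"
    using assms(2) by (auto simp: Sort_def words_def intro: less_le_trans)
  then obtain q y where "G p = Some q" "target (Sort (k + 1)) q = Some y" "y \<in> val (Sort (k + 1)) p"
    using G unfolding realizes_def by blast
  then have "G p = Some (sort_seq p)"
    by (simp add: Sort_def words_def split: if_splits)
  moreover have "sort_seq p t < j + 1" for t
    using sort_seq_le[of p j t] x(2) by (auto simp: less_Suc_eq_le)
  ultimately show "\<exists>q y. G p = Some q \<and> target (Sort (j + 1)) q = Some y \<and> y \<in> val (Sort (j + 1)) x"
    using x(1) by (simp add: Sort_def words_def)
qed

lemma finite_choice_weihrauch_le_mono:
  assumes "finite_choice m \<le>\<^sub>W g" "l \<le> m"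
  shows "finite_choice l \<le>\<^sub>W g"
  by (rule weihrauch_le_left_mono[OF assms(1)]) (erule realizes_finite_choice_mono[OF _ assms(2)])

theorem mainTheorem1:
  fixes i j k :: nat
  assumes "1 \<le> i" and "1 \<le> j" and "1 \<le> k"
  shows "(finite_choice (i + 1) \<le>\<^sub>W XC j \<and> XC j \<le>\<^sub>W Sort (k + 1)) \<longleftrightarrow> (i \<le> j \<and> j \<le> k)"
proof
  assume le: "finite_choice (i + 1) \<le>\<^sub>W XC j \<and> XC j \<le>\<^sub>W Sort (k + 1)"
  \<comment> \<open>Both inequalities follow by chaining through \<open>XC j\<close>: m = j + 1 and
    \<open>XC_le_Sort\<close> if j < i, m = k + 1 and \<open>finite_choice_le_XC\<close> if k <
    j.\<close>
  have not_le: False if "finite_choice (m + 1) \<le>\<^sub>W XC j" "XC j \<le>\<^sub>W Sort m" for m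
  proof -
    have "cont_le (finite_choice (m + 1)) (Sort m)"
      by (rule cont_le_trans[of _ "XC j"]) (rule weihrauch_le_imp_cont_le, fact that)+
    with not_finite_choice_le_Sort show False ..
  qed
  show "i \<le> j \<and> j \<le> k"
  proof (intro conjI; rule ccontr)
    assume "\<not> i \<le> j"
    then have "finite_choice (j + 1 + 1) \<le>\<^sub>W XC j"
      by (intro finite_choice_weihrauch_le_mono[OF conjunct1[OF le]]) simp
    then show False
      using XC_le_Sort[OF assms(2)] by (rule not_le)
  next
    assume "\<not> j \<le> k"
    then have "finite_choice (k + 1 + 1) \<le>\<^sub>W XC j"
      by (intro finite_choice_weihrauch_le_mono[OF finite_choice_le_XC[OF assms(2)]]) simp
    then show False
      using conjunct2[OF le] by (rule not_le)
  qed
next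
  assume le: "i \<le> j \<and> j \<le> k"
  have "finite_choice (i + 1) \<le>\<^sub>W XC j"
    by (rule finite_choice_weihrauch_le_mono[OF finite_choice_le_XC[OF assms(2)]]) (simp add: le)
  moreover have "XC j \<le>\<^sub>W Sort (k + 1)"
    by (rule weihrauch_le_right_mono[OF XC_le_Sort[OF assms(2)]])
      (erule realizes_Sort_mono, simp add: le)
  ultimately show "finite_choice (i + 1) \<le>\<^sub>W XC j \<and> XC j \<le>\<^sub>W Sort (k + 1)" ..
qed

end
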